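(* Let $n\ge 2$, $t\ge 3$, $\Lambda=PG(2n-1,q^t)$, $\Sigma^*=PG(tn-1,q^t)$ containing $\Lambda$, and $\Sigma=\mathrm{Fix}(\Psi)\cong PG(tn-1,q)$ where $\Psi$ is a semilinear collineation of $\Sigma^*$ of order $t$. Let $L$ be a scattered $\mathbb{F}_q$-linear set of $\Lambda$ of pseudoregulus type with associated pseudoregulus $\mathcal P$, and suppose $L=p_{\Gamma,\Lambda}(\Sigma)$ for an $(n(t-2)-1)$-dimensional subspace $\Gamma$ of $\Sigma^*$ disjoint from $\Sigma$ and from $\Lambda$. Then: (i) the set $\mathcal D_L=\{\langle\Gamma,s\rangle_{q^t}\cap\Sigma: s\in\mathcal P\}$ is a Desarguesian $(t-1)$-spread of $\Sigma$; (ii) there exist a director space $\bar\Theta$ of $\mathcal D_L$ and an integer $m$ with $\gcd(m,t)=1$ such that, with $\tau=\Psi^m$, $$\Gamma=\langle\bar\Theta,\bar\Theta^{\tau},\dots,\bar\Theta^{\tau^{t-3}}\rangle_{q^t}.$$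
   Context: Projection: $p_{\Gamma,\Lambda}(\Sigma)=\{\langle\Gamma,P\rangle_{q^t}\cap\Lambda:P\in\Sigma\}$. Desarguesian spreads: if $\Theta$ is an $(n-1)$-dimensional subspace of $\Sigma^*$ such that $\Theta,\Theta^\Psi,\dots,\Theta^{\Psi^{t-1}}$ span $\Sigma^*$, then $\mathcal D(\Theta)=\{\langle P,P^\Psi,\dots,P^{\Psi^{t-1}}\rangle_{q^t}\cap\Sigma:P\in\Theta\}$ is a $(t-1)$-spread of $\Sigma$ (partition of its points into $(t-1)$-dimensional subspaces) called Desarguesian, and $\Theta^{\Psi^i}$, $i=0,\dots,t-1$, are its director spaces. For an $\mathbb{F}_q$-subspace $U$ of the underlying $\mathbb{F}_{q^t}$-space, $L_U=\{\langle\mathbf u\rangle_{q^t}:\mathbf u\in U\setminus\{\mathbf 0\}\}$ has rank $\dim_{\mathbb F_q}U$, the weight of $PG(W,\mathbb{F}_{q^t})$ in $L_U$ is $\dim_{\mathbb F_q}(W\cap U)$, and $L_U$ is scattered if all points have weight 1. Pseudoregulus type: for $t,n\ge 2$, a scattered $\mathbb{F}_q$-linear set $L$ of $PG(2n-1,q^t)$ of rank $tn$ such that (i) there exist $(q^{nt}-1)/(q^t-1)$ pairwise disjoint lines each of weight $t$ in $L$, and (ii) there exist exactly two $(n-1)$-dimensional subspaces $T_1,T_2$ disjoint from $L$ meeting each of these lines; the set of these lines is the pseudoregulus associated with $L$. *)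

theory Defs
  imports "HOL-Computational_Algebra.Primes" "HOL-Library.Cardinality"
begin

text \<open>Underlying vector space of the ambient projective space: vectors with
  coordinates in a finite field 'a, supported on indices below N (so K^N).
  Projective subspaces are represented by their underlying K-subspaces.\<close>

definition vecs :: "nat \<Rightarrow> (nat \<Rightarrow> 'a::field) set" where
  "vecs N = {v. \<forall>i\<ge>N. v i = 0}"

definition vadd :: "(nat \<Rightarrow> 'a::field) \<Rightarrow> (nat \<Rightarrow> 'a) \<Rightarrow> (nat \<Rightarrow> 'a)" where
  "vadd v w = (\<lambda>i. v i + w i)"

definition smul :: "'a::field \<Rightarrow> (nat \<Rightarrow> 'a) \<Rightarrow> (nat \<Rightarrow> 'a)" where
  "smul a v = (\<lambda>i. a * v i)"

definition zvec :: "nat \<Rightarrow> 'a::field" where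
  "zvec = (\<lambda>i. 0)"

definition subsp_over :: "'a::field set \<Rightarrow> nat \<Rightarrow> (nat \<Rightarrow> 'a) set \<Rightarrow> bool" where
  "subsp_over F N S \<longleftrightarrow> S \<subseteq> vecs N \<and> zvec \<in> S \<and>
     (\<forall>v\<in>S. \<forall>w\<in>S. vadd v w \<in> S) \<and> (\<forall>a\<in>F. \<forall>v\<in>S. smul a v \<in> S)"

abbreviation ksub :: "nat \<Rightarrow> (nat \<Rightarrow> 'a::field) set \<Rightarrow> bool" where
  "ksub N S \<equiv> subsp_over UNIV N S"

definition kspan :: "nat \<Rightarrow> (nat \<Rightarrow> 'a::field) set \<Rightarrow> (nat \<Rightarrow> 'a) set" where
  "kspan N X = \<Inter>{S. ksub N S \<and> X \<subseteq> S}"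

text \<open>Points of PG(N-1,K): 1-dimensional K-subspaces (K finite, so dimension d
  of a subspace S is expressed as card S = |K|^d).\<close>
definition is_point :: "nat \<Rightarrow> (nat \<Rightarrow> 'a::{field,finite}) set \<Rightarrow> bool" where
  "is_point N P \<longleftrightarrow> ksub N P \<and> card P = CARD('a)"

definition subfield_q :: "nat \<Rightarrow> 'a::field set" where
  "subfield_q q = {x. x ^ q = x}"

definition lin_set :: "nat \<Rightarrow> (nat \<Rightarrow> 'a::field) set \<Rightarrow> (nat \<Rightarrow> 'a) set set" where
  "lin_set N U = {kspan N {u} | u. u \<in> U \<and> u \<noteq> zvec}"

definition scattered :: "nat \<Rightarrow> nat \<Rightarrow> (nat \<Rightarrow> 'a::field) set \<Rightarrow> bool" where
  "scattered q N U \<longleftrightarrow> (\<forall>u \<in> U - {zvec}. card (kspan N {u} \<inter> U) = q)"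

definition pseudoregulus ::
  "nat \<Rightarrow> nat \<Rightarrow> nat \<Rightarrow> nat \<Rightarrow> (nat \<Rightarrow> 'a::{field,finite}) set \<Rightarrow> (nat \<Rightarrow> 'a) set
     \<Rightarrow> (nat \<Rightarrow> 'a) set set \<Rightarrow> bool" where
  "pseudoregulus q N t n W U PR \<longleftrightarrow>
     (\<forall>s\<in>PR. ksub N s \<and> s \<subseteq> W \<and> card s = CARD('a) ^ 2 \<and> card (s \<inter> U) = q ^ t)
   \<and> card PR = (q ^ (n * t) - 1) div (q ^ t - 1)
   \<and> (\<forall>s\<in>PR. \<forall>s'\<in>PR. s \<noteq> s' \<longrightarrow> s \<inter> s' = {zvec})
   \<and> card {T. ksub N T \<and> T \<subseteq> W \<and> card T = CARD('a) ^ n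
              \<and> (\<forall>P\<in>lin_set N U. \<not> P \<subseteq> T) \<and> (\<forall>s\<in>PR. s \<inter> T \<noteq> {zvec})} = 2"

text \<open>f is a semilinear bijection of K^N with companion field automorphism \<sigma>;
  it induces the collineation S \<mapsto> f ` S.\<close>
definition semilinear :: "nat \<Rightarrow> ('a::field \<Rightarrow> 'a) \<Rightarrow> ((nat \<Rightarrow> 'a) \<Rightarrow> (nat \<Rightarrow> 'a)) \<Rightarrow> bool" where
  "semilinear N \<sigma> f \<longleftrightarrow> bij \<sigma> \<and> (\<forall>x y. \<sigma> (x + y) = \<sigma> x + \<sigma> y) \<and> (\<forall>x y. \<sigma> (x * y) = \<sigma> x * \<sigma> y)
     \<and> bij_betw f (vecs N) (vecs N)
     \<and> (\<forall>v\<in>vecs N. \<forall>w\<in>vecs N. f (vadd v w) = vadd (f v) (f w))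
     \<and> (\<forall>a. \<forall>v\<in>vecs N. f (smul a v) = smul (\<sigma> a) (f v))"

definition coll_order :: "nat \<Rightarrow> ((nat \<Rightarrow> 'a::{field,finite}) \<Rightarrow> (nat \<Rightarrow> 'a)) \<Rightarrow> nat \<Rightarrow> bool" where
  "coll_order N f t \<longleftrightarrow> (\<forall>P. is_point N P \<longrightarrow> (f ^^ t) ` P = P)
     \<and> (\<forall>k. 0 < k \<and> k < t \<longrightarrow> (\<exists>P. is_point N P \<and> (f ^^ k) ` P \<noteq> P))"

definition fixpts :: "nat \<Rightarrow> ((nat \<Rightarrow> 'a::{field,finite}) \<Rightarrow> (nat \<Rightarrow> 'a)) \<Rightarrow> (nat \<Rightarrow> 'a) set set" where
  "fixpts N f = {P. is_point N P \<and> f ` P = P}"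

definition canonical_subgeometry :: "nat \<Rightarrow> nat \<Rightarrow> (nat \<Rightarrow> 'a::{field,finite}) set set \<Rightarrow> bool" where
  "canonical_subgeometry q N Pts \<longleftrightarrow> (\<exists>V0. subsp_over (subfield_q q) N V0 \<and> card V0 = q ^ N
       \<and> kspan N V0 = vecs N \<and> Pts = lin_set N V0)"

definition sigma_part :: "nat \<Rightarrow> ((nat \<Rightarrow> 'a::{field,finite}) \<Rightarrow> (nat \<Rightarrow> 'a)) \<Rightarrow> (nat \<Rightarrow> 'a) set \<Rightarrow> (nat \<Rightarrow> 'a) set set" where
  "sigma_part N f Y = {P \<in> fixpts N f. P \<subseteq> Y}"

definition director_ok :: "nat \<Rightarrow> ((nat \<Rightarrow> 'a::{field,finite}) \<Rightarrow> (nat \<Rightarrow> 'a)) \<Rightarrow> nat \<Rightarrow> nat \<Rightarrow> (nat \<Rightarrow> 'a) set \<Rightarrow> bool" where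
  "director_ok N f t n \<Theta> \<longleftrightarrow> ksub N \<Theta> \<and> card \<Theta> = CARD('a) ^ n
      \<and> kspan N (\<Union>i<t. (f ^^ i) ` \<Theta>) = vecs N"

definition desarg_spread :: "nat \<Rightarrow> ((nat \<Rightarrow> 'a::{field,finite}) \<Rightarrow> (nat \<Rightarrow> 'a)) \<Rightarrow> nat \<Rightarrow> (nat \<Rightarrow> 'a) set \<Rightarrow> (nat \<Rightarrow> 'a) set set set" where
  "desarg_spread N f t \<Theta> =
     {sigma_part N f (kspan N (\<Union>i<t. (f ^^ i) ` P)) | P. is_point N P \<and> P \<subseteq> \<Theta>}"

definition is_desarguesian :: "nat \<Rightarrow> ((nat \<Rightarrow> 'a::{field,finite}) \<Rightarrow> (nat \<Rightarrow> 'a)) \<Rightarrow> nat \<Rightarrow> nat \<Rightarrow> (nat \<Rightarrow> 'a) set set set \<Rightarrow> bool" where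
  "is_desarguesian N f t n D \<longleftrightarrow> (\<exists>\<Theta>. director_ok N f t n \<Theta> \<and> D = desarg_spread N f t \<Theta>)"

definition is_director_space :: "nat \<Rightarrow> ((nat \<Rightarrow> 'a::{field,finite}) \<Rightarrow> (nat \<Rightarrow> 'a)) \<Rightarrow> nat \<Rightarrow> nat \<Rightarrow> (nat \<Rightarrow> 'a) set set set \<Rightarrow> (nat \<Rightarrow> 'a) set \<Rightarrow> bool" where
  "is_director_space N f t n D \<Theta>b \<longleftrightarrow>
     (\<exists>\<Theta> i. director_ok N f t n \<Theta> \<and> D = desarg_spread N f t \<Theta> \<and> i < t \<and> \<Theta>b = (f ^^ i) ` \<Theta>)"

definition proj :: "nat \<Rightarrow> ((nat \<Rightarrow> 'a::{field,finite}) \<Rightarrow> (nat \<Rightarrow> 'a)) \<Rightarrow> (nat \<Rightarrow> 'a) set \<Rightarrow> (nat \<Rightarrow> 'a) set \<Rightarrow> (nat \<Rightarrow> 'a) set set" where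
  "proj N f \<Gamma> W = {kspan N (\<Gamma> \<union> P) \<inter> W | P. P \<in> fixpts N f}"

definition DL :: "nat \<Rightarrow> ((nat \<Rightarrow> 'a::{field,finite}) \<Rightarrow> (nat \<Rightarrow> 'a)) \<Rightarrow> (nat \<Rightarrow> 'a) set \<Rightarrow> (nat \<Rightarrow> 'a) set set \<Rightarrow> (nat \<Rightarrow> 'a) set set set" where
  "DL N f \<Gamma> PR = {sigma_part N f (kspan N (\<Gamma> \<union> s)) | s. s \<in> PR}"

end

theory Submission
  imports Defs "HOL-Number_Theory.Residues" "HOL-Computational_Algebra.Polynomial"
    "HOL-Library.Function_Algebras" "HOL-Library.Set_Algebras" "HOL-Library.FuncSet"
begin

text \<open>
  After rescaling, \<open>\<Psi>\<close> is a \<open>\<sigma>\<close>-semilinear map of \<open>V = K\<^sup>t\<^sup>n\<close> whose fixed vectors form \<open>V0\<close>, where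
  \<open>\<sigma>\<close> generates the Galois group of \<open>K\<close> over \<open>F\<^sub>q\<close>. Counting points shows that \<open>V0\<close> meets
  \<open>\<Gamma> + s\<close> in \<open>q\<^sup>t\<close> vectors for each line \<open>s\<close> of the pseudoregulus, and \<open>H\<^sub>i = \<Gamma> + T\<^sub>i\<close> only in \<open>0\<close>, for
  the transversals \<open>T\<^sub>1\<close>, \<open>T\<^sub>2\<close>. So \<open>V0\<close> is a complement of each \<open>H\<^sub>i\<close> and inherits from \<open>V / H\<^sub>i\<close> a structure
  of \<open>K\<close>-space, whose one-dimensional subspaces are the \<open>(\<Gamma> + s) \<inter> V0\<close>. The two structures thus differ by a field
  automorphism \<open>\<alpha> = \<sigma>\<^sup>j\<close>, and since \<open>V0\<close> spans \<open>V\<close>, this means \<open>\<Psi>\<^sup>j H\<^sub>1 = H\<^sub>2\<close>. A trace argument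
  shows that the conjugates of \<open>H\<^sub>1\<close> meet in \<open>0\<close>. Hence \<open>V\<close> is the direct sum of the conjugates of the
  intersection \<open>\<Theta>\<close> of all \<open>\<Psi>\<^sup>k H\<^sub>1\<close> with \<open>0 < k < t\<close>, and \<open>\<Gamma> = H\<^sub>1 \<inter> \<Psi>\<^sup>j H\<^sub>1\<close> is the sum of the
  \<open>\<Psi>\<^sup>i \<Theta>\<close> with \<open>i \<noteq> 0, j\<close>. That \<open>j\<close> is coprime to \<open>t\<close> follows from scatteredness.
\<close>

section \<open>Automorphisms of finite fields\<close>

text \<open>Vectors over \<open>K\<close>, fixed vectors over the field with \<open>q\<close>
  elements and points all interact, so dimensions are replaced throughout by sizes of additive
  groups. The formula |A| |B| = |A + B| |A \<inter> B| also applies when A is a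
  \<open>K\<close>-subspace and B a set of fixed vectors.

  The equation between \<open>L\<close> and the projection of \<Sigma> compares points only; no
  linear map from \<open>V0\<close> to \<open>U\<close> is given. Weights therefore pass from one to
  the other by counting points, each of which carries \<open>q - 1\<close> nonzero vectors on either
  side.

  \<open>\<Gamma>\<close> alone gives \<open>V0\<close> no \<open>K\<close>-structure: its
  codimension 2n is too large. Adding a transversal lowers the codimension to n, and then the
  quotient has exactly as many vectors as \<open>V0\<close>. The two structures share their lines,
  and \<open>n \<ge> 2\<close> provides enough lines for the argument of the fundamental theorem of
  projective geometry. They are compared by a power of \<open>\<Psi>\<close> because
  \<open>\<Psi>\<close> fixes \<open>V0\<close> pointwise: on multiples of fixed vectors it changes
  nothing but the scalar.\<close>

lemma finite_field_generator:
  "\<exists>w::'a::{field,finite}. w \<noteq> 0 \<and> (\<forall>x. x \<noteq> 0 \<longrightarrow> (\<exists>i::nat. x = w ^ i))"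
proof -
  \<comment> \<open>Cyclicity of the multiplicative group is a theorem about ring records, so the
    type is repackaged as one.\<close>
  define R :: "'a ring" where "R = \<lparr>carrier = UNIV, mult = (*), one = 1, zero = 0, add = (+)\<rparr>"
  interpret R: field R
  proof (intro cring.cring_fieldI2 cringI abelian_groupI comm_monoidI)
    show "\<exists>y\<in>carrier R. y \<oplus>\<^bsub>R\<^esub> x = \<zero>\<^bsub>R\<^esub>" for x
      by (auto simp: R_def intro: exI[of _ "- x"])
    show "\<exists>y\<in>carrier R. x \<otimes>\<^bsub>R\<^esub> y = \<one>\<^bsub>R\<^esub>" if "x \<noteq> \<zero>\<^bsub>R\<^esub>" for x
      using that by (auto simp: R_def intro: exI[of _ "inverse x"])
  qed (auto simp: R_def algebra_simps)
  have pw: "x [^]\<^bsub>R\<^esub> (i::nat) = x ^ i" for x i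
    by (induction i) (simp_all add: nat_pow_def R_def mult.commute)
  have c: "carrier R = UNIV" and z: "\<zero>\<^bsub>R\<^esub> = 0"
    by (simp_all add: R_def)
  obtain a where a: "a \<in> carrier (mult_of R)"
     "carrier (mult_of R) = {a [^]\<^bsub>R\<^esub> i | i::nat. i \<in> UNIV}"
    using R.finite_field_mult_group_has_gen c by auto
  have m: "carrier (mult_of R) = - {0}" using c z by (auto simp: carrier_mult_of)
  have "a \<noteq> 0" using a(1) unfolding m by simp
  moreover have "\<exists>i::nat. x = a ^ i" if "x \<noteq> 0" for x
  proof -
    have "x \<in> {a [^]\<^bsub>R\<^esub> i | i::nat. i \<in> UNIV}" unfolding a(2)[symmetric] m using that by simp
    then show ?thesis unfolding pw by simp
  qed
  ultimately show ?thesis by (intro exI[of _ a]) simp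
qed

lemma power_card_minus_1:
  fixes x :: "'a::{field,finite}"
  assumes "x \<noteq> 0"
  shows "x ^ (CARD('a) - 1) = 1"
proof -
  let ?A = "UNIV - {0::'a}"
  have "(\<Prod>y\<in>?A. x * y) = (\<Prod>y\<in>?A. y)"
    by (rule prod.reindex_bij_witness[of _ "\<lambda>y. y / x" "\<lambda>y. x * y"]) (use assms in auto)
  then have "x ^ card ?A * (\<Prod>y\<in>?A. y) = (\<Prod>y\<in>?A. y)"
    by (simp add: prod.distrib)
  moreover have "(\<Prod>y\<in>?A. y) \<noteq> 0" by simp
  ultimately have "x ^ card ?A = 1" by simp
  then show ?thesis by (simp add: card_Diff_subset)
qed

lemma power_card_eq_self: "(x::'a::{field,finite}) ^ CARD('a) = x"
proof (cases "x = 0")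
  case False
  have "x ^ Suc (CARD('a) - 1) = x" unfolding power_Suc power_card_minus_1[OF False] by simp
  moreover have "Suc (CARD('a) - 1) = CARD('a)" by (simp add: card_gt_0_iff)
  ultimately show ?thesis by argo
qed (simp add: card_gt_0_iff zero_power)

text \<open>Reducing exponents modulo \<open>CARD('a) - 1\<close> shows that the powers in this
  range already cover all \<open>CARD('a) - 1\<close> nonzero elements, so no two of them
  coincide.\<close>

lemma generator_power_inj:
  fixes w :: "'a::{field,finite}"
  assumes w: "w \<noteq> 0" "\<And>x. x \<noteq> 0 \<Longrightarrow> \<exists>i::nat. x = w ^ i"
    and ab: "w ^ a = w ^ b" "a < CARD('a) - 1" "b < CARD('a) - 1"
  shows "a = b"
proof -
  let ?Q = "CARD('a) - 1"
  have w1: "w ^ ?Q = 1" by (rule power_card_minus_1[OF w(1)])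
  have Qpos: "?Q > 0" using ab by simp
  have "x \<in> (\<lambda>i. w ^ i) ` {..<?Q}" if x: "x \<in> - {0}" for x
  proof -
    obtain i where i: "x = w ^ i" using w(2) x by auto
    have "w ^ i = w ^ (i mod ?Q + ?Q * (i div ?Q))" by simp
    also have "\<dots> = w ^ (i mod ?Q)" by (simp only: power_add power_mult w1 power_one mult_1_right)
    finally show ?thesis unfolding i using Qpos by (intro image_eqI[of _ _ "i mod ?Q"]) auto
  qed
  then have "- {0} \<subseteq> (\<lambda>i. w ^ i) ` {..<?Q}" by blast
  then have "card (- {0::'a}) \<le> card ((\<lambda>i. w ^ i) ` {..<?Q})" by (simp add: card_mono)
  moreover have "card (- {0::'a}) = ?Q" by (simp add: Compl_eq_Diff_UNIV card_Diff_subset)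
  moreover have "card ((\<lambda>i. w ^ i) ` {..<?Q}) \<le> ?Q"
    using card_image_le[of "{..<?Q}" "\<lambda>i. w ^ i"] by simp
  ultimately have "inj_on (\<lambda>i. w ^ i) {..<?Q}" by (intro eq_card_imp_inj_on) auto
  then show ?thesis by (rule inj_onD) (use ab in auto)
qed

text \<open>Injectivity excludes the zero map; on a finite field it also gives bijectivity.\<close>

definition field_auto :: "('a::field \<Rightarrow> 'a) \<Rightarrow> bool" where
  "field_auto g \<longleftrightarrow> inj g \<and> (\<forall>x y. g (x + y) = g x + g y) \<and> (\<forall>x y. g (x * y) = g x * g y)"

lemma field_autoD:
  assumes "field_auto g"
  shows "g (x + y) = g x + g y" "g (x * y) = g x * g y" "g 0 = 0" "g 1 = 1"
    "g x = g y \<longleftrightarrow> x = y" "g (- x) = - g x" "g (x - y) = g x - g y" "g (x ^ k) = g x ^ k"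
    "g x = 0 \<longleftrightarrow> x = 0"
proof -
  show add: "g (x + y) = g x + g y" for x y using assms by (simp add: field_auto_def)
  show mult: "g (x * y) = g x * g y" for x y using assms by (simp add: field_auto_def)
  show inj: "g x = g y \<longleftrightarrow> x = y" for x y
    using assms by (auto simp: field_auto_def inj_eq)
  show z: "g 0 = 0" using add[of 0 0] unfolding add_0_left add_cancel_right_right .
  show nz: "g x = 0 \<longleftrightarrow> x = 0" for x using inj[of x 0] z by simp
  have "g 1 * g 1 = g 1 * 1" using mult[of 1 1, symmetric] by simp
  then show one: "g 1 = 1" unfolding mult_cancel_left using nz[of 1] by simp
  show neg: "g (- x) = - g x" for x 
    unfolding eq_neg_iff_add_eq_0 using add[of "- x" x, symmetric] z by simp
  show "g (x - y) = g x - g y" using add[of x "- y"] neg[of y] by simp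
  show "g (x ^ k) = g x ^ k" by (induction k) (simp_all add: one mult)
qed

lemma field_auto_comp: "field_auto g \<Longrightarrow> field_auto h \<Longrightarrow> field_auto (g \<circ> h)"
  by (simp add: field_auto_def inj_compose)

lemma field_auto_funpow: "field_auto g \<Longrightarrow> field_auto (g ^^ i)"
  by (induction i) (simp add: field_auto_def, simp add: field_auto_comp)

lemma field_auto_coeff_prod:
  assumes g: "field_auto g" and "finite A"
  shows "g (coeff (\<Prod>i\<in>A. [:- a i, 1:]) k) = coeff (\<Prod>i\<in>A. [:- g (a i), 1:]) k"
  using \<open>finite A\<close>
proof (induction A arbitrary: k rule: finite_induct)
  case empty
  then show ?case using field_autoD[OF g] by (simp add: one_pCons coeff_pCons split: nat.split)
next
  case (insert i A)
  have c: "coeff ([:- b, 1:] * p) k = - b * coeff p k + (case k of 0 \<Rightarrow> 0 | Suc k' \<Rightarrow> coeff p k')"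
    for b :: 'a and p k
    by (simp add: coeff_pCons split: nat.split)
  show ?case
    unfolding prod.insert[OF insert.hyps] c
    by (cases k) (simp_all add: field_autoD[OF g] insert.IH del: mult_pCons_left mult_pCons_right)
qed

text \<open>The product of the \<open>X - g\<^sup>i w\<close> over the orbit of a multiplicative generator \<open>w\<close> has
  coefficients fixed by \<open>g\<close>, hence by \<open>\<alpha>\<close>, so \<open>\<alpha>\<close> permutes its roots.\<close>

lemma field_auto_in_cyclic:
  fixes g \<alpha> :: "'a::{field,finite} \<Rightarrow> 'a"
  assumes g: "field_auto g" and r: "r > 0" "g ^^ r = id" and \<alpha>: "field_auto \<alpha>"
    and fixd: "\<And>x. g x = x \<Longrightarrow> \<alpha> x = x"
  shows "\<exists>i<r. \<alpha> = g ^^ i"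
proof -
  obtain w :: 'a where w: "w \<noteq> 0" "\<And>x. x \<noteq> 0 \<Longrightarrow> \<exists>i::nat. x = w ^ i"
    using finite_field_generator by auto
  define P where "P = (\<Prod>i<r. [:- (g ^^ i) w, 1:])"
  obtain r' where r': "r = Suc r'" using r(1) gr0_implies_Suc by blast
  \<comment> \<open>Applying \<open>g\<close> to the roots shifts the factors cyclically; the last
    one becomes the first because \<open>g ^^ r\<close> is the identity.\<close>
  have "(\<Prod>i<r. [:- g ((g ^^ i) w), 1:]) = (\<Prod>i<r'. [:- (g ^^ Suc i) w, 1:]) * [:- (g ^^ r) w, 1:]"
    by (simp add: r')
  also have "\<dots> = [:- (g ^^ 0) w, 1:] * (\<Prod>i<r'. [:- (g ^^ Suc i) w, 1:])"
    by (simp add: r(2) del: mult_pCons_left mult_pCons_right)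
  also have "\<dots> = P" unfolding P_def r' by (rule prod.lessThan_Suc_shift[symmetric])
  finally have gP: "(\<Prod>i<r. [:- g ((g ^^ i) w), 1:]) = P" .
  have "g (coeff P k) = coeff P k" for k
    using field_auto_coeff_prod[OF g, of "{..<r}" "\<lambda>i. (g ^^ i) w" k] gP by (simp add: P_def)
  then have "\<alpha> (coeff P k) = coeff P k" for k using fixd by blast
  then have "P = (\<Prod>i<r. [:- \<alpha> ((g ^^ i) w), 1:])"
    using field_auto_coeff_prod[OF \<alpha>, of "{..<r}" "\<lambda>i. (g ^^ i) w"]
    by (intro poly_eqI) (simp add: P_def)
  moreover have "poly (\<Prod>i<r. [:- \<alpha> ((g ^^ i) w), 1:]) (\<alpha> w) = 0"
    unfolding poly_prod using r(1) by (intro prod_zero) (auto intro!: bexI[of _ 0])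
  ultimately have "poly P (\<alpha> w) = 0" by simp
  then obtain i where i: "i < r" "\<alpha> w = (g ^^ i) w"
    by (auto simp: P_def poly_prod prod_zero_iff)
  have "\<alpha> x = (g ^^ i) x" for x
  proof (cases "x = 0")
    case True then show ?thesis
      using field_autoD(3)[OF \<alpha>] field_autoD(3)[OF field_auto_funpow[OF g]] by simp
  next
    case False
    then obtain k where "x = w ^ k" using w by auto
    then show ?thesis
      using i(2) field_autoD(8)[OF \<alpha>] field_autoD(8)[OF field_auto_funpow[OF g]] by simp
  qed
  then show ?thesis using i(1) by blast
qed

section \<open>Frobenius powers and subfields of a field with \<open>q ^ t\<close> elements\<close>

locale field_ext =
  fixes q t :: nat and K :: "'a::{field,finite} itself"
  assumes t_pos: "t > 0"
    and q_prime_power: "\<exists>p k. prime p \<and> k > 0 \<and> q = p ^ k"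
    and card_field: "CARD('a) = q ^ t"
begin

abbreviation Fq :: "'a set" where "Fq \<equiv> subfield_q q"

lemma q_ge_2: "q \<ge> 2"
  using q_prime_power by (metis prime_ge_2_nat self_le_power order_trans le_trans one_le_numeral)

lemma power_q_add: "(x + y :: 'a) ^ q = x ^ q + y ^ q"
proof -
  obtain p k where p: "prime p" "k > 0" "q = p ^ k" using q_prime_power by auto
  have "CHAR('a) dvd p ^ (k * t)"
    using CHAR_dvd_CARD[where ?'a='a] card_field p by (simp add: power_mult)
  moreover have pr: "prime CHAR('a)"
    by (rule prime_CHAR_semidom) (simp add: finite_imp_CHAR_pos)
  ultimately have "CHAR('a) = p" using p(1) by (metis prime_dvd_power primes_dvd_imp_eq)
  then show ?thesis using freshmans_dream'[where ?'a='a, of q k x y] pr p by simp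
qed

lemma field_auto_frob: "field_auto (\<lambda>x::'a. x ^ q)"
proof -
  have "x = y" if "x ^ q = y ^ q" for x y :: 'a
  proof -
    have "y ^ q = (x + (y - x)) ^ q" by simp
    also have "\<dots> = x ^ q + (y - x) ^ q" by (rule power_q_add)
    finally have "(y - x) ^ q = 0" using that by simp
    then show ?thesis by simp
  qed
  then have "inj (\<lambda>x::'a. x ^ q)" by (rule injI)
  then show ?thesis by (simp add: field_auto_def power_q_add power_mult_distrib)
qed

lemma frob_funpow: "((\<lambda>x::'a. x ^ q) ^^ i) x = x ^ (q ^ i)"
  by (induction i) (simp_all add: power_mult[symmetric] mult.commute)

lemma power_q_mod: "(x::'a) ^ (q ^ (i mod t)) = x ^ (q ^ i)"
proof -
  have "((\<lambda>x::'a. x ^ q) ^^ t) = id"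
    by (rule ext) (simp only: frob_funpow card_field[symmetric] power_card_eq_self id_apply)
  then have "((\<lambda>x::'a. x ^ q) ^^ (i mod t)) = ((\<lambda>x::'a. x ^ q) ^^ i)"
    by (metis funpow_mod_eq id_apply ext)
  then show ?thesis by (metis frob_funpow)
qed

lemma field_auto_eq_frob:
  assumes "field_auto (\<alpha> :: 'a \<Rightarrow> 'a)" "\<And>x. x \<in> Fq \<Longrightarrow> \<alpha> x = x"
  shows "\<exists>i<t. \<alpha> = (\<lambda>x. x ^ (q ^ i))"
proof -
  have id: "((\<lambda>x::'a. x ^ q) ^^ t) = id"
    by (rule ext) (simp only: frob_funpow card_field[symmetric] power_card_eq_self id_apply)
  have "\<exists>i<t. \<alpha> = (\<lambda>x::'a. x ^ q) ^^ i"
    by (rule field_auto_in_cyclic[OF field_auto_frob t_pos id assms(1)])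
      (use assms(2) in \<open>auto simp: subfield_q_def\<close>)
  then show ?thesis by (auto simp: frob_funpow fun_eq_iff)
qed

lemma frob_inj:
  assumes "(\<lambda>x::'a. x ^ (q ^ i)) = (\<lambda>x. x ^ (q ^ k))" "i < t" "k < t"
  shows "i = k"
proof -
  obtain w :: 'a where w: "w \<noteq> 0" "\<And>x. x \<noteq> 0 \<Longrightarrow> \<exists>i::nat. x = w ^ i"
    using finite_field_generator by auto
  have Suc: "q ^ i = Suc (q ^ i - 1)" for i using q_ge_2 by simp
  have lt: "q ^ i - 1 < CARD('a) - 1" if "i < t" for i
    using power_strict_increasing[OF that, of q] q_ge_2 card_field Suc[of i] by linarith
  \<comment> \<open>Cancelling one factor \<open>w\<close> brings the exponents strictly below
    \<open>CARD('a) - 1\<close>, the range in which powers of a generator are distinct.\<close>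
  have "w ^ Suc (q ^ i - 1) = w ^ Suc (q ^ k - 1)"
    using fun_cong[OF assms(1), of w] unfolding Suc[symmetric] .
  then have "q ^ i - 1 = q ^ k - 1"
    using generator_power_inj[OF w _ lt[OF assms(2)] lt[OF assms(3)]] w(1) by simp
  then have "q ^ i = q ^ k" using Suc[of i] Suc[of k] by argo
  then show ?thesis using q_ge_2 by (simp add: power_inject_exp)
qed

text \<open>The elements \<open>w\<^sup>e\<^sup>k\<close> with \<open>e = (q\<^sup>t - 1)/(q\<^sup>d - 1)\<close> form the multiplicative
  group of the subfield of order \<open>q\<^sup>d\<close>.\<close>

lemma ex_exponent:
  assumes "d dvd t"
  shows "\<exists>e>0. e * (q ^ d - 1) = CARD('a) - 1"
proof -
  obtain c where c: "t = d * c" using assms by auto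
  have Suc: "1 \<le> q ^ i" for i using q_ge_2 by simp
  have "int (q ^ d) - 1 dvd int (q ^ d) ^ c - 1"
    using power_diff_1_eq[of "int (q ^ d)" c] by (metis dvd_triv_left)
  then have "int (q ^ d - 1) dvd int (q ^ t - 1)"
    using Suc[of d] Suc[of t] by (simp add: c power_mult of_nat_diff)
  then have "q ^ d - 1 dvd q ^ t - 1" by (simp only: int_dvd_int_iff)
  then obtain e where e: "q ^ t - 1 = (q ^ d - 1) * e" by auto
  have "q ^ t > 1" using q_ge_2 t_pos by (metis Suc_1 Suc_le_lessD one_less_power)
  then have "e > 0" using e by (cases e) auto
  then show ?thesis using e card_field by (auto simp: mult.commute)
qed

text \<open>The witness is \<open>w ^ e\<close>, which generates the multiplicative group of the
  subfield of order \<open>q ^ d\<close>; its order \<open>q ^ d - 1\<close> exceeds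
  \<open>q - 1\<close>.\<close>

lemma Fq_proper_subfield:
  assumes "d dvd t" "d > 1"
  shows "\<exists>x::'a. x ^ (q ^ d) = x \<and> x \<notin> Fq"
proof -
  obtain w :: 'a where w: "w \<noteq> 0" "\<And>x. x \<noteq> 0 \<Longrightarrow> \<exists>i::nat. x = w ^ i"
    using finite_field_generator by auto
  obtain e where e: "e > 0" "e * (q ^ d - 1) = CARD('a) - 1" using ex_exponent[OF assms(1)] by auto
  have Suc: "q ^ i = Suc (q ^ i - 1)" for i using q_ge_2 by simp
  have Q: "CARD('a) = Suc (CARD('a) - 1)" by (simp add: card_gt_0_iff)
  have "(w ^ e) ^ Suc (q ^ d - 1) = w ^ (e * (q ^ d - 1)) * w ^ e"
    by (simp only: power_Suc2 power_mult)
  then have "(w ^ e) ^ (q ^ d) = w ^ (e * (q ^ d - 1)) * w ^ e" using Suc[of d] by argo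
  also have "\<dots> = w ^ CARD('a) * w ^ (e - 1)"
  proof -
    have "CARD('a) - 1 + e = CARD('a) + (e - 1)" using Q e(1) by linarith
    then show ?thesis by (metis e(2) power_add)
  qed
  also have "\<dots> = w ^ e" using e(1) power_card_eq_self[of w] by (metis power_minus_mult mult.commute)
  finally have 1: "(w ^ e) ^ (q ^ d) = w ^ e" .
  moreover have "w ^ e \<notin> Fq"
  proof
    assume "w ^ e \<in> Fq"
    then have "(w ^ e) ^ q = w ^ e" by (simp add: subfield_q_def)
    moreover have "(w ^ e) ^ Suc (q - 1) = w ^ (e * (q - 1)) * w ^ e"
      by (simp only: power_Suc2 power_mult)
    moreover have "Suc (q - 1) = q" using q_ge_2 by simp
    ultimately have "w ^ (e * (q - 1)) = w ^ 0" using w(1) by (simp only:) simp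
    moreover have "q < q ^ d" using assms(2) q_ge_2 power_strict_increasing[of 1 d q] by simp
    then have "e * (q - 1) < e * (q ^ d - 1)" using e(1) q_ge_2 by simp
    ultimately have "e * (q - 1) = 0"
      using generator_power_inj[OF w, of "e * (q - 1)" 0] unfolding e(2) by linarith
    then show False using e(1) q_ge_2 by simp
  qed
  ultimately show ?thesis by blast
qed

text \<open>Zero and the \<open>q - 1\<close> powers of an element of order \<open>q - 1\<close> are
  all roots of \<open>x ^ q = x\<close>.\<close>

lemma card_Fq_ge: "q \<le> card Fq"
proof -
  obtain w :: 'a where w: "w \<noteq> 0" "\<And>x. x \<noteq> 0 \<Longrightarrow> \<exists>i::nat. x = w ^ i"
    using finite_field_generator by auto
  obtain e where e: "e > 0" "e * (q ^ 1 - 1) = CARD('a) - 1" using ex_exponent[of 1] by auto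
  have q1: "q = Suc (q - 1)" using q_ge_2 by simp
  have Q: "CARD('a) = Suc (CARD('a) - 1)" by (simp add: card_gt_0_iff)
  have "w ^ (e * (q - 1)) = 1" using power_card_minus_1[OF w(1)] e(2) by simp
  then have "(w ^ e) ^ Suc (q - 1) = w ^ e" by (simp add: power_mult)
  then have "(w ^ e) ^ q = w ^ e" using q1 by argo
  then have "((w ^ e) ^ k) ^ q = (w ^ e) ^ k" for k
    by (metis power_mult mult.commute)
  then have sub: "insert 0 ((\<lambda>k. (w ^ e) ^ k) ` {..<q - 1}) \<subseteq> Fq"
    using q_ge_2 by (auto simp: subfield_q_def)
  have "inj_on (\<lambda>k. (w ^ e) ^ k) {..<q - 1}"
  proof (rule inj_onI)
    fix a b assume ab: "a \<in> {..<q - 1}" "b \<in> {..<q - 1}" "(w ^ e) ^ a = (w ^ e) ^ b"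
    then have "e * a < e * (q ^ 1 - 1)" "e * b < e * (q ^ 1 - 1)" using e(1) by auto
    then have "e * a < CARD('a) - 1" "e * b < CARD('a) - 1" unfolding e(2) .
    then have "e * a = e * b"
      using generator_power_inj[OF w, of "e * a" "e * b"] ab(3) by (simp add: power_mult)
    then show "a = b" using e(1) by simp
  qed
  then have "card (insert 0 ((\<lambda>k. (w ^ e) ^ k) ` {..<q - 1})) = q"
    using w(1) q1 by (subst card_insert_disjoint) (auto simp: card_image)
  then show ?thesis using card_mono[OF _ sub] by simp
qed

lemma FqD:
  "0 \<in> Fq" "1 \<in> Fq" "x \<in> Fq \<Longrightarrow> y \<in> Fq \<Longrightarrow> x + y \<in> Fq" "x \<in> Fq \<Longrightarrow> y \<in> Fq \<Longrightarrow> x * y \<in> Fq"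
  "x \<in> Fq \<Longrightarrow> - x \<in> Fq" "x \<in> Fq \<Longrightarrow> inverse x \<in> Fq"
  using field_autoD[OF field_auto_frob] by (auto simp: subfield_q_def power_inverse)

end

text \<open>Generating the Galois group is expressed by the fixed field of \<open>\<sigma>\<close>;
  that \<open>\<sigma>\<close> is a Frobenius power with exponent coprime to \<open>t\<close> is
  derived from it.\<close>

locale galois_generator = field_ext q t K
  for q t and K :: "'a::{field,finite} itself" +
  fixes \<sigma> :: "'a \<Rightarrow> 'a"
  assumes auto_\<sigma>: "field_auto \<sigma>" and fix_\<sigma>: "\<sigma> x = x \<longleftrightarrow> x \<in> Fq"
begin

text \<open>A common divisor \<open>d > 1\<close> of \<open>s\<close> and \<open>t\<close> would
  leave a subfield of order \<open>q ^ d\<close> fixed, which is larger than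
  \<open>Fq\<close>.\<close>

lemma frob_coprime:
  assumes "\<And>x::'a. x ^ (q ^ s) = x \<Longrightarrow> x \<in> Fq"
  shows "coprime s t"
proof (rule ccontr)
  assume "\<not> coprime s t"
  moreover have "gcd s t > 0" using t_pos by simp
  ultimately have "gcd s t > 1" by (metis One_nat_def Suc_lessI coprime_iff_gcd_eq_1)
  then obtain x :: 'a where x: "x ^ (q ^ gcd s t) = x" "x \<notin> Fq"
    using Fq_proper_subfield[of "gcd s t"] by auto
  have "x ^ (q ^ (gcd s t * c)) = x" for c
    by (induction c) (simp_all add: power_add power_mult x(1))
  then have "x ^ (q ^ s) = x" by (metis dvd_def gcd_dvd1)
  then show False using assms x(2) by blast
qed

lemma ex_frob_exponent: "\<exists>s. coprime s t \<and> (\<forall>i x. (\<sigma> ^^ i) x = x ^ (q ^ (s * i)))"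
proof -
  obtain s where s: "s < t" "\<And>x. \<sigma> x = x ^ (q ^ s)"
    using field_auto_eq_frob[OF auto_\<sigma>] fix_\<sigma> by (metis (mono_tags))
  have "(\<sigma> ^^ i) x = x ^ (q ^ (s * i))" for i x
    by (induction i) (simp_all add: s(2) power_mult[symmetric] power_add[symmetric] mult.commute)
  moreover have "coprime s t" using frob_coprime[of s] fix_\<sigma> s(2) by simp
  ultimately show ?thesis by blast
qed

lemma funpow_\<sigma>_t: "(\<sigma> ^^ t) x = x"
proof -
  obtain s where "coprime s t" and s: "\<And>i x. (\<sigma> ^^ i) x = x ^ (q ^ (s * i))"
    using ex_frob_exponent by auto
  show ?thesis using power_q_mod[of x "s * t"] by (simp add: s)
qed

lemma funpow_\<sigma>_inj:
  assumes "\<sigma> ^^ i = \<sigma> ^^ k" "i < t" "k < t"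
  shows "i = k"
proof -
  obtain s where s0: "coprime s t" and s: "\<And>i x. (\<sigma> ^^ i) x = x ^ (q ^ (s * i))"
    using ex_frob_exponent by auto
  have "(\<lambda>x::'a. x ^ (q ^ ((s * i) mod t))) = (\<lambda>x. x ^ (q ^ ((s * k) mod t)))"
    unfolding power_q_mod s[symmetric] using assms(1) by simp
  then have "(s * i) mod t = (s * k) mod t" using frob_inj t_pos by simp
  then have "[i = k] (mod t)" using s0 by (simp add: cong_def[symmetric] cong_mult_lcancel_nat)
  then show ?thesis using assms(2,3) by (simp add: cong_def)
qed

lemma field_auto_eq_funpow:
  assumes "field_auto \<alpha>" "\<And>x. x \<in> Fq \<Longrightarrow> \<alpha> x = x"
  shows "\<exists>j<t. \<alpha> = \<sigma> ^^ j"
proof -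
  have id: "\<sigma> ^^ t = id" by (rule ext) (simp add: funpow_\<sigma>_t)
  show ?thesis
    by (rule field_auto_in_cyclic[OF auto_\<sigma> t_pos id assms(1)]) (simp add: fix_\<sigma> assms(2))
qed

text \<open>Turns scatteredness, which bounds the scalars fixed by \<open>\<sigma> ^^ j\<close>,
  into the coprimality claimed for the exponent.\<close>

lemma funpow_coprime:
  assumes "\<And>x. (\<sigma> ^^ j) x = x \<Longrightarrow> x \<in> Fq"
  shows "coprime j t"
proof -
  obtain s where s: "\<And>i x. (\<sigma> ^^ i) x = x ^ (q ^ (s * i))"
    using ex_frob_exponent by auto
  show ?thesis using frob_coprime[of "s * j"] assms by (simp add: s)
qed

text \<open>Artin's proof of Dedekind's theorem: the relation at \<open>x * y\<close> minus
  \<open>\<chi> a y\<close> times the relation at \<open>x\<close> has no term for \<open>a\<close>,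
  and \<open>y\<close> is chosen so that the term for \<open>k\<close> survives.\<close>

lemma independent_characters:
  fixes \<chi> :: "nat \<Rightarrow> 'a \<Rightarrow> 'a"
  assumes "finite I" "\<And>i x y. i \<in> I \<Longrightarrow> \<chi> i (x * y) = \<chi> i x * \<chi> i y"
    and "\<And>i. i \<in> I \<Longrightarrow> \<chi> i 1 = 1" and "inj_on \<chi> I"
    and "\<And>x. (\<Sum>i\<in>I. c i * \<chi> i x) = 0" "k \<in> I"
  shows "c k = 0"
  using assms
proof (induction I arbitrary: c k rule: finite_induct)
  case (insert a I)
  have I0: "c k = 0" if k: "k \<in> I" for k
  proof -
    have "\<chi> k \<noteq> \<chi> a" using insert.prems(3) k insert.hyps by (auto simp: inj_on_def)
    then obtain y where y: "\<chi> k y \<noteq> \<chi> a y" by blast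
    have "(\<Sum>i\<in>I. (c i * (\<chi> i y - \<chi> a y)) * \<chi> i x) = 0" for x
    proof -
      have "c a * \<chi> a (x * y) + (\<Sum>i\<in>I. c i * \<chi> i (x * y)) = 0"
        using insert.prems(4)[of "x * y"] insert.hyps by simp
      moreover have "(c a * \<chi> a x + (\<Sum>i\<in>I. c i * \<chi> i x)) * \<chi> a y = 0"
        using insert.prems(4)[of x] insert.hyps by simp
      ultimately have "(\<Sum>i\<in>I. c i * \<chi> i (x * y)) - (\<Sum>i\<in>I. c i * \<chi> i x) * \<chi> a y = 0"
        using insert.prems(1)[of a x y] by (simp add: algebra_simps) (metis add_left_cancel)
      moreover have "(\<Sum>i\<in>I. (c i * (\<chi> i y - \<chi> a y)) * \<chi> i x)
          = (\<Sum>i\<in>I. c i * \<chi> i (x * y)) - (\<Sum>i\<in>I. c i * \<chi> i x) * \<chi> a y"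
        unfolding sum_distrib_right sum_subtractf[symmetric]
        using insert.prems(1) by (intro sum.cong) (auto simp: algebra_simps)
      ultimately show ?thesis by simp
    qed
    then have "c k * (\<chi> k y - \<chi> a y) = 0"
      using insert.IH[of "\<lambda>i. c i * (\<chi> i y - \<chi> a y)" k] insert.prems k by (auto simp: inj_on_def)
    then show ?thesis using y by simp
  qed
  then have "c a * \<chi> a 1 = 0" using insert.prems(4)[of 1] insert.hyps by simp
  then have "c a = 0" using insert.prems(2)[of a] by simp
  then show ?case using I0 insert.prems(5) by auto
qed simp

lemma sum_funpow_eq_0D:
  assumes "\<And>x. (\<Sum>i<t. c i * (\<sigma> ^^ i) x) = 0" "k < t"
  shows "c k = 0"
proof (rule independent_characters[of "{..<t}" "\<lambda>i. \<sigma> ^^ i"])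
  show "inj_on (\<lambda>i. \<sigma> ^^ i) {..<t}" using funpow_\<sigma>_inj by (auto intro: inj_onI)
qed (use assms field_autoD[OF field_auto_funpow[OF auto_\<sigma>]] in auto)

end

section \<open>Subspaces missing the fixed points of a semilinear map\<close>

declare plus_fun_apply [simp del] zero_fun_apply [simp del] minus_apply [simp del]

lemmas fun_apply_simps = plus_fun_apply zero_fun_apply minus_apply

text \<open>Additive subgroups are the common ground of \<open>K\<close>-subspaces and of
  \<open>V0\<close>, which is closed only under scalars from \<open>Fq\<close>; sums of both kinds
  have to be counted.\<close>

definition add_closed :: "'v::ab_group_add set \<Rightarrow> bool" where
  "add_closed A \<longleftrightarrow> 0 \<in> A \<and> (\<forall>x\<in>A. \<forall>y\<in>A. x + y \<in> A \<and> x - y \<in> A)"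

lemma add_closedD:
  assumes "add_closed A"
  shows "0 \<in> A" "x \<in> A \<Longrightarrow> y \<in> A \<Longrightarrow> x + y \<in> A" "x \<in> A \<Longrightarrow> y \<in> A \<Longrightarrow> x - y \<in> A"
  using assms by (auto simp: add_closed_def)

text \<open>The dimension formula in terms of sizes. Each fibre of addition on
  \<open>A \<times> B\<close> is parametrised by \<open>A \<inter> B\<close>: \<open>c\<close> is
  moved from one summand to the other.\<close>

lemma card_set_plus_mult:
  assumes A: "add_closed A" "finite A" and B: "add_closed B" "finite B"
  shows "card A * card B = card (A + B) * card (A \<inter> B)"
proof -
  let ?f = "\<lambda>z. fst z + snd z"
  have im: "?f ` (A \<times> B) = A + B" by (force simp: set_plus_def)
  have "card {z \<in> A \<times> B. ?f z = y} = card (A \<inter> B)" if y: "y \<in> A + B" for y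
  proof -
    obtain a b where ab: "a \<in> A" "b \<in> B" "y = a + b" using y by (auto elim: set_plus_elim)
    have "bij_betw (\<lambda>c. (a + c, b - c)) (A \<inter> B) {z \<in> A \<times> B. ?f z = y}"
    proof (rule bij_betw_byWitness[of _ "\<lambda>z. fst z - a"])
      show "(\<lambda>c. (a + c, b - c)) ` (A \<inter> B) \<subseteq> {z \<in> A \<times> B. ?f z = y}"
        using ab add_closedD[OF A(1)] add_closedD[OF B(1)] by auto
      show "(\<lambda>z. fst z - a) ` {z \<in> A \<times> B. ?f z = y} \<subseteq> A \<inter> B"
      proof
        fix c assume "c \<in> (\<lambda>z. fst z - a) ` {z \<in> A \<times> B. ?f z = y}"
        then obtain a' b' where *: "a' \<in> A" "b' \<in> B" "a' + b' = y" "c = a' - a" by auto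
        have "a' + b' = a + b" using *(3) ab(3) by simp
        then have "a' - a = b - b'" by (simp only: diff_eq_eq add_diff_eq eq_diff_eq diff_add_eq add.commute)
        then have "c = b - b'" using *(4) by simp
        then show "c \<in> A \<inter> B"
          using * ab add_closedD(3)[OF A(1), of a' a] add_closedD(3)[OF B(1), of b b'] by simp
      qed
    qed (auto simp: ab(3) algebra_simps)
    then show ?thesis by (simp add: bij_betw_same_card)
  qed
  moreover have "card (A \<times> B) = (\<Sum>y\<in>?f ` (A \<times> B). card {z \<in> A \<times> B. ?f z = y})"
    using sum.image_gen[of "A \<times> B" "\<lambda>_. 1::nat" ?f] A(2) B(2) by simp
  ultimately show ?thesis by (simp add: im card_cartesian_product)
qed

lemma card_set_plus_direct:
  assumes "add_closed A" "finite A" "add_closed B" "finite B" "A \<inter> B = {0}"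
  shows "card (A + B) = card A * card B"
  using card_set_plus_mult[OF assms(1-4)] assms(5) by simp

lemma card_set_plus_le: "finite A \<Longrightarrow> finite B \<Longrightarrow> card (A + B) \<le> card A * card B"
  unfolding set_plus_image card_cartesian_product[symmetric] by (intro card_image_le) simp

lemma sum_fun_apply: "(\<Sum>k\<in>A. f k) i = (\<Sum>k\<in>A. f k i)"
  by (induction A rule: infinite_finite_induct) (auto simp: fun_apply_simps)

lemma vadd_eq: "vadd v w = v + w" and zvec_eq: "zvec = 0"
  by (simp_all add: vadd_def zvec_def fun_eq_iff fun_apply_simps)

interpretation vs: vector_space "smul :: 'a::field \<Rightarrow> (nat \<Rightarrow> 'a) \<Rightarrow> (nat \<Rightarrow> 'a)"
  by unfold_locales (simp_all add: smul_def fun_eq_iff fun_apply_simps algebra_simps)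

lemma subspace_vecs: "vs.subspace (vecs N)"
  by (auto simp: vs.subspace_def vecs_def smul_def fun_apply_simps)

lemma ksub_iff: "ksub N S \<longleftrightarrow> S \<subseteq> vecs N \<and> vs.subspace S"
  by (auto simp: subsp_over_def vs.subspace_def vadd_eq zvec_eq)

lemma kspan_eq:
  assumes "X \<subseteq> vecs N"
  shows "kspan N X = vs.span X"
proof
  show "kspan N X \<subseteq> vs.span X"
    unfolding kspan_def using assms
    by (intro Inter_lower) (auto simp: ksub_iff vs.span_superset subspace_vecs dest: vs.span_minimal)
  show "vs.span X \<subseteq> kspan N X"
    unfolding kspan_def by (auto simp: ksub_iff dest: vs.span_minimal)
qed

lemma bij_betw_vecs_PiE: "bij_betw (\<lambda>v. restrict v {..<N}) (vecs N) (PiE {..<N} (\<lambda>_. UNIV :: 'a::field set))"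
  by (rule bij_betw_byWitness[of _ "\<lambda>g i. if i < N then g i else 0"])
    (auto simp: vecs_def fun_eq_iff restrict_def PiE_def extensional_def)

lemma finite_vecs: "finite (vecs N :: (nat \<Rightarrow> 'a::{field,finite}) set)"
  using bij_betw_finite[OF bij_betw_vecs_PiE[of N, where ?'a = 'a]] by (simp add: finite_PiE)

lemma card_vecs: "card (vecs N :: (nat \<Rightarrow> 'a::{field,finite}) set) = CARD('a) ^ N"
  using bij_betw_same_card[OF bij_betw_vecs_PiE[of N, where ?'a = 'a]] by (simp add: card_PiE)

lemma add_closed_subspace: "vs.subspace A \<Longrightarrow> add_closed A"
  by (simp add: add_closed_def vs.subspace_0 vs.subspace_add vs.subspace_diff)

lemma card_span_singleton:
  assumes "(x :: nat \<Rightarrow> 'a::{field,finite}) \<noteq> 0"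
  shows "card (vs.span {x}) = CARD('a)"
  unfolding vs.span_singleton using assms by (intro card_image) (auto intro: injI)

text \<open>The line through one vector outside \<open>A\<close> meets \<open>A\<close> in zero, so
  adjoining it multiplies the size by \<open>CARD('a)\<close>.\<close>

lemma card_subspace_psubset:
  fixes A :: "(nat \<Rightarrow> 'a::{field,finite}) set"
  assumes A: "vs.subspace A" and B: "vs.subspace B" "finite B" and AB: "A \<subset> B"
  shows "CARD('a) * card A \<le> card B"
proof -
  obtain x where x: "x \<in> B" "x \<notin> A" using AB by auto
  have x0: "x \<noteq> 0" using x(2) vs.subspace_0[OF A] by auto
  have sp: "vs.span {x} \<subseteq> B" using vs.span_minimal[of "{x}" B] x B by simp
  have "A \<inter> vs.span {x} = {0}"
  proof -
    have "c = 0" if "smul c x \<in> A" for c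
    proof (rule ccontr)
      assume "c \<noteq> 0"
      then have "x = smul (inverse c) (smul c x)" by simp
      then show False using vs.subspace_scale[OF A that, of "inverse c"] x(2) by simp
    qed
    then show ?thesis using vs.subspace_0[OF A] by (auto simp: vs.span_singleton)
  qed
  then have "card (A + vs.span {x}) = card A * card (vs.span {x})"
    using A B AB sp by (intro card_set_plus_direct add_closed_subspace) (auto intro: finite_subset)
  moreover have "A + vs.span {x} \<subseteq> B"
    using AB sp vs.subspace_add[OF B(1)] by (auto elim!: set_plus_elim)
  ultimately show ?thesis
    using card_mono[OF B(2)] card_span_singleton[OF x0] by (metis mult.commute)
qed

lemma span_UN_subspaces:
  assumes "finite J" "\<And>i. i \<in> J \<Longrightarrow> vs.subspace (A i)"
  shows "vs.span (\<Union>i\<in>J. A i) = {\<Sum>i\<in>J. g i | g. \<forall>i\<in>J. g i \<in> A i}"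
  using assms
proof (induction J rule: finite_induct)
  case (insert a J)
  have "vs.span (\<Union>i\<in>insert a J. A i) = {x + y | x y. x \<in> A a \<and> y \<in> vs.span (\<Union>i\<in>J. A i)}"
    using insert.prems vs.span_Un[of "A a"] by (simp add: vs.span_eq_iff[THEN iffD2])
  also have "\<dots> = {\<Sum>i\<in>insert a J. g i | g. \<forall>i\<in>insert a J. g i \<in> A i}" (is "?L = ?R")
  proof
    show "?L \<subseteq> ?R"
    proof
      fix z assume "z \<in> ?L"
      then obtain x g where g: "z = x + (\<Sum>i\<in>J. g i)" "x \<in> A a" "\<forall>i\<in>J. g i \<in> A i"
        using insert.IH insert.prems by auto
      have "(\<Sum>i\<in>insert a J. (g(a := x)) i) = x + (\<Sum>i\<in>J. g i)"
        using insert.hyps by (simp add: sum.insert) (intro sum.cong, auto)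
      then show "z \<in> ?R" using g by (intro CollectI exI[of _ "g(a := x)"]) auto
    qed
    show "?R \<subseteq> ?L" using insert by auto
  qed
  finally show ?case .
qed simp

lemma card_span_UN_le:
  fixes A :: "'i \<Rightarrow> (nat \<Rightarrow> 'a::{field,finite}) set"
  assumes "finite J" "\<And>i. i \<in> J \<Longrightarrow> vs.subspace (A i)" "\<And>i. i \<in> J \<Longrightarrow> finite (A i) \<and> card (A i) \<le> c"
  shows "finite (vs.span (\<Union>i\<in>J. A i)) \<and> card (vs.span (\<Union>i\<in>J. A i)) \<le> c ^ card J"
  using assms
proof (induction J rule: finite_induct)
  case (insert a J)
  have "vs.span (\<Union>i\<in>insert a J. A i) = A a + vs.span (\<Union>i\<in>J. A i)"
    using insert.prems vs.span_Un[of "A a"]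
    by (auto simp: vs.span_eq_iff[THEN iffD2] set_plus_def)
  moreover have "card (A a + vs.span (\<Union>i\<in>J. A i)) \<le> card (A a) * card (vs.span (\<Union>i\<in>J. A i))"
    using insert by (intro card_set_plus_le) auto
  moreover have "card (A a) * card (vs.span (\<Union>i\<in>J. A i)) \<le> c * c ^ card J"
    using insert by (intro mult_le_mono) auto
  ultimately show ?case using insert by (auto intro: finite_set_plus)
qed simp

section \<open>Powers of a semilinear map whose fixed vectors span\<close>

locale semilin = galois_generator q t K \<sigma>
  for q t and K :: "'a::{field,finite} itself" and \<sigma> +
  fixes n N :: nat and \<Psi> :: "(nat \<Rightarrow> 'a) \<Rightarrow> (nat \<Rightarrow> 'a)" and V0 :: "(nat \<Rightarrow> 'a) set"
  assumes N: "N = t * n"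
    and Psi_vecs: "v \<in> vecs N \<Longrightarrow> \<Psi> v \<in> vecs N"
    and Psi_add: "v \<in> vecs N \<Longrightarrow> w \<in> vecs N \<Longrightarrow> \<Psi> (v + w) = \<Psi> v + \<Psi> w"
    and Psi_smul: "v \<in> vecs N \<Longrightarrow> \<Psi> (smul a v) = smul (\<sigma> a) (\<Psi> v)"
    and V0: "v \<in> V0 \<longleftrightarrow> v \<in> vecs N \<and> \<Psi> v = v"
    and span_V0: "vs.span V0 = vecs N"
begin

abbreviation V :: "(nat \<Rightarrow> 'a) set" where "V \<equiv> vecs N"

lemmas V_closed = vs.subspace_0[OF subspace_vecs] vs.subspace_add[OF subspace_vecs]
  vs.subspace_diff[OF subspace_vecs] vs.subspace_scale[OF subspace_vecs] vs.subspace_neg[OF subspace_vecs]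

lemma V0_subset: "V0 \<subseteq> V" using V0 by auto

lemma pow_vecs: "v \<in> V \<Longrightarrow> (\<Psi> ^^ i) v \<in> V"
  by (induction i) (simp_all add: Psi_vecs)

lemma pow_add: "v \<in> V \<Longrightarrow> w \<in> V \<Longrightarrow> (\<Psi> ^^ i) (v + w) = (\<Psi> ^^ i) v + (\<Psi> ^^ i) w"
  by (induction i) (simp_all add: Psi_add pow_vecs)

lemma pow_smul: "v \<in> V \<Longrightarrow> (\<Psi> ^^ i) (smul a v) = smul ((\<sigma> ^^ i) a) ((\<Psi> ^^ i) v)"
  by (induction i) (simp_all add: Psi_smul pow_vecs)

lemma pow_0: "(\<Psi> ^^ i) 0 = 0"
  using pow_add[OF V_closed(1) V_closed(1), of i] by simp

lemma pow_diff: "v \<in> V \<Longrightarrow> w \<in> V \<Longrightarrow> (\<Psi> ^^ i) (v - w) = (\<Psi> ^^ i) v - (\<Psi> ^^ i) w"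
  using pow_add[of "v - w" w i] V_closed(3)[of v _ w] by (simp add: algebra_simps)

lemma Psi_sum:
  assumes "\<And>k. k \<in> A \<Longrightarrow> g k \<in> V"
  shows "\<Psi> (\<Sum>k\<in>A. g k) = (\<Sum>k\<in>A. \<Psi> (g k))"
  using assms
proof (induction A rule: infinite_finite_induct)
  case (insert x F)
  have "(\<Sum>k\<in>F. g k) \<in> V" using insert.prems by (intro vs.subspace_sum[OF subspace_vecs]) auto
  then show ?case using insert by (simp add: Psi_add)
qed (use pow_0[of 1] in auto)

lemma pow_V0: "v \<in> V0 \<Longrightarrow> (\<Psi> ^^ i) v = v"
  by (induction i) (auto simp: V0)

text \<open>True on \<open>V0\<close>, and inherited by its span because
  \<open>\<sigma> ^^ t\<close> is the identity.\<close>

lemma pow_t: assumes "v \<in> V" shows "(\<Psi> ^^ t) v = v"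
proof -
  have "v \<in> vs.span V0" using assms span_V0 by simp
  then have "v \<in> V \<and> (\<Psi> ^^ t) v = v"
  proof (induction rule: vs.span_induct_alt)
    case base
    then show ?case by (simp add: pow_0 V_closed)
  next
    case (step c x y)
    then have "x \<in> V" using V0_subset by auto
    then show ?case using step by (simp add: pow_add pow_smul V_closed pow_V0 funpow_\<sigma>_t)
  qed
  then show ?thesis ..
qed

lemma pow_mod: "v \<in> V \<Longrightarrow> (\<Psi> ^^ (i mod t)) v = (\<Psi> ^^ i) v"
  by (rule funpow_mod_eq[OF pow_t])

lemma pow_pow: "(\<Psi> ^^ i) ((\<Psi> ^^ k) v) = (\<Psi> ^^ (i + k)) v"
  by (simp add: funpow_add)

lemma pow_inverse:
  assumes "v \<in> V" shows "(\<Psi> ^^ (t - i mod t)) ((\<Psi> ^^ i) v) = v"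
proof -
  have "((t - i mod t) + i) mod t = 0"
    using mod_less_divisor[OF t_pos, of i]
    by (metis add.commute le_add_diff_inverse less_imp_le mod_add_left_eq mod_self)
  then show ?thesis using pow_mod[OF assms, of "(t - i mod t) + i"] by (simp add: pow_pow)
qed

lemma pow_inj: "v \<in> V \<Longrightarrow> w \<in> V \<Longrightarrow> (\<Psi> ^^ i) v = (\<Psi> ^^ i) w \<Longrightarrow> v = w"
  by (metis pow_inverse)

lemma inj_on_pow: "A \<subseteq> V \<Longrightarrow> inj_on (\<Psi> ^^ i) A"
  by (rule inj_onI) (auto dest: pow_inj)

lemma subspace_pow:
  assumes A: "vs.subspace A" "A \<subseteq> V"
  shows "vs.subspace ((\<Psi> ^^ i) ` A)"
proof (rule vs.subspaceI)
  show "0 \<in> (\<Psi> ^^ i) ` A" using vs.subspace_0[OF A(1)] pow_0 by (metis imageI)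
  show "x + y \<in> (\<Psi> ^^ i) ` A" if "x \<in> (\<Psi> ^^ i) ` A" "y \<in> (\<Psi> ^^ i) ` A" for x y
    using that A by (auto simp: pow_add[symmetric] subset_iff vs.subspace_add)
  show "smul c x \<in> (\<Psi> ^^ i) ` A" if x: "x \<in> (\<Psi> ^^ i) ` A" for c x
  proof -
    obtain v where v: "v \<in> A" "x = (\<Psi> ^^ i) v" using x by auto
    \<comment> \<open>A scalar has to be pulled back through \<open>\<sigma> ^^ i\<close>, whose
      inverse is the power with exponent \<open>t - i mod t\<close>.\<close>
    have "(\<sigma> ^^ i) ((\<sigma> ^^ (t - i mod t)) c) = c"
    proof -
      have "(i + (t - i mod t)) mod t = 0"
        using mod_less_divisor[OF t_pos, of i]
        by (metis le_add_diff_inverse less_imp_le mod_add_left_eq mod_self)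
      then have "(\<sigma> ^^ (i + (t - i mod t))) c = c"
        using funpow_mod_eq[OF funpow_\<sigma>_t, of "i + (t - i mod t)" c] by simp
      then show ?thesis by (simp add: funpow_add)
    qed
    then have "smul c x = (\<Psi> ^^ i) (smul ((\<sigma> ^^ (t - i mod t)) c) v)"
      using v A by (subst pow_smul) auto
    then show ?thesis using v A by (auto simp: vs.subspace_scale)
  qed
qed

lemma card_pow: "A \<subseteq> V \<Longrightarrow> card ((\<Psi> ^^ i) ` A) = card A"
  by (rule card_image[OF inj_on_pow])

lemma pow_subset: "A \<subseteq> V \<Longrightarrow> (\<Psi> ^^ i) ` A \<subseteq> V"
  using pow_vecs by auto

lemma finite_sub: "A \<subseteq> V \<Longrightarrow> finite A"
  using finite_subset finite_vecs by blast

lemma subspace_V0_Fq: "v \<in> V0 \<Longrightarrow> w \<in> V0 \<Longrightarrow> v + w \<in> V0" "v \<in> V0 \<Longrightarrow> w \<in> V0 \<Longrightarrow> v - w \<in> V0"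
  "v \<in> V0 \<Longrightarrow> a \<in> Fq \<Longrightarrow> smul a v \<in> V0" "0 \<in> V0"
  using pow_diff[of v w 1] pow_0[of 1]
  by (auto simp: V0 Psi_add Psi_smul V_closed fix_\<sigma>[THEN iffD2])

text \<open>The field trace carried over to vectors; it will identify \<open>\<Theta>\<close> with
  \<open>V0\<close>.\<close>

definition tr :: "(nat \<Rightarrow> 'a) \<Rightarrow> (nat \<Rightarrow> 'a)" where
  "tr v = (\<Sum>k<t. (\<Psi> ^^ k) v)"

lemma tr_in_V0: assumes "v \<in> V" shows "tr v \<in> V0"
proof -
  have "\<Psi> (tr v) + (\<Psi> ^^ 0) v = (\<Sum>k<t. (\<Psi> ^^ Suc k) v) + (\<Psi> ^^ 0) v"
    unfolding tr_def using pow_vecs[OF assms] by (subst Psi_sum) auto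
  also have "\<dots> = (\<Sum>k<Suc t. (\<Psi> ^^ k) v)" by (subst sum.lessThan_Suc_shift) (simp add: add.commute)
  also have "\<dots> = tr v + (\<Psi> ^^ 0) v" by (simp add: tr_def pow_t[OF assms])
  finally have "\<Psi> (tr v) = tr v" by simp
  moreover have "tr v \<in> V" unfolding tr_def
    by (rule vs.subspace_sum[OF subspace_vecs]) (rule pow_vecs[OF assms])
  ultimately show ?thesis by (simp add: V0)
qed

end

text \<open>\<open>H\<close> has codimension \<open>n\<close> and misses the points of \<open>V0\<close>: then \<open>V\<close> is the direct sum of the
  conjugates of the intersection \<open>\<Theta>\<close> of the nontrivial conjugates of \<open>H\<close>.\<close>

locale semilin_complement = semilin q t K \<sigma> n N \<Psi> V0
  for q t and K :: "'a::{field,finite} itself" and \<sigma> n N \<Psi> V0 +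
  fixes H :: "(nat \<Rightarrow> 'a) set"
  assumes subspace_H: "vs.subspace H" and H_subset: "H \<subseteq> V"
    and card_H: "card H * CARD('a) ^ n = CARD('a) ^ N"
    and H_V0: "H \<inter> V0 = {0}"
begin

definition \<Theta> :: "(nat \<Rightarrow> 'a) set" where
  "\<Theta> = {v \<in> V. \<forall>k. 0 < k \<and> k < t \<longrightarrow> v \<in> (\<Psi> ^^ k) ` H}"

text \<open>The trace of every multiple of such a \<open>v\<close> lies in \<open>H \<inter> V0\<close>.\<close>

lemma conjugates_inter:
  assumes "\<And>k. k < t \<Longrightarrow> v \<in> (\<Psi> ^^ k) ` H"
  shows "v = 0"
proof -
  have v: "v \<in> V" using assms[of 0] t_pos H_subset by auto
  have pow_H: "(\<Psi> ^^ k) v \<in> H" if k: "k < t" for k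
  proof -
    \<comment> \<open>The conjugate with index \<open>-k\<close> modulo \<open>t\<close> is the one
      that \<open>\<Psi> ^^ k\<close> carries back to \<open>H\<close>; the reduction covers
      \<open>k = 0\<close>.\<close>
    obtain h where h: "h \<in> H" "v = (\<Psi> ^^ ((t - k) mod t)) h"
      using assms[of "(t - k) mod t"] t_pos by auto
    have hV: "h \<in> V" using h H_subset by auto
    have "(\<Psi> ^^ k) v = (\<Psi> ^^ (k + (t - k))) h"
      using h(2) pow_mod[OF hV, of "t - k"] by (metis pow_pow)
    then show ?thesis using h(1) pow_t[OF hV] k by simp
  qed
  have tr0: "tr (smul a v) = 0" for a
  proof -
    have "tr (smul a v) \<in> H"
      unfolding tr_def using pow_H v
      by (intro vs.subspace_sum[OF subspace_H]) (simp add: pow_smul vs.subspace_scale[OF subspace_H])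
    moreover have "tr (smul a v) \<in> V0" using v V_closed(4) by (intro tr_in_V0)
    ultimately show ?thesis using H_V0 by auto
  qed
  \<comment> \<open>In each coordinate the vanishing traces give a linear relation between the
    powers of \<open>\<sigma>\<close>, valid for all scalars, so its coefficients are zero.\<close>
  have "(\<Sum>k<t. ((\<Psi> ^^ k) v) i * (\<sigma> ^^ k) a) = 0" for a i
  proof -
    have "(\<Sum>k<t. smul ((\<sigma> ^^ k) a) ((\<Psi> ^^ k) v)) = 0"
      using tr0[of a] v by (simp add: tr_def pow_smul)
    from fun_cong[OF this, of i] show ?thesis
      by (simp add: sum_fun_apply smul_def mult.commute fun_apply_simps)
  qed
  then have "((\<Psi> ^^ 0) v) i = 0" for i
    using sum_funpow_eq_0D[of "\<lambda>k. ((\<Psi> ^^ k) v) i" 0] t_pos by blast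
  then show ?thesis by (simp add: fun_eq_iff fun_apply_simps)
qed

lemma subspace_\<Theta>: "vs.subspace \<Theta>"
proof -
  have "\<Theta> = V \<inter> (\<Inter>k\<in>{0<..<t}. (\<Psi> ^^ k) ` H)" by (auto simp: \<Theta>_def)
  then show ?thesis
    using subspace_pow[OF subspace_H H_subset] by (simp add: vs.subspace_inter vs.subspace_Int subspace_vecs)
qed

lemma \<Theta>_subset: "\<Theta> \<subseteq> V" by (auto simp: \<Theta>_def)

lemma \<Theta>_H: "\<Theta> \<inter> H = {0}"
proof -
  have "v = 0" if "v \<in> \<Theta>" "v \<in> H" for v
  proof (rule conjugates_inter)
    show "v \<in> (\<Psi> ^^ k) ` H" if "k < t" for k
      using \<open>v \<in> \<Theta>\<close> \<open>v \<in> H\<close> that by (cases "k = 0") (auto simp: \<Theta>_def)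
  qed
  then show ?thesis using vs.subspace_0[OF subspace_\<Theta>] vs.subspace_0[OF subspace_H] by auto
qed

lemma card_pos: "vs.subspace (A :: (nat \<Rightarrow> 'a) set) \<Longrightarrow> A \<subseteq> V \<Longrightarrow> card A > 0"
  using vs.subspace_0[of A] finite_sub[of A] by (auto simp: card_gt_0_iff)

text \<open>Upper bound: \<open>\<Theta>\<close> avoids \<open>H\<close>, which has codimension
  \<open>n\<close>. Lower bound: each of the \<open>t - 1\<close> intersected conjugates costs at
  most \<open>n\<close> of the \<open>t * n\<close> dimensions.\<close>

lemma card_\<Theta>: "card \<Theta> = CARD('a) ^ n"
proof (rule antisym)
  have "card \<Theta> * card H = card (\<Theta> + H)"
    using \<Theta>_H subspace_\<Theta> subspace_H \<Theta>_subset H_subset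
    by (intro card_set_plus_direct[symmetric] add_closed_subspace finite_sub)
  also have "\<dots> \<le> CARD('a) ^ N"
    unfolding card_vecs[symmetric] using \<Theta>_subset H_subset
    by (intro card_mono finite_vecs) (auto elim!: set_plus_elim intro: V_closed(2))
  also have "\<dots> = CARD('a) ^ n * card H" by (simp add: card_H[symmetric] mult.commute)
  finally show "card \<Theta> \<le> CARD('a) ^ n" using card_pos[OF subspace_H H_subset] by simp
next
  let ?A = "\<lambda>m. {v \<in> V. \<forall>k. 0 < k \<and> k \<le> m \<longrightarrow> v \<in> (\<Psi> ^^ k) ` H}"
  have A: "vs.subspace (?A m) \<and> CARD('a) ^ N \<le> card (?A m) * CARD('a) ^ (n * m)" for m
  proof (induction m)
    case 0
    then show ?case by (simp add: card_vecs subspace_vecs)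
  next
    case (Suc m)
    let ?H = "(\<Psi> ^^ Suc m) ` H"
    have H: "vs.subspace ?H" "?H \<subseteq> V" "card ?H = card H"
      by (rule subspace_pow[OF subspace_H H_subset] pow_subset[OF H_subset] card_pow[OF H_subset])+
    have eq: "?A (Suc m) = ?A m \<inter> ?H" by (auto simp: le_Suc_eq)
    define a b where "a = card (?A m)" and "b = card (?A m \<inter> ?H)"
    have "a * card ?H = card (?A m + ?H) * b"
      unfolding a_def b_def using Suc.IH H by (intro card_set_plus_mult add_closed_subspace finite_sub) auto
    also have "\<dots> \<le> CARD('a) ^ N * b"
      unfolding card_vecs[symmetric] using H(2)
      by (intro mult_le_mono1 card_mono finite_vecs) (auto elim!: set_plus_elim intro: V_closed(2))
    finally have "card H * a \<le> card H * (b * CARD('a) ^ n)"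
      by (simp only: H(3) card_H[symmetric] mult_ac)
    then have "a \<le> b * CARD('a) ^ n" using card_pos[OF subspace_H H_subset] by simp
    then have "a * CARD('a) ^ (n * m) \<le> b * CARD('a) ^ n * CARD('a) ^ (n * m)" by (rule mult_le_mono1)
    also have "\<dots> = b * CARD('a) ^ (n * Suc m)" by (simp add: power_add)
    finally have "CARD('a) ^ N \<le> b * CARD('a) ^ (n * Suc m)"
      using Suc.IH unfolding a_def by linarith
    moreover have "vs.subspace (?A m \<inter> ?H)" using Suc.IH H(1) by (intro vs.subspace_inter) auto
    ultimately show ?case unfolding eq b_def by simp
  qed
  have "?A (t - 1) = \<Theta>"
    unfolding \<Theta>_def using t_pos by (intro Collect_cong conj_cong refl all_cong1 imp_cong) auto
  then have "CARD('a) ^ N \<le> card \<Theta> * CARD('a) ^ (n * (t - 1))" using A[of "t - 1"] by argo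
  moreover have "CARD('a) ^ N = CARD('a) ^ n * CARD('a) ^ (n * (t - 1))"
    unfolding N power_add[symmetric] using t_pos by (cases t) (auto simp: mult.commute)
  ultimately show "CARD('a) ^ n \<le> card \<Theta>" by simp
qed

lemma conj_\<Theta>_subset_conj_H:
  assumes "i < t" "k < t" "i \<noteq> k"
  shows "(\<Psi> ^^ i) ` \<Theta> \<subseteq> (\<Psi> ^^ k) ` H"
proof
  fix v assume "v \<in> (\<Psi> ^^ i) ` \<Theta>"
  then obtain \<theta> where \<theta>: "\<theta> \<in> \<Theta>" "v = (\<Psi> ^^ i) \<theta>" by auto
  \<comment> \<open>\<open>d\<close> represents \<open>k - i\<close> modulo \<open>t\<close> between
    1 and \<open>t - 1\<close>, where the definition of \<open>\<Theta>\<close> says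
    something.\<close>
  define d where "d = (if i < k then k - i else k + t - i)"
  have d: "0 < d" "d < t" "(i + d) mod t = k" using assms by (auto simp: d_def)
  then obtain h where h: "h \<in> H" "\<theta> = (\<Psi> ^^ d) h" using \<theta>(1) by (auto simp: \<Theta>_def)
  then have "v = (\<Psi> ^^ (i + d)) h" by (simp add: \<theta>(2) pow_pow)
  also have "\<dots> = (\<Psi> ^^ k) h" using pow_mod[of h "i + d"] d(3) h(1) H_subset by auto
  finally show "v \<in> (\<Psi> ^^ k) ` H" using h(1) by blast
qed

text \<open>Modulo the \<open>i\<close>-th conjugate of \<open>H\<close> only the
  \<open>i\<close>-th component survives, so components can be read off without dual bases.\<close>

lemma sum_minus_component:
  assumes "J \<subseteq> {..<t}" "\<And>k. k \<in> J \<Longrightarrow> g k \<in> (\<Psi> ^^ k) ` \<Theta>" "i \<in> J"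
  shows "(\<Sum>k\<in>J. g k) - g i \<in> (\<Psi> ^^ i) ` H"
proof -
  have "(\<Sum>k\<in>J. g k) - g i = (\<Sum>k\<in>J - {i}. g k)"
    using assms finite_subset[OF assms(1)] by (simp add: sum.remove[of J i])
  moreover have "(\<Sum>k\<in>J - {i}. g k) \<in> (\<Psi> ^^ i) ` H"
    using assms conj_\<Theta>_subset_conj_H
    by (intro vs.subspace_sum subspace_pow subspace_H H_subset) blast
  ultimately show ?thesis by simp
qed

lemma conj_\<Theta>_H: "(\<Psi> ^^ i) ` \<Theta> \<inter> (\<Psi> ^^ i) ` H = {0}"
proof -
  have "(\<Psi> ^^ i) ` \<Theta> \<inter> (\<Psi> ^^ i) ` H = (\<Psi> ^^ i) ` (\<Theta> \<inter> H)"
    using inj_on_image_Int[OF inj_on_pow[of V i], of \<Theta> H] \<Theta>_subset H_subset by simp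
  then show ?thesis by (simp add: \<Theta>_H pow_0)
qed

lemmas conj_\<Theta> = subspace_pow[OF subspace_\<Theta> \<Theta>_subset] pow_subset[OF \<Theta>_subset]

text \<open>The conjugates of \<open>\<Theta>\<close> before the \<open>m\<close>-th lie in the
  \<open>m\<close>-th conjugate of \<open>H\<close>, which avoids the \<open>m\<close>-th conjugate
  of \<open>\<Theta>\<close>. So the sum is direct, and the sizes multiply up to that of
  \<open>V\<close>.\<close>

lemma span_conj_\<Theta>: "vs.span (\<Union>i<t. (\<Psi> ^^ i) ` \<Theta>) = V"
proof -
  let ?B = "\<lambda>m. vs.span (\<Union>i<m. (\<Psi> ^^ i) ` \<Theta>)"
  have sub: "?B m \<subseteq> V" for m
    using conj_\<Theta>(2) subspace_vecs by (intro vs.span_minimal) blast+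
  have "m \<le> t \<Longrightarrow> card (?B m) = CARD('a) ^ (n * m)" for m
  proof (induction m)
    case (Suc m)
    have "?B (Suc m) = {x + y |x y. x \<in> ?B m \<and> y \<in> (\<Psi> ^^ m) ` \<Theta>}"
      using vs.span_Un[of "\<Union>i<m. (\<Psi> ^^ i) ` \<Theta>" "(\<Psi> ^^ m) ` \<Theta>"] conj_\<Theta>(1)
      by (simp add: lessThan_Suc Un_commute vs.span_eq_iff[THEN iffD2])
    then have eq: "?B (Suc m) = ?B m + (\<Psi> ^^ m) ` \<Theta>" by (auto simp: set_plus_def)
    have "?B m \<subseteq> (\<Psi> ^^ m) ` H"
    proof (rule vs.span_minimal)
      show "(\<Union>i<m. (\<Psi> ^^ i) ` \<Theta>) \<subseteq> (\<Psi> ^^ m) ` H"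
        using conj_\<Theta>_subset_conj_H[of _ m] Suc.prems by (intro UN_least) auto
    qed (rule subspace_pow[OF subspace_H H_subset])
    then have "?B m \<inter> (\<Psi> ^^ m) ` \<Theta> = {0}"
      using conj_\<Theta>_H[of m] vs.span_zero vs.subspace_0[OF conj_\<Theta>(1)[of m]] by blast
    then have "card (?B (Suc m)) = card (?B m) * card ((\<Psi> ^^ m) ` \<Theta>)"
      unfolding eq using sub conj_\<Theta> by (intro card_set_plus_direct add_closed_subspace finite_sub) auto
    then show ?case using Suc by (simp add: card_pow[OF \<Theta>_subset] card_\<Theta> power_add)
  qed simp
  then have "card (?B t) = card V" by (simp add: card_vecs N mult.commute)
  then show ?thesis using sub finite_vecs card_subset_eq by blast
qed

lemma decompose:
  assumes "v \<in> V"
  shows "\<exists>g. (\<forall>i<t. g i \<in> (\<Psi> ^^ i) ` \<Theta>) \<and> v = (\<Sum>i<t. g i)"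
proof -
  have "v \<in> vs.span (\<Union>i\<in>{..<t}. (\<Psi> ^^ i) ` \<Theta>)" using assms span_conj_\<Theta> by simp
  then have "v \<in> {\<Sum>i\<in>{..<t}. g i | g. \<forall>i\<in>{..<t}. g i \<in> (\<Psi> ^^ i) ` \<Theta>}"
    using span_UN_subspaces[of "{..<t}" "\<lambda>i. (\<Psi> ^^ i) ` \<Theta>"] conj_\<Theta>(1) by simp
  then obtain g where "v = (\<Sum>i<t. g i)" "\<forall>i\<in>{..<t}. g i \<in> (\<Psi> ^^ i) ` \<Theta>" by blast
  then show ?thesis by (intro exI[of _ g]) simp
qed

lemma tr_minus_self: assumes "\<theta> \<in> \<Theta>" shows "tr \<theta> - \<theta> \<in> H"
  using sum_minus_component[of "{..<t}" "\<lambda>k. (\<Psi> ^^ k) \<theta>" 0] assms t_pos by (auto simp: tr_def)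

text \<open>The witness is the component of \<open>v\<close> in \<open>\<Theta>\<close>. Both
  \<open>v\<close> and the trace of that component agree with it modulo \<open>H\<close>, and
  \<open>H\<close> has no nonzero fixed vector.\<close>

lemma V0_eq_tr: assumes "v \<in> V0" shows "\<exists>\<theta>\<in>\<Theta>. v = tr \<theta>"
proof -
  obtain g where g: "\<forall>i<t. g i \<in> (\<Psi> ^^ i) ` \<Theta>" "v = (\<Sum>i<t. g i)"
    using decompose assms V0_subset by blast
  have "v - g 0 \<in> H" using sum_minus_component[of "{..<t}" g 0] g t_pos by auto
  moreover have \<theta>: "g 0 \<in> \<Theta>" using g(1) t_pos by force
  ultimately have "(v - g 0) - (tr (g 0) - g 0) \<in> H"
    using tr_minus_self vs.subspace_diff[OF subspace_H] by blast
  moreover have "v - tr (g 0) \<in> V0"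
    using assms \<theta> \<Theta>_subset tr_in_V0 subspace_V0_Fq by blast
  ultimately have "v - tr (g 0) \<in> H \<inter> V0" by simp
  then have "v - tr (g 0) = 0" unfolding H_V0 by blast
  then show ?thesis using \<theta> by auto
qed

text \<open>Lying in the \<open>i\<close>-th conjugate of \<open>H\<close> amounts to having
  \<open>i\<close>-th component zero.\<close>

lemma H_inter_conj_H:
  assumes "0 < j" "j < t"
  shows "H \<inter> (\<Psi> ^^ j) ` H = vs.span (\<Union>i\<in>{..<t} - {0, j}. (\<Psi> ^^ i) ` \<Theta>)" (is "?L = vs.span ?U")
proof
  show "vs.span ?U \<subseteq> ?L"
  proof (rule vs.span_minimal)
    show "?U \<subseteq> ?L" using conj_\<Theta>_subset_conj_H[of _ 0] conj_\<Theta>_subset_conj_H[of _ j] assms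
      by (intro UN_least) auto
    show "vs.subspace ?L" using subspace_H subspace_pow[OF subspace_H H_subset] by (rule vs.subspace_inter)
  qed
  show "?L \<subseteq> vs.span ?U"
  proof
    fix v assume v: "v \<in> ?L"
    then obtain g where g: "\<forall>i<t. g i \<in> (\<Psi> ^^ i) ` \<Theta>" "v = (\<Sum>i<t. g i)"
      using decompose H_subset by blast
    have z: "g i = 0" if i: "i < t" "v \<in> (\<Psi> ^^ i) ` H" for i
    proof -
      have "v - g i \<in> (\<Psi> ^^ i) ` H" using sum_minus_component[of "{..<t}" g i] g i by auto
      then have "v - (v - g i) \<in> (\<Psi> ^^ i) ` H"
        using vs.subspace_diff[OF subspace_pow[OF subspace_H H_subset]] i by blast
      then show ?thesis using conj_\<Theta>_H[of i] g(1) i by auto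
    qed
    have "g 0 = 0" "g j = 0" using z[of 0] z[of j] v assms by auto
    then have "v = (\<Sum>i\<in>{..<t} - {0, j}. g i)"
      unfolding g(2) by (intro sum.mono_neutral_right) auto
    moreover have "(\<Sum>i\<in>{..<t} - {0, j}. g i) \<in> vs.span ?U"
      using g(1) by (intro vs.span_sum vs.span_base UN_I) auto
    ultimately show "v \<in> vs.span ?U" by simp
  qed
qed

lemma card_H_inter_conj_H_le:
  assumes "0 < j" "j < t"
  shows "card (H \<inter> (\<Psi> ^^ j) ` H) \<le> CARD('a) ^ (n * (t - 2))"
proof -
  have "card (vs.span (\<Union>i\<in>{..<t} - {0, j}. (\<Psi> ^^ i) ` \<Theta>)) \<le> (CARD('a) ^ n) ^ card ({..<t} - {0, j})"
    using conj_\<Theta> card_pow[OF \<Theta>_subset] card_\<Theta> finite_sub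
    by (intro card_span_UN_le[THEN conjunct2]) auto
  moreover have "card ({..<t} - {0, j}) = t - 2" using assms by (subst card_Diff_subset) auto
  ultimately show ?thesis by (simp add: H_inter_conj_H[OF assms] power_mult)
qed

end

section \<open>The automorphism relating the two transversals\<close>

text \<open>Everything is lifted from \<open>W\<close> to \<open>V\<close> along the projection from \<open>\<Gamma>\<close>: \<open>\<S>\<close> is the set of the
  \<open>\<Gamma> + s\<close> with \<open>s\<close> in the pseudoregulus and \<open>H1\<close>, \<open>H2\<close> are \<open>\<Gamma> + T1\<close>, \<open>\<Gamma> + T2\<close>.\<close>

locale lifted_pseudoregulus = semilin q t K \<sigma> n N \<Psi> V0
  for q t and K :: "'a::{field,finite} itself" and \<sigma> n N \<Psi> V0 +
  fixes \<Gamma> H1 H2 :: "(nat \<Rightarrow> 'a) set" and \<S> :: "(nat \<Rightarrow> 'a) set set"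
  assumes n2: "n \<ge> 2" and t2: "t \<ge> 2"
    and card_\<Gamma>: "card \<Gamma> = CARD('a) ^ (n * (t - 2))"
    and subspace_\<Gamma>: "vs.subspace \<Gamma>"
    and scattered: "v \<in> V0 \<Longrightarrow> v' \<in> V0 \<Longrightarrow> v \<noteq> 0 \<Longrightarrow> smul a v - v' \<in> \<Gamma> \<Longrightarrow> a \<in> Fq"
    and S: "S \<in> \<S> \<Longrightarrow> vs.subspace S \<and> S \<subseteq> V \<and> \<Gamma> \<subseteq> S
      \<and> card S = CARD('a) ^ 2 * card \<Gamma> \<and> card (S \<inter> V0) = CARD('a)"
    and S_inter: "S \<in> \<S> \<Longrightarrow> S' \<in> \<S> \<Longrightarrow> S \<noteq> S' \<Longrightarrow> S \<inter> S' = \<Gamma>"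
    and S_cover: "V0 \<subseteq> \<Union>\<S>"
    and H: "H \<in> {H1, H2} \<Longrightarrow> vs.subspace H \<and> H \<subseteq> V \<and> \<Gamma> \<subseteq> H
      \<and> card H = CARD('a) ^ n * card \<Gamma> \<and> H \<inter> V0 = {0} \<and> (\<forall>S\<in>\<S>. S \<inter> H \<noteq> \<Gamma>)"
    and H_neq: "H1 \<noteq> H2"
begin

lemma H1: "H1 \<in> {H1, H2}" and H2: "H2 \<in> {H1, H2}" by auto

lemma HD:
  assumes "H \<in> {H1, H2}"
  shows "vs.subspace H" "H \<subseteq> V" "\<Gamma> \<subseteq> H" "card H = CARD('a) ^ n * card \<Gamma>" "H \<inter> V0 = {0}"
    "S \<in> \<S> \<Longrightarrow> S \<inter> H \<noteq> \<Gamma>"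
  using H[OF assms] by simp_all

lemmas H_diff = vs.subspace_diff[OF HD(1)] and H_add = vs.subspace_add[OF HD(1)]
  and H_scale = vs.subspace_scale[OF HD(1)]

lemma SD:
  assumes "S \<in> \<S>"
  shows "vs.subspace S" "S \<subseteq> V" "\<Gamma> \<subseteq> S" "card S = CARD('a) ^ 2 * card \<Gamma>"
    "card (S \<inter> V0) = CARD('a)"
  using S[OF assms] by simp_all

lemma H_V0_eq:
  assumes "H \<in> {H1, H2}" "v \<in> V0" "v' \<in> V0" "v - v' \<in> H"
  shows "v = v'"
proof -
  have "v - v' \<in> H \<inter> V0" using assms subspace_V0_Fq(2) by simp
  then show ?thesis unfolding HD(5)[OF assms(1)] by simp
qed

lemma H_V0_unique:
  assumes "H \<in> {H1, H2}" "x - v \<in> H" "x - v' \<in> H" "v \<in> V0" "v' \<in> V0"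
  shows "v = v'"
  using H_V0_eq[OF assms(1,4,5)] H_diff[OF assms(1,3,2)] by simp

lemma smul_notin_H:
  assumes HH: "H \<in> {H1, H2}" and v: "v \<in> V0" "v \<noteq> 0" and a: "smul a v \<in> H"
  shows "a = 0"
proof (rule ccontr)
  assume "a \<noteq> 0"
  then have "v = smul (inverse a) (smul a v)" by simp
  then have "v \<in> H" using H_scale[OF HH a, of "inverse a"] by simp
  then show False using v HD(5)[OF HH] by auto
qed

lemma add_closed_V0: "add_closed V0"
  using subspace_V0_Fq by (simp add: add_closed_def)

text \<open>By size: \<open>S \<inter> H\<close> is a subspace properly above
  \<open>\<Gamma>\<close>, so it has at least \<open>CARD('a) * card \<Gamma>\<close> vectors;
  \<open>S \<inter> V0\<close> has \<open>CARD('a)\<close>, and the two share only zero. Together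
  they exhaust \<open>S\<close>.\<close>

lemma S_eq_sum:
  assumes HH: "H \<in> {H1, H2}" and SS: "S \<in> \<S>"
  shows "S = (S \<inter> H) + (S \<inter> V0)"
proof -
  note s = SD[OF SS] and h = HD[OF HH]
  have sh: "vs.subspace (S \<inter> H)" using s(1) h(1) by (rule vs.subspace_inter)
  have sv: "add_closed (S \<inter> V0)"
    using add_closed_V0 add_closed_subspace[OF s(1)] by (simp add: add_closed_def)
  have "\<Gamma> \<subset> S \<inter> H" using s(3) h(3) h(6)[OF SS] by auto
  then have "CARD('a) * card \<Gamma> \<le> card (S \<inter> H)"
    using sh s(2) finite_sub[of "S \<inter> H"] by (intro card_subspace_psubset subspace_\<Gamma>) auto
  then have "card S \<le> card (S \<inter> H) * card (S \<inter> V0)"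
    using s(4,5) by (simp add: power2_eq_square)
  also have "\<dots> = card ((S \<inter> H) + (S \<inter> V0))"
  proof (rule card_set_plus_direct[symmetric])
    show "(S \<inter> H) \<inter> (S \<inter> V0) = {0}" using h(5) vs.subspace_0[OF s(1)] by auto
  qed (use sv add_closed_subspace[OF sh] s(2) in \<open>auto intro: finite_sub\<close>)
  finally have le: "card S \<le> card ((S \<inter> H) + (S \<inter> V0))" .
  have "(S \<inter> H) + (S \<inter> V0) \<subseteq> S"
    using vs.subspace_add[OF s(1)] by (auto elim!: set_plus_elim)
  then show ?thesis using card_seteq[OF finite_sub[OF s(2)]] le by blast
qed

text \<open>Here \<open>v'\<close> is the product of \<open>a\<close> and \<open>v\<close> in the
  structure that \<open>V0\<close> inherits from the quotient by \<open>H\<close>. The relation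
  \<open>smul a v - v' \<in> H\<close> is to be read this way throughout.\<close>

lemma ex_smul_image:
  assumes HH: "H \<in> {H1, H2}" and SS: "S \<in> \<S>" and v: "v \<in> V0" "v \<in> S"
  shows "\<exists>v'\<in>V0 \<inter> S. smul a v - v' \<in> H"
proof -
  have "smul a v \<in> (S \<inter> H) + (S \<inter> V0)"
    using S_eq_sum[OF HH SS] vs.subspace_scale[OF SD(1)[OF SS] v(2)] by simp
  then obtain h v' where "h \<in> S \<inter> H" "v' \<in> S \<inter> V0" "smul a v = h + v'" by (auto elim: set_plus_elim)
  then show ?thesis by (intro bexI[of _ v']) auto
qed

text \<open>Distinct scalars have distinct products with \<open>v\<close>, and
  \<open>S \<inter> V0\<close> has only \<open>CARD('a)\<close> elements: it is one line of the
  inherited structure.\<close>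

lemma ex_scalar:
  assumes HH: "H \<in> {H1, H2}" and SS: "S \<in> \<S>" and v: "v \<in> V0" "v \<in> S" "v \<noteq> 0"
    and v': "v' \<in> V0" "v' \<in> S"
  shows "\<exists>a. smul a v - v' \<in> H"
proof -
  obtain g where g: "\<And>a. g a \<in> V0 \<inter> S \<and> smul a v - g a \<in> H"
    using ex_smul_image[OF HH SS v(1,2)] by metis
  have "inj g"
  proof (rule injI)
    fix a b assume "g a = g b"
    then have "(smul a v - g a) - (smul b v - g a) \<in> H"
      using g H_diff[OF HH] by metis
    then have "smul (a - b) v \<in> H" by (simp add: vs.scale_left_diff_distrib)
    then have "a - b = 0" by (rule smul_notin_H[OF HH v(1,3)])
    then show "a = b" by simp
  qed
  then have "card (range g) = card (S \<inter> V0)" using SD(5)[OF SS] by (simp add: card_image)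
  moreover have "finite (S \<inter> V0)" using SD(2)[OF SS] by (intro finite_sub) auto
  moreover have "range g \<subseteq> S \<inter> V0" using g by auto
  ultimately have "range g = S \<inter> V0" using card_subset_eq by blast
  then obtain a where "v' = g a" using v' by auto
  then show ?thesis using g by auto
qed

text \<open>The scalar that acts on \<open>v\<close> in the structure from \<open>H2\<close> as
  \<open>a\<close> does in the structure from \<open>H1\<close>.\<close>

definition companion :: "(nat \<Rightarrow> 'a) \<Rightarrow> 'a \<Rightarrow> 'a" where
  "companion v a = (SOME b. \<exists>v'\<in>V0. smul a v - v' \<in> H1 \<and> smul b v - v' \<in> H2)"

lemma V0_in_S: "v \<in> V0 \<Longrightarrow> \<exists>S\<in>\<S>. v \<in> S"
  using S_cover by auto

lemma companion:
  assumes v: "v \<in> V0" "v \<noteq> 0"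
  shows "\<exists>v'\<in>V0. smul a v - v' \<in> H1 \<and> smul (companion v a) v - v' \<in> H2"
proof -
  obtain S where SS: "S \<in> \<S>" "v \<in> S" using V0_in_S[OF v(1)] by auto
  obtain v' where v': "v' \<in> V0 \<inter> S" "smul a v - v' \<in> H1"
    using ex_smul_image[OF H1 SS(1) v(1) SS(2)] by auto
  obtain b where "smul b v - v' \<in> H2"
    using ex_scalar[OF H2 SS(1) v(1) SS(2) v(2)] v' by auto
  then have "\<exists>b. \<exists>v'\<in>V0. smul a v - v' \<in> H1 \<and> smul b v - v' \<in> H2" using v' by auto
  then show ?thesis unfolding companion_def by (rule someI_ex)
qed

lemma companion_eq:
  assumes v: "v \<in> V0" "v \<noteq> 0" and v': "v' \<in> V0" "smul a v - v' \<in> H1" "smul b v - v' \<in> H2"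
  shows "companion v a = b"
proof -
  obtain w where w: "w \<in> V0" "smul a v - w \<in> H1" "smul (companion v a) v - w \<in> H2"
    using companion[OF v] by auto
  have "w = v'" using H_V0_unique[OF H1 w(2) v'(2)] w v' by simp
  then have "(smul (companion v a) v - v') - (smul b v - v') \<in> H2"
    using w(3) v'(3) H_diff[OF H2] by metis
  then have "smul (companion v a - b) v \<in> H2" by (simp add: vs.scale_left_diff_distrib)
  then have "companion v a - b = 0" by (rule smul_notin_H[OF H2 v])
  then show ?thesis by simp
qed

lemma \<Gamma>_V0: "v \<in> \<Gamma> \<Longrightarrow> v \<in> V0 \<Longrightarrow> v = 0"
  using HD(5)[OF H1] HD(3)[OF H1] by auto

text \<open>As in the fundamental theorem of projective geometry, comparing \<open>v\<close>, \<open>w\<close> and \<open>v + w\<close> makes the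
  companion scalar independent of the vector.\<close>

lemma companion_add:
  assumes v: "v \<in> V0" "v \<noteq> 0" and w: "w \<in> V0" "w \<noteq> 0"
    and S: "S \<in> \<S>" "v \<in> S" and S': "S' \<in> \<S>" "w \<in> S'" and "S \<noteq> S'"
  shows "companion (v + w) a = companion v a"
proof -
  note s = assms(5-8)
  have sub: "vs.subspace S" "vs.subspace S'" "vs.subspace H1" "vs.subspace H2"
    using SD(1)[OF s(1)] SD(1)[OF s(3)] HD(1)[OF H1] HD(1)[OF H2] by auto
  have inter: "x = 0" if "x \<in> V0" "x \<in> S" "x \<in> S'" for x
    using S_inter[OF s(1,3) \<open>S \<noteq> S'\<close>] \<Gamma>_V0[of x] that by auto
  have u: "v + w \<in> V0" using v w subspace_V0_Fq by blast
  have u0: "v + w \<noteq> 0"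
  proof
    assume "v + w = 0"
    then have "w = - v" by (simp add: add_eq_0_iff)
    then have "w \<in> S" using vs.subspace_neg[OF sub(1) s(2)] by simp
    then show False using inter[OF w(1)] s(4) w(2) by simp
  qed
  let ?k = "companion (v + w) a" and ?m = "companion v a" and ?l = "companion w a"
  obtain v' where v': "v' \<in> V0" "smul a v - v' \<in> H1" "smul ?m v - v' \<in> H2"
    using companion[OF v] by blast
  obtain w' where w': "w' \<in> V0" "smul a w - w' \<in> H1" "smul ?l w - w' \<in> H2"
    using companion[OF w] by blast
  obtain u' where u': "u' \<in> V0" "smul a (v + w) - u' \<in> H1" "smul ?k (v + w) - u' \<in> H2"
    using companion[OF u u0] by blast
  have "(smul a v - v') + (smul a w - w') \<in> H1" using v'(2) w'(2) by (rule H_add[OF H1])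
  then have "smul a (v + w) - (v' + w') \<in> H1" by (simp add: vs.scale_right_distrib algebra_simps)
  then have u'eq: "u' = v' + w'"
    using H_V0_unique[OF H1 u'(2)] u'(1) v'(1) w'(1) subspace_V0_Fq(1) by simp
  \<comment> \<open>In the structure from \<open>H2\<close> additivity gives
    \<open>(?k - ?m) v + (?k - ?l) w = 0\<close>. The summands are represented by \<open>x\<close>
    in \<open>S\<close> and \<open>y\<close> in \<open>S'\<close>, whose only common fixed vector is
    zero, so both vanish.\<close>
  obtain x where x: "x \<in> V0" "x \<in> S" "smul (?k - ?m) v - x \<in> H2"
    using ex_smul_image[OF H2 s(1) v(1) s(2)] by blast
  obtain y where y: "y \<in> V0" "y \<in> S'" "smul (?k - ?l) w - y \<in> H2"
    using ex_smul_image[OF H2 s(3) w(1) s(4)] by blast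
  have "(smul ?k (v + w) - u') - (smul ?m v - v') - (smul ?l w - w')
      - ((smul (?k - ?m) v - x) + (smul (?k - ?l) w - y)) \<in> H2"
    by (intro H_diff[OF H2] H_add[OF H2] u'(3) v'(3) w'(3) x(3) y(3))
  also have "(smul ?k (v + w) - u') - (smul ?m v - v') - (smul ?l w - w')
      - ((smul (?k - ?m) v - x) + (smul (?k - ?l) w - y)) = x + y"
    unfolding u'eq by (simp add: vs.scale_right_distrib vs.scale_left_diff_distrib algebra_simps)
  finally have "x + y \<in> H2 \<inter> V0" using x(1) y(1) subspace_V0_Fq(1) by simp
  then have "x + y = 0" unfolding HD(5)[OF H2] by simp
  then have "x = - y" by (simp add: eq_neg_iff_add_eq_0)
  then have "x \<in> S'" using vs.subspace_neg[OF sub(2) y(2)] by simp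
  then have "x = 0" using inter x(1,2) by simp
  then show ?thesis using smul_notin_H[OF H2 v, of "?k - ?m"] x(3) by simp
qed

text \<open>A member of \<open>\<S>\<close> exceeds \<open>\<Gamma>\<close> by two dimensions but
  \<open>V\<close> by \<open>2 * n\<close>, and \<open>V0\<close> spans \<open>V\<close>; here
  \<open>n \<ge> 2\<close> provides a second line to compare with.\<close>

lemma ex_outside: assumes "S \<in> \<S>" shows "\<exists>u\<in>V0. u \<notin> S"
proof (rule ccontr)
  assume "\<not> ?thesis"
  then have "V0 \<subseteq> S" by auto
  then have "vs.span V0 \<subseteq> S" by (rule vs.span_minimal[OF _ SD(1)[OF assms]])
  then have "V \<subseteq> S" by (simp add: span_V0)
  then have "CARD('a) ^ N \<le> card S"
    unfolding card_vecs[symmetric] using SD(2)[OF assms] by (intro card_mono finite_sub) auto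
  also have "\<dots> = CARD('a) ^ (2 + n * (t - 2))" using SD(4)[OF assms] by (simp only: card_\<Gamma> power_add)
  finally have le: "CARD('a) ^ N \<le> CARD('a) ^ (2 + n * (t - 2))" .
  have "CARD('a) > 1" unfolding card_field using q_ge_2 t_pos by (intro one_less_power) auto
  then have "N \<le> 2 + n * (t - 2)" using le by (rule power_le_imp_le_exp)
  moreover have "n * (t - 2) + 2 * n = N" using t2 by (simp add: N algebra_simps diff_mult_distrib2)
  ultimately show False using n2 by simp
qed

text \<open>Vectors from different members of \<open>\<S>\<close> are compared through their sum,
  vectors from the same member through a third one outside it.\<close>

lemma companion_const:
  assumes v: "v \<in> V0" "v \<noteq> 0" and w: "w \<in> V0" "w \<noteq> 0"
  shows "companion v a = companion w a"
proof -
  have indep: "companion v a = companion w a"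
    if v: "v \<in> V0" "v \<noteq> 0" "S \<in> \<S>" "v \<in> S" and w: "w \<in> V0" "w \<noteq> 0" "S' \<in> \<S>" "w \<in> S'" and "S \<noteq> S'"
    for v w S S'
    using companion_add[OF v(1,2) w(1,2) v(3,4) w(3,4) \<open>S \<noteq> S'\<close>, of a]
      companion_add[OF w(1,2) v(1,2) w(3,4) v(3,4) \<open>S \<noteq> S'\<close>[symmetric], of a]
    by (simp add: add.commute)
  obtain S where S1: "S \<in> \<S>" "v \<in> S" using V0_in_S[OF v(1)] by auto
  obtain S' where S2: "S' \<in> \<S>" "w \<in> S'" using V0_in_S[OF w(1)] by auto
  show ?thesis
  proof (cases "S = S'")
    case True
    obtain u where u: "u \<in> V0" "u \<notin> S" using ex_outside[OF S1(1)] by auto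
    obtain T where T: "T \<in> \<S>" "u \<in> T" using V0_in_S[OF u(1)] by auto
    have "u \<noteq> 0" using u(2) vs.subspace_0[OF SD(1)[OF S1(1)]] by auto
    moreover have "S \<noteq> T" using u T by auto
    ultimately show ?thesis
      using indep[OF v S1 u(1) _ T] indep[OF w S2 u(1) _ T] True by simp
  qed (use indep[OF v S1 w S2] in simp)
qed

lemma ex_V0_nonzero: "\<exists>v\<in>V0. v \<noteq> 0"
proof -
  obtain S where "S \<in> \<S>" using S_cover subspace_V0_Fq(4) by blast
  then show ?thesis using ex_outside SD(1) vs.subspace_0 by metis
qed

lemma ex_companion_auto:
  "\<exists>\<alpha>. field_auto \<alpha> \<and> (\<forall>x\<in>Fq. \<alpha> x = x)
     \<and> (\<forall>v\<in>V0. \<forall>a. \<exists>v'\<in>V0. smul a v - v' \<in> H1 \<and> smul (\<alpha> a) v - v' \<in> H2)"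
proof -
  obtain v where v: "v \<in> V0" "v \<noteq> 0" using ex_V0_nonzero by auto
  have sub: "vs.subspace H1" "vs.subspace H2" using HD(1)[OF H1] HD(1)[OF H2] .
  define \<alpha> where "\<alpha> = companion v"
  have \<alpha>: "\<exists>w'\<in>V0. smul a w - w' \<in> H1 \<and> smul (\<alpha> a) w - w' \<in> H2" if w: "w \<in> V0" for w a
  proof (cases "w = 0")
    case True
    then show ?thesis using subspace_V0_Fq(4) sub vs.subspace_0 by (intro bexI[of _ 0]) auto
  next
    case False
    then show ?thesis using companion[OF w False, of a] companion_const[OF w False v, of a]
      by (simp add: \<alpha>_def)
  qed
  have fq: "\<alpha> x = x" if "x \<in> Fq" for x
    unfolding \<alpha>_def using subspace_V0_Fq(3)[OF v(1) that] sub vs.subspace_0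
    by (intro companion_eq[OF v, of "smul x v" x x]) simp_all
  have add: "\<alpha> (x + y) = \<alpha> x + \<alpha> y" for x y
  proof -
    obtain a b where a: "a \<in> V0" "smul x v - a \<in> H1" "smul (\<alpha> x) v - a \<in> H2"
      and b: "b \<in> V0" "smul y v - b \<in> H1" "smul (\<alpha> y) v - b \<in> H2"
      using \<alpha>[OF v(1)] by meson
    have "(smul x v - a) + (smul y v - b) \<in> H1" "(smul (\<alpha> x) v - a) + (smul (\<alpha> y) v - b) \<in> H2"
      using a(2,3) b(2,3) H_add[OF H1] H_add[OF H2] by simp_all
    then have "smul (x + y) v - (a + b) \<in> H1" "smul (\<alpha> x + \<alpha> y) v - (a + b) \<in> H2"
      by (simp_all add: vs.scale_left_distrib algebra_simps)
    then show ?thesis unfolding \<alpha>_def using companion_eq[OF v, of "a + b"] a b subspace_V0_Fq(1) by simp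
  qed
  \<comment> \<open>The product is formed in two stages, first at \<open>v\<close> and then at
    \<open>b\<close>; this works because the companion does not depend on the vector.\<close>
  have mult: "\<alpha> (x * y) = \<alpha> x * \<alpha> y" for x y
  proof -
    obtain b where b: "b \<in> V0" "smul y v - b \<in> H1" "smul (\<alpha> y) v - b \<in> H2"
      using \<alpha>[OF v(1)] by meson
    obtain a where a: "a \<in> V0" "smul x b - a \<in> H1" "smul (\<alpha> x) b - a \<in> H2"
      using \<alpha>[OF b(1)] by meson
    have "smul x (smul y v - b) + (smul x b - a) \<in> H1" "smul (\<alpha> x) (smul (\<alpha> y) v - b) + (smul (\<alpha> x) b - a) \<in> H2"
      by (intro H_add[OF H1] H_scale[OF H1] a b) (intro H_add[OF H2] H_scale[OF H2] a b)
    then have "smul (x * y) v - a \<in> H1" "smul (\<alpha> x * \<alpha> y) v - a \<in> H2"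
      by (simp_all add: vs.scale_right_diff_distrib)
    then show ?thesis unfolding \<alpha>_def using companion_eq[OF v, of a] a by simp
  qed
  have inj: "inj \<alpha>"
  proof (rule injI)
    fix x y assume xy: "\<alpha> x = \<alpha> y"
    obtain a b where a: "a \<in> V0" "smul x v - a \<in> H1" "smul (\<alpha> x) v - a \<in> H2"
      and b: "b \<in> V0" "smul y v - b \<in> H1" "smul (\<alpha> y) v - b \<in> H2"
      using \<alpha>[OF v(1)] by meson
    have "a = b" using H_V0_unique[OF H2 a(3)] b a xy by simp
    then have "(smul x v - a) - (smul y v - a) \<in> H1" using H_diff[OF H1 a(2), of "smul y v - a"] b(2) \<open>a = b\<close> by simp
    then have "smul (x - y) v \<in> H1" by (simp add: vs.scale_left_diff_distrib)
    then have "x - y = 0" by (rule smul_notin_H[OF H1 v])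
    then show "x = y" by simp
  qed
  show ?thesis
    by (intro exI[of _ \<alpha>]) (use \<alpha> fq add mult inj in \<open>simp add: field_auto_def\<close>)
qed

lemma Psi_pow_H1_eq_H2: "\<exists>j. 0 < j \<and> j < t \<and> coprime j t \<and> (\<Psi> ^^ j) ` H1 = H2 \<and> \<Gamma> = H1 \<inter> H2"
proof -
  obtain \<alpha> where \<alpha>: "field_auto \<alpha>" "\<And>x. x \<in> Fq \<Longrightarrow> \<alpha> x = x"
    "\<And>v a. v \<in> V0 \<Longrightarrow> \<exists>v'\<in>V0. smul a v - v' \<in> H1 \<and> smul (\<alpha> a) v - v' \<in> H2"
    using ex_companion_auto by auto
  obtain j where j: "j < t" "\<alpha> = \<sigma> ^^ j" using field_auto_eq_funpow[OF \<alpha>(1,2)] by auto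
  have sub: "vs.subspace H1" "vs.subspace H2" "H1 \<subseteq> V" "H2 \<subseteq> V"
    using HD(1,2)[OF H1] HD(1,2)[OF H2] by auto
  \<comment> \<open>The projection of \<open>v\<close> onto \<open>V0\<close> along
    \<open>H1\<close> equals that of its image under \<open>\<Psi> ^^ j\<close> along
    \<open>H2\<close>. On multiples of fixed vectors this is the property of
    \<open>\<alpha>\<close>, and additivity extends it to the span. Comparing kernels then carries
    \<open>H1\<close> into \<open>H2\<close>.\<close>
  have key: "v \<in> V \<and> (\<exists>v'\<in>V0. v - v' \<in> H1 \<and> (\<Psi> ^^ j) v - v' \<in> H2)" if "v \<in> vs.span V0" for v
    using that
  proof (induction rule: vs.span_induct_alt)
    case base
    show ?case using V_closed(1) subspace_V0_Fq(4) sub vs.subspace_0 pow_0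
      by (intro conjI bexI[of _ 0]) auto
  next
    case (step c x y)
    obtain y' where y: "y \<in> V" "y' \<in> V0" "y - y' \<in> H1" "(\<Psi> ^^ j) y - y' \<in> H2" using step.IH by auto
    have x: "x \<in> V" using step V0_subset by auto
    obtain x' where x': "x' \<in> V0" "smul c x - x' \<in> H1" "smul (\<alpha> c) x - x' \<in> H2"
      using \<alpha>(3)[OF step.hyps] by blast
    have "(smul c x - x') + (y - y') \<in> H1" "(smul (\<alpha> c) x - x') + ((\<Psi> ^^ j) y - y') \<in> H2"
      using x'(2,3) y(3,4) H_add[OF H1] H_add[OF H2] by simp_all
    moreover have "(\<Psi> ^^ j) (smul c x + y) = smul (\<alpha> c) x + (\<Psi> ^^ j) y"
      using x y(1) step.hyps V_closed(4)[OF x, of c] by (simp add: pow_add pow_smul pow_V0 j(2))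
    ultimately have "smul c x + y - (x' + y') \<in> H1" "(\<Psi> ^^ j) (smul c x + y) - (x' + y') \<in> H2"
      by (simp_all add: algebra_simps)
    then show ?case using V_closed(2)[OF V_closed(4)[OF x] y(1)] subspace_V0_Fq(1)[OF x'(1) y(2)]
      by (intro conjI bexI[of _ "x' + y'"])
  qed
  have "(\<Psi> ^^ j) ` H1 \<subseteq> H2"
  proof clarify
    fix v assume v: "v \<in> H1"
    then obtain v' where v': "v' \<in> V0" "v - v' \<in> H1" "(\<Psi> ^^ j) v - v' \<in> H2"
      using key sub(3) span_V0 by blast
    have "v - (v - v') \<in> H1" using v v'(2) by (rule H_diff[OF H1])
    then have "v' = 0" using v'(1) HD(5)[OF H1] by auto
    then show "(\<Psi> ^^ j) v \<in> H2" using v' by simp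
  qed
  moreover have "card ((\<Psi> ^^ j) ` H1) = card H2" using card_pow[OF sub(3)] HD(4)[OF H1] HD(4)[OF H2] by simp
  ultimately have eq: "(\<Psi> ^^ j) ` H1 = H2" using card_subset_eq finite_sub[OF sub(4)] by blast
  have "j \<noteq> 0" using eq H_neq by (intro notI) simp
  then have j0: "0 < j" by simp
  have NN: "n + n * (t - 2) + n = N" using t2 by (simp add: N algebra_simps diff_mult_distrib2)
  interpret semilin_complement q t K \<sigma> n N \<Psi> V0 H1
  proof
    show "card H1 * CARD('a) ^ n = CARD('a) ^ N"
      using HD(4)[OF H1] card_\<Gamma> by (simp add: NN[symmetric] power_add)
  qed (use HD[OF H1] in auto)
  have "card (H1 \<inter> H2) \<le> card \<Gamma>" using card_H_inter_conj_H_le[OF j0 j(1)] by (simp add: eq card_\<Gamma>)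
  then have \<Gamma>: "\<Gamma> = H1 \<inter> H2"
    using HD(2,3)[OF H1] HD(3)[OF H2] finite_sub[of "H1 \<inter> H2"] by (intro card_seteq) auto
  \<comment> \<open>A scalar fixed by \<open>\<sigma> ^^ j\<close> has the same product with
    \<open>v\<close> in both structures, so the difference lies in
    \<open>H1 \<inter> H2 = \<Gamma>\<close> and scatteredness applies.\<close>
  have "coprime j t"
  proof (rule funpow_coprime)
    fix x assume x: "(\<sigma> ^^ j) x = x"
    obtain v where v: "v \<in> V0" "v \<noteq> 0" using ex_V0_nonzero by auto
    obtain v' where "v' \<in> V0" "smul x v - v' \<in> H1" "smul (\<alpha> x) v - v' \<in> H2" using \<alpha>(3)[OF v(1)] by blast
    then show "x \<in> Fq" using scattered[OF v(1) _ v(2)] x j(2) \<Gamma> by auto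
  qed
  then show ?thesis using j(1) j0 eq \<Gamma> by blast
qed

section \<open>Spread elements and the decomposition of \<open>\<Gamma>\<close>\<close>

sublocale semilin_complement q t K \<sigma> n N \<Psi> V0 H1
proof
  have NN: "n + n * (t - 2) + n = N" using t2 by (simp add: N algebra_simps diff_mult_distrib2)
  show "card H1 * CARD('a) ^ n = CARD('a) ^ N"
    using HD(4)[OF H1] card_\<Gamma> by (simp add: NN[symmetric] power_add)
qed (use HD[OF H1] in auto)

text \<open>Since \<open>tr p\<close> and \<open>p\<close> agree modulo \<open>H1\<close>, the
  products of \<open>tr p\<close> in the inherited structure are the traces of the
  \<open>K\<close>-multiples of \<open>p\<close>. They form both the line
  \<open>S \<inter> V0\<close> and the spread element of the point \<open>p\<close>.\<close>

lemma S_V0_iff: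
  assumes p: "p \<in> \<Theta>" "p \<noteq> 0" and SS: "S \<in> \<S>" "tr p \<in> S" and v: "v \<in> V0"
  shows "v \<in> S \<longleftrightarrow> v \<in> vs.span (\<Union>i<t. (\<Psi> ^^ i) ` vs.span {p})"
proof -
  have pV: "p \<in> V" using p \<Theta>_subset by auto
  have spV: "vs.span {p} \<subseteq> V" using pV subspace_vecs by (intro vs.span_minimal) auto
  have sp: "vs.span {p} \<subseteq> \<Theta>" using p subspace_\<Theta> by (intro vs.span_minimal) auto
  have tr: "tr p \<in> V0" by (rule tr_in_V0[OF pV])
  have tr0: "tr p \<noteq> 0"
  proof
    assume "tr p = 0"
    then have "p \<in> H1" using vs.subspace_neg[OF subspace_H tr_minus_self[OF p(1)]] by simp
    then show False using p \<Theta>_H by auto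
  qed
  have shift: "smul a (tr p) - x \<in> H1 \<longleftrightarrow> smul a p - x \<in> H1" for a x
  proof -
    have e: "smul a (tr p - p) \<in> H1" using tr_minus_self[OF p(1)] by (rule vs.subspace_scale[OF subspace_H])
    have "smul a (tr p) - x = (smul a p - x) + smul a (tr p - p)"
      by (simp add: vs.scale_right_diff_distrib)
    then show ?thesis using e vs.subspace_add[OF subspace_H] vs.subspace_diff[OF subspace_H]
      by (metis add_diff_cancel_right')
  qed
  show ?thesis
  proof
    assume "v \<in> S"
    then obtain a where a: "smul a (tr p) - v \<in> H1" using ex_scalar[OF H1 SS(1) tr SS(2) tr0 v] by auto
    obtain \<theta> where \<theta>: "\<theta> \<in> \<Theta>" "v = tr \<theta>" using V0_eq_tr[OF v] by auto
    have "(smul a p - v) + (tr \<theta> - \<theta>) \<in> H1"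
      using a tr_minus_self[OF \<theta>(1)] unfolding shift by (rule vs.subspace_add[OF subspace_H])
    then have "smul a p - \<theta> \<in> H1" by (simp add: \<theta>(2))
    moreover have "smul a p - \<theta> \<in> \<Theta>"
      by (intro vs.subspace_diff[OF subspace_\<Theta>] vs.subspace_scale[OF subspace_\<Theta>] p \<theta>)
    ultimately have "smul a p - \<theta> \<in> \<Theta> \<inter> H1" by simp
    then have "\<theta> = smul a p" unfolding \<Theta>_H by simp
    then have "\<theta> \<in> vs.span {p}" by (auto simp: vs.span_singleton)
    then show "v \<in> vs.span (\<Union>i<t. (\<Psi> ^^ i) ` vs.span {p})"
      unfolding \<theta>(2) tr_def by (intro vs.span_sum vs.span_base UN_I) auto
  next
    assume "v \<in> vs.span (\<Union>i<t. (\<Psi> ^^ i) ` vs.span {p})"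
    then have "v \<in> {\<Sum>i\<in>{..<t}. g i | g. \<forall>i\<in>{..<t}. g i \<in> (\<Psi> ^^ i) ` vs.span {p}}"
      using span_UN_subspaces[of "{..<t}" "\<lambda>i. (\<Psi> ^^ i) ` vs.span {p}"] subspace_pow[OF _ spV] by simp
    then obtain g where g: "v = (\<Sum>i<t. g i)" "\<And>i. i < t \<Longrightarrow> g i \<in> (\<Psi> ^^ i) ` vs.span {p}" by auto
    \<comment> \<open>The zeroth component is a multiple \<open>smul a p\<close> and determines the
      fixed vector \<open>v\<close> modulo \<open>H1\<close>: \<open>v\<close> is the product of
      \<open>a\<close> and \<open>tr p\<close>.\<close>
    have "g 0 \<in> vs.span {p}" using g(2)[of 0] t_pos by simp
    then obtain a where a: "g 0 = smul a p" by (auto simp: vs.span_singleton)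
    have "v - g 0 \<in> (\<Psi> ^^ 0) ` H1"
      unfolding g(1) by (rule sum_minus_component) (use g(2) sp t_pos in auto)
    then have "v - smul a p \<in> H1" using a by simp
    from vs.subspace_neg[OF subspace_H this] have "smul a p - v \<in> H1" by simp
    then have 1: "smul a (tr p) - v \<in> H1" unfolding shift .
    obtain v' where "v' \<in> V0" "v' \<in> S" "smul a (tr p) - v' \<in> H1"
      using ex_smul_image[OF H1 SS(1) tr SS(2)] by blast
    then show "v \<in> S" using H_V0_unique[OF H1 1, of v'] v by auto
  qed
qed

lemma ex_S_\<Theta>:
  assumes "S \<in> \<S>"
  shows "\<exists>p\<in>\<Theta>. p \<noteq> 0 \<and> tr p \<in> S"
proof -
  have "card {0 :: nat \<Rightarrow> 'a} < card (S \<inter> V0)"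
    using SD(5)[OF assms] card_field q_ge_2 t_pos one_less_power[of q t] by simp
  then have "\<not> S \<inter> V0 \<subseteq> {0}" by (meson card_mono finite.emptyI finite.insertI not_le)
  then obtain v where v: "v \<in> V0" "v \<in> S" "v \<noteq> 0" by auto
  obtain p where p: "p \<in> \<Theta>" "v = tr p" using V0_eq_tr[OF v(1)] by auto
  have "p \<noteq> 0" using v(3) p(2) by (auto simp: tr_def pow_0)
  then show ?thesis using p v by auto
qed

lemma ex_\<Theta>_S: "p \<in> \<Theta> \<Longrightarrow> \<exists>S\<in>\<S>. tr p \<in> S"
  using V0_in_S tr_in_V0 \<Theta>_subset by blast

text \<open>As \<open>j\<close> is invertible modulo \<open>t\<close>, the exponents other than 0
  and \<open>j\<close> are \<open>2 * j\<close>, \<open>3 * j\<close>, up to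
  \<open>(t - 1) * j\<close>. This progression of \<open>t - 2\<close> terms dictates the conjugate
  of \<open>\<Theta>\<close> to start from and the last index \<open>t - 3\<close>.\<close>

lemma \<Gamma>_eq_span:
  "\<exists>j. coprime j t \<and> \<Gamma> = vs.span (\<Union>i\<le>t - 3. (\<Psi> ^^ (j * i)) ` (\<Psi> ^^ (2 * j mod t)) ` \<Theta>)"
  if t3: "t \<ge> 3"
proof -
  obtain j where j: "0 < j" "j < t" "coprime j t" "(\<Psi> ^^ j) ` H1 = H2" "\<Gamma> = H1 \<inter> H2"
    using Psi_pow_H1_eq_H2 by auto
  have im: "(\<Psi> ^^ (j * i)) ` (\<Psi> ^^ (2 * j mod t)) ` \<Theta> = (\<Psi> ^^ (j * (i + 2) mod t)) ` \<Theta>" for i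
  proof -
    have "(\<Psi> ^^ (j * i)) ((\<Psi> ^^ (2 * j mod t)) v) = (\<Psi> ^^ (j * (i + 2) mod t)) v" if "v \<in> \<Theta>" for v
    proof -
      have v: "v \<in> V" using that \<Theta>_subset by auto
      have "(\<Psi> ^^ (j * i)) ((\<Psi> ^^ (2 * j mod t)) v) = (\<Psi> ^^ (j * i + 2 * j)) v"
        using pow_mod[OF v, of "2 * j"] by (simp add: pow_pow[symmetric])
      also have "j * i + 2 * j = j * (i + 2)" by (simp add: distrib_left)
      also have "(\<Psi> ^^ (j * (i + 2))) v = (\<Psi> ^^ (j * (i + 2) mod t)) v"
        by (rule pow_mod[OF v, symmetric])
      finally show ?thesis .
    qed
    then show ?thesis by (auto simp: image_image intro!: image_cong)
  qed
  have inj: "inj_on (\<lambda>i. j * i mod t) {..<t}"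
  proof (rule inj_onI)
    fix a b assume ab: "a \<in> {..<t}" "b \<in> {..<t}" "j * a mod t = j * b mod t"
    then have "[a = b] (mod t)" using j(3) by (simp add: cong_def[symmetric] cong_mult_lcancel_nat)
    then show "a = b" using ab by (simp add: cong_def)
  qed
  have img: "(\<lambda>i. j * i mod t) ` {..<t} = {..<t}"
    using inj t_pos by (intro card_subset_eq) (auto simp: card_image)
  have "(\<lambda>i. j * (i + 2) mod t) ` {..t - 3} = (\<lambda>i. j * i mod t) ` ({..<t} - {0, 1})"
  proof -
    have "(\<lambda>i. i + 2) ` {..t - 3} = {..<t} - {0, 1}"
    proof
      show "{..<t} - {0, 1} \<subseteq> (\<lambda>i. i + 2) ` {..t - 3}"
      proof
        fix x assume "x \<in> {..<t} - {0, 1}"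
        then show "x \<in> (\<lambda>i. i + 2) ` {..t - 3}" using t3 by (intro image_eqI[of _ _ "x - 2"]) auto
      qed
    qed (use t3 in auto)
    then show ?thesis by (metis (no_types, lifting) image_image image_cong)
  qed
  also have "\<dots> = {..<t} - {0, j}"
    using inj_on_image_set_diff[OF inj, of "{..<t}" "{0, 1}"] t3 j(2) by (simp add: img)
  finally have idx: "(\<lambda>i. j * (i + 2) mod t) ` {..t - 3} = {..<t} - {0, j}" .
  have "\<Gamma> = vs.span (\<Union>i\<in>{..<t} - {0, j}. (\<Psi> ^^ i) ` \<Theta>)"
    using j(4,5) H_inter_conj_H[OF j(1,2)] by simp
  also have "(\<Union>i\<in>{..<t} - {0, j}. (\<Psi> ^^ i) ` \<Theta>)
      = (\<Union>i\<le>t - 3. (\<Psi> ^^ (j * i)) ` (\<Psi> ^^ (2 * j mod t)) ` \<Theta>)"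
    unfolding idx[symmetric] im by blast
  finally show ?thesis using j(3) by blast
qed

end

section \<open>Subgeometries\<close>

lemma card_span_independent:
  fixes B :: "(nat \<Rightarrow> 'a::{field,finite}) set"
  assumes "finite B" "vs.independent B"
  shows "finite (vs.span B) \<and> card (vs.span B) = CARD('a) ^ card B"
  using assms
proof (induction B rule: finite_induct)
  case (insert a B)
  have ind: "vs.independent B" and a: "a \<notin> vs.span B"
    using insert by (auto simp: vs.independent_insert)
  have a0: "a \<noteq> 0" using a vs.span_zero by auto
  have eq: "vs.span (insert a B) = vs.span {a} + vs.span B"
    using vs.span_Un[of "{a}" B] by (auto simp: set_plus_def)
  have fin: "finite (vs.span {a})" by (simp add: vs.span_singleton)
  have "c = 0" if "smul c a \<in> vs.span B" for c
  proof (rule ccontr)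
    assume "c \<noteq> 0"
    then have "a = smul (inverse c) (smul c a)" by simp
    then show False using a vs.span_scale[OF that, of "inverse c"] by simp
  qed
  then have "vs.span {a} \<inter> vs.span B = {0}" by (auto simp: vs.span_singleton vs.span_zero)
  then have "card (vs.span (insert a B)) = card (vs.span {a}) * card (vs.span B)"
    unfolding eq using insert.IH[OF ind] fin
    by (intro card_set_plus_direct add_closed_subspace) auto
  then show ?case
    using insert.IH[OF ind] insert.hyps fin card_span_singleton[OF a0]
    by (simp add: eq finite_set_plus)
qed simp

lemma span_singleton_eqI:
  assumes "u \<in> vs.span {v}" "u \<noteq> 0"
  shows "vs.span {u} = vs.span {v}"
proof -
  obtain c where c: "u = smul c v" using assms(1) by (auto simp: vs.span_singleton)
  have "v = smul (inverse c) u" using c assms(2) by auto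
  then have "v \<in> vs.span {u}" by (auto simp: vs.span_singleton)
  then show ?thesis using assms(1) by (simp add: vs.span_eq)
qed

lemma card_preimage_fibres:
  assumes "finite A" "M \<subseteq> g ` A" "\<And>y. y \<in> g ` A \<Longrightarrow> card {x \<in> A. g x = y} = c"
  shows "card {x \<in> A. g x \<in> M} = c * card M"
proof -
  have M: "finite M" using assms finite_subset by blast
  have "{x \<in> A. g x \<in> M} = (\<Union>y\<in>M. {x \<in> A. g x = y})" by auto
  then have "card {x \<in> A. g x \<in> M} = (\<Sum>y\<in>M. card {x \<in> A. g x = y})"
    using M assms(1) by (simp only:) (subst card_UN_disjoint, auto)
  also have "\<dots> = (\<Sum>y\<in>M. c)" using assms by (intro sum.cong) auto
  finally show ?thesis by simp
qed

lemma is_point_span: "v \<in> vecs N \<Longrightarrow> v \<noteq> 0 \<Longrightarrow> is_point N (vs.span {v})"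
  using vs.span_minimal[OF _ subspace_vecs, of "{v}" N]
  by (simp add: is_point_def ksub_iff card_span_singleton)

lemma is_pointE:
  assumes "is_point N P"
  obtains v where "v \<in> vecs N" "v \<noteq> 0" "P = vs.span {v}"
proof -
  have P: "vs.subspace P" "P \<subseteq> vecs N" "card P = CARD('a)" using assms by (auto simp: is_point_def ksub_iff)
  have "CARD('a) \<noteq> 1"
    by (metis (full_types) UNIV_I card_1_singletonE singletonD zero_neq_one)
  then have "P \<noteq> {0}" using P(3) by auto
  then obtain v where v: "v \<in> P" "v \<noteq> 0" using vs.subspace_0[OF P(1)] by auto
  have "vs.span {v} \<subseteq> P" using v P(1) by (intro vs.span_minimal) auto
  then have "vs.span {v} = P"
    using P card_span_singleton[OF v(2)] finite_subset[OF P(2) finite_vecs]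
    by (intro card_subset_eq) auto
  then show ?thesis using that[of v] v P(2) by auto
qed

section \<open>From fixed points of the collineation to fixed vectors\<close>

locale subgeometry = field_ext q t K
  for q t and K :: "'a::{field,finite} itself" +
  fixes N :: nat and \<sigma> :: "'a \<Rightarrow> 'a" and f :: "(nat \<Rightarrow> 'a) \<Rightarrow> (nat \<Rightarrow> 'a)"
    and V0 :: "(nat \<Rightarrow> 'a) set"
  assumes N2: "N \<ge> 2"
    and f: "semilinear N \<sigma> f"
    and V0_Fq: "subsp_over Fq N V0" and card_V0: "card V0 = q ^ N"
    and kspan_V0: "kspan N V0 = vecs N" and fixpts_eq: "fixpts N f = lin_set N V0"
begin

lemma V0_sub: "V0 \<subseteq> vecs N"
  using V0_Fq by (simp add: subsp_over_def)

lemma sp_V0: "vs.span V0 = vecs N"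
  using kspan_V0 kspan_eq[OF V0_sub] by simp

lemma V0_closed: "0 \<in> V0" "v \<in> V0 \<Longrightarrow> w \<in> V0 \<Longrightarrow> v + w \<in> V0" "a \<in> Fq \<Longrightarrow> v \<in> V0 \<Longrightarrow> smul a v \<in> V0"
  using V0_Fq by (auto simp: subsp_over_def vadd_eq zvec_eq)

lemma auto_\<sigma>: "field_auto \<sigma>"
  using f by (simp add: semilinear_def field_auto_def bij_is_inj)

lemma surj_\<sigma>: "\<exists>b. \<sigma> b = a"
  using f by (metis bij_pointE semilinear_def)

lemma f_vecs: "v \<in> vecs N \<Longrightarrow> f v \<in> vecs N"
  using f by (auto simp: semilinear_def dest: bij_betwE)

lemma f_add: "v \<in> vecs N \<Longrightarrow> w \<in> vecs N \<Longrightarrow> f (v + w) = f v + f w"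
  using f by (auto simp: semilinear_def vadd_eq)

lemma f_smul: "v \<in> vecs N \<Longrightarrow> f (smul a v) = smul (\<sigma> a) (f v)"
  using f by (auto simp: semilinear_def)

lemma kspan_single: "v \<in> vecs N \<Longrightarrow> kspan N {v} = vs.span {v}"
  by (rule kspan_eq) simp

lemma fixpts_iff: "P \<in> fixpts N f \<longleftrightarrow> (\<exists>v\<in>V0. v \<noteq> 0 \<and> P = vs.span {v})"
  unfolding fixpts_eq lin_set_def zvec_eq using V0_sub kspan_single by blast

lemma card_gt_1: "CARD('a) > 1"
  unfolding card_field using q_ge_2 t_pos by (intro one_less_power) auto

lemma ex_V0_outside:
  assumes "v \<in> vecs N" shows "\<exists>u\<in>V0. u \<notin> vs.span {v}"
proof (rule ccontr)
  assume "\<not> ?thesis"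
  then have "vecs N \<subseteq> vs.span {v}" using vs.span_minimal[of V0 "vs.span {v}"] sp_V0 by auto
  then have "CARD('a) ^ N \<le> card (vs.span {v})"
    unfolding card_vecs[symmetric] by (intro card_mono) (auto simp: vs.span_singleton)
  also have "\<dots> \<le> CARD('a)" unfolding vs.span_singleton by (intro card_image_le) simp
  finally have "CARD('a) ^ N \<le> CARD('a) ^ 1" by simp
  then have "N \<le> 1" using power_le_imp_le_exp[OF card_gt_1] by blast
  then show False using N2 by simp
qed

lemma ex_eigenvalue: assumes "v \<in> V0" "v \<noteq> 0" shows "\<exists>c. f v = smul c v"
proof -
  have "f ` vs.span {v} = vs.span {v}"
    using assms fixpts_iff by (auto simp: fixpts_def)
  then have "f v \<in> vs.span {v}" using vs.span_base[of v "{v}"] by blast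
  then show ?thesis by (auto simp: vs.span_singleton)
qed

text \<open>Fixed points make every vector of \<open>V0\<close> an eigenvector. For \<open>v\<close>
  and \<open>w\<close> on different points, \<open>v + w\<close> is again in \<open>V0\<close>,
  which forces equal eigenvalues.\<close>

lemma ex_common_eigenvalue: "\<exists>c. c \<noteq> 0 \<and> (\<forall>v\<in>V0. f v = smul c v)"
proof -
  define l where "l v = (SOME c. f v = smul c v)" for v
  have l: "f v = smul (l v) v" if "v \<in> V0" "v \<noteq> 0" for v
    unfolding l_def by (rule someI_ex[OF ex_eigenvalue[OF that]])
  have indep: "l v = l w" if v: "v \<in> V0" "v \<noteq> 0" and w: "w \<in> V0" "w \<notin> vs.span {v}" for v w
  proof -
    have w0: "w \<noteq> 0" using w(2) vs.span_zero by auto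
    have "v + w \<noteq> 0"
    proof
      assume "v + w = 0"
      then have "w = - v" by (simp add: add_eq_0_iff)
      then show False using w(2) vs.span_neg[OF vs.span_base[of v "{v}"]] by simp
    qed
    then have "smul (l (v + w)) (v + w) = smul (l v) v + smul (l w) w"
      using l[of "v + w"] l[OF v] l[OF w(1) w0] f_add[of v w] V0_closed(2)[OF v(1) w(1)] v(1) w(1) V0_sub
      by auto
    then have eq: "smul (l w - l (v + w)) w = smul (l (v + w) - l v) v"
      by (simp add: vs.scale_right_distrib vs.scale_left_diff_distrib algebra_simps)
    have 1: "l w - l (v + w) = 0"
    proof (rule ccontr)
      assume nz: "l w - l (v + w) \<noteq> 0"
      then have "w = smul (inverse (l w - l (v + w))) (smul (l w - l (v + w)) w)" by simp
      then have "w \<in> vs.span {v}" unfolding eq by (auto simp: vs.span_singleton)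
      then show False using w(2) by simp
    qed
    then have "smul (l (v + w) - l v) v = 0" using eq by simp
    then show ?thesis using 1 v(2) by simp
  qed
  obtain v where v: "v \<in> V0" "v \<noteq> 0" using ex_V0_outside[of 0] subspace_vecs vs.subspace_0 by fastforce
  have const: "l w = l v" if w: "w \<in> V0" "w \<noteq> 0" for w
  proof (cases "w \<in> vs.span {v}")
    case True
    obtain u where u: "u \<in> V0" "u \<notin> vs.span {v}" using ex_V0_outside v(1) V0_sub by auto
    have "u \<notin> vs.span {w}" using u(2) span_singleton_eqI[OF True w(2)] by simp
    then show ?thesis using indep[OF v u] indep[OF w u(1)] by simp
  qed (use indep[OF v w(1)] in simp)
  have "f 0 = 0" using f_smul[of 0 0] subspace_vecs vs.subspace_0 field_autoD(3)[OF auto_\<sigma>] by auto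
  moreover have "l v \<noteq> 0"
  proof
    assume "l v = 0"
    then have "f v = f 0" using l[OF v] \<open>f 0 = 0\<close> by simp
    moreover have "inj_on f (vecs N)" using f by (simp add: semilinear_def bij_betw_def)
    ultimately show False using v V0_sub vs.subspace_0[OF subspace_vecs] by (auto dest: inj_onD)
  qed
  ultimately show ?thesis using l const by (intro exI[of _ "l v"]) force
qed

definition ev :: 'a where "ev = (SOME c. c \<noteq> 0 \<and> (\<forall>v\<in>V0. f v = smul c v))"

lemma ev: "ev \<noteq> 0" "v \<in> V0 \<Longrightarrow> f v = smul ev v"
proof -
  have "ev \<noteq> 0 \<and> (\<forall>v\<in>V0. f v = smul ev v)"
    unfolding ev_def by (rule someI_ex[OF ex_common_eigenvalue])
  then show "ev \<noteq> 0" "v \<in> V0 \<Longrightarrow> f v = smul ev v" by blast+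
qed

definition \<Psi> :: "(nat \<Rightarrow> 'a) \<Rightarrow> (nat \<Rightarrow> 'a)" where "\<Psi> v = smul (inverse ev) (f v)"

lemma \<Psi>_V0: "v \<in> V0 \<Longrightarrow> \<Psi> v = v"
  using ev by (simp add: \<Psi>_def)

lemma \<Psi>_smul: "v \<in> vecs N \<Longrightarrow> \<Psi> (smul a v) = smul (\<sigma> a) (\<Psi> v)"
  by (simp add: \<Psi>_def f_smul mult.commute)

lemma \<Psi>_add: "v \<in> vecs N \<Longrightarrow> w \<in> vecs N \<Longrightarrow> \<Psi> (v + w) = \<Psi> v + \<Psi> w"
  by (simp add: \<Psi>_def f_add vs.scale_right_distrib)

lemma f_\<Psi>: "f v = smul ev (\<Psi> v)"
  using ev(1) by (simp add: \<Psi>_def)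

text \<open>A maximal independent subset of \<open>V0\<close> has \<open>N\<close> elements, so its \<open>Fq\<close>-combinations already
  exhaust \<open>V0\<close>.\<close>

lemma ex_basis:
  "\<exists>B. finite B \<and> card B = N \<and> B \<subseteq> V0 \<and> vs.independent B
     \<and> (\<forall>c. (\<Sum>b\<in>B. smul (c b) b) \<in> V0 \<longrightarrow> (\<forall>b\<in>B. c b \<in> Fq))"
proof -
  obtain B where B: "B \<subseteq> V0" "vs.independent B" "V0 \<subseteq> vs.span B"
    using vs.maximal_independent_subset[of V0] by auto
  have fin: "finite B" using B(1) V0_sub finite_vecs finite_subset by metis
  have "vs.span B = vecs N"
    using B vs.span_mono[OF B(1)] vs.span_mono[OF B(3)] sp_V0 by (simp add: vs.span_span)
  then have "CARD('a) ^ card B = CARD('a) ^ N"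
    using card_span_independent[OF fin B(2)] card_vecs[of N, where ?'a = 'a] by simp
  then have cB: "card B = N" using power_inject_exp[OF card_gt_1] by blast
  let ?g = "\<lambda>c. \<Sum>b\<in>B. smul (c b) b"
  have uniq: "c b = d b" if "?g c = ?g d" "b \<in> B" for c d b
  proof -
    have "(\<Sum>b\<in>B. smul (c b - d b) b) = 0"
      using that(1) by (simp add: vs.scale_left_diff_distrib sum_subtractf)
    from vs.independentD[OF B(2) fin subset_refl this that(2)] show ?thesis by simp
  qed
  have "inj_on ?g (PiE B (\<lambda>_. Fq))"
  proof (rule inj_onI)
    fix c d assume cd: "c \<in> PiE B (\<lambda>_. Fq)" "d \<in> PiE B (\<lambda>_. Fq)" "?g c = ?g d"
    show "c = d" by (rule PiE_ext[OF cd(1,2)]) (rule uniq[OF cd(3)])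
  qed
  then have "card (?g ` PiE B (\<lambda>_. Fq)) = card Fq ^ N" by (simp add: card_image card_PiE fin cB)
  then have le: "card V0 \<le> card (?g ` PiE B (\<lambda>_. Fq))"
    using card_Fq_ge by (simp add: card_V0 power_mono)
  have "(\<Sum>b\<in>C. smul (c b) b) \<in> V0" if "finite C" "C \<subseteq> V0" "\<forall>b\<in>C. c b \<in> Fq" for C c
    using that by (induction C rule: finite_induct) (auto intro: V0_closed)
  then have "?g ` PiE B (\<lambda>_. Fq) \<subseteq> V0" using fin B(1) by auto
  then have im: "?g ` PiE B (\<lambda>_. Fq) = V0"
    using le finite_subset[OF V0_sub finite_vecs] card_seteq by blast
  have "c b \<in> Fq" if c: "?g c \<in> V0" and b: "b \<in> B" for c b
  proof -
    obtain d where d: "d \<in> PiE B (\<lambda>_. Fq)" "?g c = ?g d" using c im by auto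
    show ?thesis using uniq[OF d(2) b] PiE_mem[OF d(1) b] by simp
  qed
  then show ?thesis using fin cB B by blast
qed

text \<open>A vector fixed by \<open>\<Psi>\<close> spans a point fixed by \<open>f\<close>, and all
  these points come from \<open>V0\<close>.\<close>

lemma fixed_point_V0:
  assumes x: "x \<in> vecs N" "x \<noteq> 0" "\<Psi> x = x"
  shows "\<exists>u\<in>V0. \<exists>c. c \<noteq> 0 \<and> x = smul c u"
proof -
  have fx: "f (smul k x) = smul (\<sigma> k * ev) x" for k using x f_\<Psi>[of x] by (simp add: f_smul)
  have "f ` vs.span {x} = vs.span {x}"
  proof
    show "f ` vs.span {x} \<subseteq> vs.span {x}" by (auto simp: vs.span_singleton fx)
    show "vs.span {x} \<subseteq> f ` vs.span {x}"
    proof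
      fix y assume "y \<in> vs.span {x}"
      then obtain k where k: "y = smul k x" by (auto simp: vs.span_singleton)
      obtain k' where "\<sigma> k' = k / ev" using surj_\<sigma> by blast
      then have "y = f (smul k' x)" using k ev(1) by (simp add: fx)
      then show "y \<in> f ` vs.span {x}" by (auto simp: vs.span_singleton)
    qed
  qed
  then have "vs.span {x} \<in> fixpts N f" using x is_point_span by (simp add: fixpts_def)
  then obtain u where u: "u \<in> V0" "u \<noteq> 0" "vs.span {x} = vs.span {u}" using fixpts_iff by auto
  then have "x \<in> vs.span {u}" using vs.span_base[of x "{x}"] by simp
  then obtain c where "x = smul c u" by (auto simp: vs.span_singleton)
  then show ?thesis using u(1) x(2) by auto
qed

text \<open>For the converse, if \<open>\<sigma>\<close> fixes \<open>a\<close> and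
  \<open>b\<close>, \<open>b'\<close> are basis vectors in \<open>V0\<close>, then
  \<open>b + smul a b'\<close> is fixed, hence a multiple of some \<open>u\<close> in
  \<open>V0\<close>. The coordinates of \<open>u\<close> at \<open>b\<close> and \<open>b'\<close>
  lie in \<open>Fq\<close> and have ratio \<open>a\<close>.\<close>

lemma fix_\<sigma>: "\<sigma> a = a \<longleftrightarrow> a \<in> Fq"
proof
  assume a: "a \<in> Fq"
  obtain v where v: "v \<in> V0" "v \<noteq> 0" using ex_V0_outside[of 0] subspace_vecs vs.subspace_0 by fastforce
  have "smul (\<sigma> a) v = smul a v"
    using \<Psi>_V0[OF V0_closed(3)[OF a v(1)]] \<Psi>_smul[of v a] \<Psi>_V0[OF v(1)] v(1) V0_sub by auto
  then show "\<sigma> a = a" using v(2) by simp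
next
  assume a: "\<sigma> a = a"
  obtain B where B: "finite B" "card B = N" "B \<subseteq> V0" "vs.independent B"
    "\<And>c b. (\<Sum>b\<in>B. smul (c b) b) \<in> V0 \<Longrightarrow> b \<in> B \<Longrightarrow> c b \<in> Fq"
    using ex_basis by blast
  obtain b where b: "b \<in> B" using B(2) N2 by fastforce
  have "card (B - {b}) \<noteq> 0" using B(1,2) N2 b by simp
  then have "B - {b} \<noteq> {}" by (metis card.empty)
  then obtain b' where b': "b' \<in> B" "b' \<noteq> b" by auto
  have sum2: "(\<Sum>x\<in>B. smul (if x = b then c else if x = b' then d else 0) x) = smul c b + smul d b'" for c d
  proof -
    have "(\<Sum>x\<in>B. smul (if x = b then c else if x = b' then d else 0) x)
        = (\<Sum>x\<in>{b, b'}. smul (if x = b then c else if x = b' then d else 0) x)"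
      using b b' B(1) by (intro sum.mono_neutral_right) auto
    then show ?thesis using b'(2) by simp
  qed
  let ?x = "b + smul a b'"
  have bV: "b \<in> vecs N" "b' \<in> vecs N" using b b' B(3) V0_sub by auto
  have abV: "smul a b' \<in> vecs N" by (rule vs.subspace_scale[OF subspace_vecs bV(2)])
  have "\<Psi> b = b" "\<Psi> b' = b'" using b b' B(3) \<Psi>_V0 by auto
  then have "\<Psi> ?x = ?x" using bV abV a by (simp add: \<Psi>_add \<Psi>_smul)
  moreover have "?x \<in> vecs N" by (rule vs.subspace_add[OF subspace_vecs bV(1) abV])
  moreover have "?x \<noteq> 0"
  proof
    assume "?x = 0"
    then have "(\<Sum>x\<in>B. smul (if x = b then 1 else if x = b' then a else 0) x) = 0"
      unfolding sum2 by simp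
    from vs.independentD[OF B(4) B(1) subset_refl this b] show False by simp
  qed
  ultimately obtain u c where u: "u \<in> V0" "c \<noteq> 0" "?x = smul c u" using fixed_point_V0[of ?x] by auto
  have "u = smul (inverse c) ?x" unfolding u(3) using u(2) by simp
  then have "u = smul (inverse c) b + smul (inverse c * a) b'" by (simp add: vs.scale_right_distrib)
  then have "(\<Sum>x\<in>B. smul (if x = b then inverse c else if x = b' then inverse c * a else 0) x) \<in> V0"
    unfolding sum2 using u(1) by simp
  from B(5)[OF this b] B(5)[OF this b'(1)] have c: "inverse c \<in> Fq" "inverse c * a \<in> Fq"
    using b'(2) by auto
  have "inverse (inverse c) * (inverse c * a) \<in> Fq" by (rule FqD(4)[OF FqD(6)[OF c(1)] c(2)])
  then show "a \<in> Fq" using u(2) by (simp add: mult.assoc[symmetric])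
qed

lemma V0_iff: "v \<in> V0 \<longleftrightarrow> v \<in> vecs N \<and> \<Psi> v = v"
proof
  assume v: "v \<in> vecs N \<and> \<Psi> v = v"
  show "v \<in> V0"
  proof (cases "v = 0")
    case False
    then obtain u c where u: "u \<in> V0" "c \<noteq> 0" "v = smul c u" using fixed_point_V0 v by blast
    have u0: "u \<noteq> 0" using u(3) False by auto
    have "smul (\<sigma> c) u = smul c u" using v u \<Psi>_smul[of u c] \<Psi>_V0 V0_sub by auto
    then have "c \<in> Fq" using u0 fix_\<sigma> by simp
    then show ?thesis using u V0_closed(3) by simp
  qed (simp add: V0_closed)
qed (use V0_sub \<Psi>_V0 in auto)

lemma \<Psi>_vecs: "v \<in> vecs N \<Longrightarrow> \<Psi> v \<in> vecs N"
  unfolding \<Psi>_def by (rule vs.subspace_scale[OF subspace_vecs f_vecs])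

lemma semilin: "N = t * n \<Longrightarrow> semilin q t \<sigma> n N \<Psi> V0"
  by unfold_locales
    (use \<Psi>_vecs V0_iff in \<open>simp_all add: auto_\<sigma> fix_\<sigma> \<Psi>_add \<Psi>_smul sp_V0\<close>)

text \<open>Rescaling leaves the collineation unchanged: the factor \<open>ev\<close> is absorbed
  into the argument as its preimage under \<open>\<sigma>\<close>.\<close>

lemma image_f_eq:
  assumes "vs.subspace A" "A \<subseteq> vecs N"
  shows "f ` A = \<Psi> ` A"
proof -
  obtain c where c: "\<sigma> c = ev" using surj_\<sigma> by blast
  have c0: "c \<noteq> 0" using c ev(1) field_autoD(3)[OF auto_\<sigma>] by auto
  have 1: "f v = \<Psi> (smul c v)" if "v \<in> A" for v
    using that assms(2) c f_\<Psi>[of v] \<Psi>_smul[of v c] by auto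
  show ?thesis
  proof
    show "f ` A \<subseteq> \<Psi> ` A" using 1 vs.subspace_scale[OF assms(1)] by auto
    show "\<Psi> ` A \<subseteq> f ` A"
    proof clarify
      fix v assume v: "v \<in> A"
      have m: "smul (inverse c) v \<in> A" using v by (rule vs.subspace_scale[OF assms(1)])
      have "\<Psi> v = f (smul (inverse c) v)" using 1[OF m] c0 by simp
      then show "\<Psi> v \<in> f ` A" using m by auto
    qed
  qed
qed

end

section \<open>Projections of subgeometries\<close>

lemma span_Un_subspaces: "vs.subspace A \<Longrightarrow> vs.subspace B \<Longrightarrow> vs.span (A \<union> B) = A + B"
  using vs.span_Un[of A B] by (auto simp: vs.span_eq_iff[THEN iffD2] set_plus_def)

lemma subspace_set_plus: "vs.subspace A \<Longrightarrow> vs.subspace B \<Longrightarrow> vs.subspace (A + B)"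
  using span_Un_subspaces[of A B] vs.subspace_span[of "A \<union> B"] by simp

locale pseudoregulus_projection = subgeometry q t K "t * n" \<sigma> f V0
  for q t n and K :: "'a::{field,finite} itself" and \<sigma> f V0 +
  fixes W \<Gamma> U T1 T2 :: "(nat \<Rightarrow> 'a) set" and PR :: "(nat \<Rightarrow> 'a) set set"
  assumes n2: "n \<ge> 2" and t3: "t \<ge> 3"
    and W: "ksub (t * n) W" "card W = CARD('a) ^ (2 * n)"
    and U: "0 \<in> U" "U \<subseteq> W" "card U = q ^ (t * n)" "scattered q (t * n) U"
    and PR: "\<And>s. s \<in> PR \<Longrightarrow> ksub (t * n) s \<and> s \<subseteq> W \<and> card s = CARD('a) ^ 2 \<and> card (s \<inter> U) = q ^ t"
    and card_PR: "card PR = (q ^ (n * t) - 1) div (q ^ t - 1)"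
    and PR_inter: "\<And>s s'. s \<in> PR \<Longrightarrow> s' \<in> PR \<Longrightarrow> s \<noteq> s' \<Longrightarrow> s \<inter> s' = {0}"
    and T: "\<And>T. T \<in> {T1, T2} \<Longrightarrow> ksub (t * n) T \<and> T \<subseteq> W \<and> card T = CARD('a) ^ n
      \<and> (\<forall>P\<in>lin_set (t * n) U. \<not> P \<subseteq> T) \<and> (\<forall>s\<in>PR. s \<inter> T \<noteq> {0})"
    and T_neq: "T1 \<noteq> T2"
    and \<Gamma>: "ksub (t * n) \<Gamma>" "card \<Gamma> = CARD('a) ^ (n * (t - 2))"
    and \<Gamma>_fixpts: "\<And>P. P \<in> fixpts (t * n) f \<Longrightarrow> \<not> P \<subseteq> \<Gamma>"
    and \<Gamma>_W: "\<Gamma> \<inter> W = {0}"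
    and lin_set_eq: "lin_set (t * n) U = proj (t * n) f \<Gamma> W"
begin

abbreviation V :: "(nat \<Rightarrow> 'a) set" where "V \<equiv> vecs (t * n)"

lemma sub_W: "vs.subspace W" "W \<subseteq> V" and sub_\<Gamma>: "vs.subspace \<Gamma>" "\<Gamma> \<subseteq> V"
  using W(1) \<Gamma>(1) by (auto simp: ksub_iff)

lemma fin: "A \<subseteq> V \<Longrightarrow> finite A"
  using finite_subset finite_vecs by blast

lemma plus_subset: "A \<subseteq> V \<Longrightarrow> B \<subseteq> V \<Longrightarrow> A + B \<subseteq> V"
  by (auto elim!: set_plus_elim intro!: vs.subspace_add[OF subspace_vecs])

lemma card_\<Gamma>_plus:
  assumes "vs.subspace X" "X \<subseteq> W"
  shows "card (\<Gamma> + X) = card \<Gamma> * card X"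
proof (rule card_set_plus_direct)
  show "\<Gamma> \<inter> X = {0}" using assms \<Gamma>_W vs.subspace_0[OF sub_\<Gamma>(1)] vs.subspace_0[OF assms(1)] by blast
qed (use assms sub_\<Gamma> sub_W in \<open>auto intro: fin add_closed_subspace\<close>)

lemma \<Gamma>_plus_W: "\<Gamma> + W = V"
proof (rule card_subset_eq)
  have "n * (t - 2) + 2 * n = t * n" using t3 by (simp add: algebra_simps diff_mult_distrib2)
  then show "card (\<Gamma> + W) = card V"
    using card_\<Gamma>_plus[OF sub_W(1)] W(2) \<Gamma>(2) by (simp add: card_vecs power_add[symmetric])
qed (use plus_subset sub_\<Gamma>(2) sub_W(2) finite_vecs in auto)

definition pr :: "(nat \<Rightarrow> 'a) \<Rightarrow> (nat \<Rightarrow> 'a)" where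
  "pr x = (SOME w. w \<in> W \<and> x - w \<in> \<Gamma>)"

lemma pr: assumes "x \<in> V" shows "pr x \<in> W" "x - pr x \<in> \<Gamma>"
proof -
  obtain g w where "g \<in> \<Gamma>" "w \<in> W" "x = g + w"
    using assms \<Gamma>_plus_W by (metis set_plus_elim)
  then have "\<exists>w. w \<in> W \<and> x - w \<in> \<Gamma>" by (intro exI[of _ w]) simp
  then have "pr x \<in> W \<and> x - pr x \<in> \<Gamma>" unfolding pr_def by (rule someI_ex)
  then show "pr x \<in> W" "x - pr x \<in> \<Gamma>" by auto
qed

lemma pr_eq: assumes "x \<in> V" "w \<in> W" "x - w \<in> \<Gamma>" shows "pr x = w"
proof -
  have "pr x - w \<in> W" using vs.subspace_diff[OF sub_W(1) pr(1)[OF assms(1)] assms(2)] .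
  moreover have "pr x - w \<in> \<Gamma>"
    using vs.subspace_diff[OF sub_\<Gamma>(1) assms(3) pr(2)[OF assms(1)]] by simp
  ultimately have "pr x - w \<in> \<Gamma> \<inter> W" by simp
  then show ?thesis unfolding \<Gamma>_W by simp
qed

lemma pr_smul: assumes "x \<in> V" shows "pr (smul a x) = smul a (pr x)"
proof (rule pr_eq)
  show "smul a x - smul a (pr x) \<in> \<Gamma>"
    using vs.subspace_scale[OF sub_\<Gamma>(1) pr(2)[OF assms], of a] by (simp add: vs.scale_right_diff_distrib)
qed (use vs.subspace_scale[OF subspace_vecs assms] vs.subspace_scale[OF sub_W(1) pr(1)[OF assms]] in auto)

lemma V0_\<Gamma>: assumes "v \<in> V0" "v \<in> \<Gamma>" shows "v = 0"
proof (rule ccontr)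
  assume "v \<noteq> 0"
  then have "vs.span {v} \<in> fixpts (t * n) f" using assms(1) fixpts_iff by auto
  moreover have "vs.span {v} \<subseteq> \<Gamma>" using assms(2) sub_\<Gamma>(1) by (intro vs.span_minimal) auto
  ultimately show False using \<Gamma>_fixpts by blast
qed

lemma V0_V: "v \<in> V0 \<Longrightarrow> v \<in> V" using V0_sub by auto

lemma pr_nonzero: assumes "v \<in> V0" "v \<noteq> 0" shows "pr v \<noteq> 0"
  using pr(2)[OF V0_V[OF assms(1)]] V0_\<Gamma>[OF assms(1)] assms(2) by auto

lemma in_\<Gamma>_plus_iff:
  assumes "vs.subspace X" "X \<subseteq> W" "x \<in> V"
  shows "x \<in> \<Gamma> + X \<longleftrightarrow> pr x \<in> X"
proof
  assume "x \<in> \<Gamma> + X"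
  then obtain g w where "g \<in> \<Gamma>" "w \<in> X" "x = g + w" by (rule set_plus_elim)
  then show "pr x \<in> X" using pr_eq[of x w] assms by auto
next
  assume "pr x \<in> X"
  then have "(x - pr x) + pr x \<in> \<Gamma> + X" using pr(2)[OF assms(3)] by (intro set_plus_intro)
  then show "x \<in> \<Gamma> + X" by simp
qed

lemma proj_point:
  assumes v: "v \<in> V0"
  shows "kspan (t * n) (\<Gamma> \<union> vs.span {v}) \<inter> W = vs.span {pr v}"
proof -
  have sp: "vs.span {v} \<subseteq> V" using V0_V[OF v] by (intro vs.span_minimal subspace_vecs) auto
  have "kspan (t * n) (\<Gamma> \<union> vs.span {v}) = \<Gamma> + vs.span {v}"
    using sp sub_\<Gamma> by (simp add: kspan_eq span_Un_subspaces)
  moreover have "(\<Gamma> + vs.span {v}) \<inter> W = vs.span {pr v}"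
  proof
    show "(\<Gamma> + vs.span {v}) \<inter> W \<subseteq> vs.span {pr v}"
    proof
      fix x assume x: "x \<in> (\<Gamma> + vs.span {v}) \<inter> W"
      then obtain g k where g: "g \<in> \<Gamma>" "x = g + smul k v"
        by (auto elim!: set_plus_elim simp: vs.span_singleton)
      have "smul k v - x = - g" using g(2) by simp
      then have "smul k v - x \<in> \<Gamma>" using vs.subspace_neg[OF sub_\<Gamma>(1) g(1)] by simp
      then have "pr (smul k v) = x"
        using x vs.subspace_scale[OF subspace_vecs V0_V[OF v]] by (intro pr_eq) auto
      then show "x \<in> vs.span {pr v}" using pr_smul[OF V0_V[OF v]] by (auto simp: vs.span_singleton)
    qed
    show "vs.span {pr v} \<subseteq> (\<Gamma> + vs.span {v}) \<inter> W"
    proof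
      fix x assume "x \<in> vs.span {pr v}"
      then obtain k where k: "x = smul k (pr v)" by (auto simp: vs.span_singleton)
      have "- smul k (v - pr v) \<in> \<Gamma>"
        by (intro vs.subspace_neg vs.subspace_scale sub_\<Gamma>(1) pr(2) V0_V v)
      then have "- smul k (v - pr v) + smul k v \<in> \<Gamma> + vs.span {v}"
        by (rule set_plus_intro) (auto simp: vs.span_singleton)
      moreover have "- smul k (v - pr v) + smul k v = x" by (simp add: k vs.scale_right_diff_distrib)
      moreover have "x \<in> W" unfolding k by (intro vs.subspace_scale sub_W(1) pr(1) V0_V v)
      ultimately show "x \<in> (\<Gamma> + vs.span {v}) \<inter> W" by simp
    qed
  qed
  ultimately show ?thesis by simp
qed

abbreviation L :: "(nat \<Rightarrow> 'a) set set" where "L \<equiv> lin_set (t * n) U"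

lemma L_U: "L = (\<lambda>u. vs.span {u}) ` (U - {0})"
proof -
  have "kspan (t * n) {u} = vs.span {u}" if "u \<in> U" for u
    using that U(2) sub_W(2) by (intro kspan_single) auto
  then show ?thesis unfolding lin_set_def zvec_eq by blast
qed

lemma L_V0: "L = (\<lambda>v. vs.span {pr v}) ` (V0 - {0})"
proof -
  have "L = {kspan (t * n) (\<Gamma> \<union> P) \<inter> W | P. P \<in> fixpts (t * n) f}"
    unfolding lin_set_eq proj_def ..
  also have "\<dots> = (\<lambda>v. vs.span {pr v}) ` (V0 - {0})"
    using proj_point by (force simp: fixpts_iff image_iff)
  finally show ?thesis .
qed

lemma fibre_U:
  assumes "P \<in> L" shows "card {u \<in> U - {0}. vs.span {u} = P} = q - 1"
proof -
  obtain u where u: "u \<in> U" "u \<noteq> 0" "P = vs.span {u}" using assms by (auto simp: L_U)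
  have "{u' \<in> U - {0}. vs.span {u'} = P} = (vs.span {u} \<inter> U) - {0}"
    unfolding u(3) using span_singleton_eqI vs.span_base by blast
  moreover have "card (vs.span {u} \<inter> U) = q"
  proof -
    have "u \<in> V" using u(1) U(2) sub_W(2) by auto
    moreover have "card (kspan (t * n) {u} \<inter> U) = q"
      using U(4) u(1,2) unfolding scattered_def zvec_eq by blast
    ultimately show ?thesis by (simp only: kspan_single)
  qed
  ultimately show ?thesis using U(1) vs.span_zero[of "{u}"] by (simp add: card_Diff_singleton)
qed

lemma card_preimage_U: "M \<subseteq> L \<Longrightarrow> card {u \<in> U - {0}. vs.span {u} \<in> M} = (q - 1) * card M"
  using fibre_U fin[OF order_trans[OF U(2) sub_W(2)]]
  by (intro card_preimage_fibres) (auto simp: L_U)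

lemma fin_V0: "finite V0" by (rule fin[OF V0_sub])

lemma card_L: "(q - 1) * card L = q ^ (t * n) - 1"
proof -
  have "{u \<in> U - {0}. vs.span {u} \<in> L} = U - {0}" by (auto simp: L_U)
  then show ?thesis using card_preimage_U[of L] U(1,3) by simp
qed

text \<open>\<open>V0\<close> and \<open>U\<close> have the same size, so \<open>V0\<close> maps onto a scattered subspace as well.\<close>

lemma fibre_V0:
  assumes v: "v \<in> V0" "v \<noteq> 0"
  shows "{w \<in> V0 - {0}. vs.span {pr w} = vs.span {pr v}} = (\<lambda>k. smul k v) ` (Fq - {0})"
    and "card {w \<in> V0 - {0}. vs.span {pr w} = vs.span {pr v}} = q - 1"
proof -
  let ?fib = "\<lambda>P. {w \<in> V0 - {0}. vs.span {pr w} = P}"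
  have sub: "(\<lambda>k. smul k v) ` (Fq - {0}) \<subseteq> ?fib (vs.span {pr v})" if v: "v \<in> V0" "v \<noteq> 0" for v
  proof clarify
    fix k assume k: "k \<in> Fq" "k \<noteq> 0"
    have "vs.span {smul k (pr v)} = vs.span {pr v}"
      using pr_nonzero[OF v] k(2) by (intro span_singleton_eqI) (auto simp: vs.span_singleton)
    then show "smul k v \<in> V0 - {0} \<and> vs.span {pr (smul k v)} = vs.span {pr v}"
      using V0_closed(3)[OF k(1) v(1)] k(2) v pr_smul[OF V0_V] by simp
  qed
  have card_im: "q - 1 \<le> card ((\<lambda>k. smul k v) ` (Fq - {0}))" if "v \<noteq> 0" for v :: "nat \<Rightarrow> 'a"
  proof -
    have "inj_on (\<lambda>k. smul k v) (Fq - {0})" using that by (intro inj_onI) simp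
    then have "card ((\<lambda>k. smul k v) ` (Fq - {0})) = card (Fq - {0})" by (rule card_image)
    also have "\<dots> = card Fq - 1" using FqD(1) by simp
    finally show ?thesis using card_Fq_ge by simp
  qed
  have ge: "q - 1 \<le> card (?fib P)" if "P \<in> L" for P
  proof -
    obtain w where w: "w \<in> V0" "w \<noteq> 0" "P = vs.span {pr w}" using \<open>P \<in> L\<close> by (auto simp: L_V0)
    have "card ((\<lambda>k. smul k w) ` (Fq - {0})) \<le> card (?fib P)"
      using sub[OF w(1,2)] fin_V0 by (intro card_mono) (auto simp: w(3))
    then show ?thesis using card_im[OF w(2)] by linarith
  qed
  \<comment> \<open>The fibres have at least \<open>q - 1\<close> elements each, and their total is
    \<open>(q - 1) * card L\<close>, since \<open>V0\<close> and \<open>U\<close> are equally large.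
    Hence no fibre is larger.\<close>
  have "card (V0 - {0}) = (\<Sum>P\<in>L. card (?fib P))"
    using sum.image_gen[of "V0 - {0}" "\<lambda>_. 1::nat" "\<lambda>v. vs.span {pr v}"] fin_V0 by (simp add: L_V0)
  then have "(\<Sum>P\<in>L. q - 1) = (\<Sum>P\<in>L. card (?fib P))"
    using card_L card_V0 V0_closed(1) by (simp add: mult.commute)
  moreover have "finite L" unfolding L_V0 using fin_V0 by simp
  ultimately have eq: "card (?fib P) = q - 1" if "P \<in> L" for P
    using sum_mono_inv[of "\<lambda>_. q - 1" L "\<lambda>P. card (?fib P)" P] ge that by simp
  have vL: "vs.span {pr v} \<in> L" using v by (auto simp: L_V0)
  show "card (?fib (vs.span {pr v})) = q - 1" by (rule eq[OF vL])
  then show "?fib (vs.span {pr v}) = (\<lambda>k. smul k v) ` (Fq - {0})"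
    using card_seteq[OF _ sub[OF v]] card_im[OF v(2)] fin_V0 by simp
qed

lemma card_preimage_V0: "M \<subseteq> L \<Longrightarrow> card {v \<in> V0 - {0}. vs.span {pr v} \<in> M} = (q - 1) * card M"
  using fibre_V0(2) fin_V0 by (intro card_preimage_fibres) (auto simp: L_V0)

lemma V0_scattered:
  assumes v: "v \<in> V0" "v' \<in> V0" "v \<noteq> 0" and a: "smul a v - v' \<in> \<Gamma>"
  shows "a \<in> Fq"
proof (cases "a = 0")
  case False
  have "pr (smul a v) = pr v'"
  proof (rule pr_eq)
    have "(smul a v - v') + (v' - pr v') \<in> \<Gamma>"
      by (intro vs.subspace_add[OF sub_\<Gamma>(1)] a pr(2) V0_V v(2))
    then show "smul a v - pr v' \<in> \<Gamma>" by simp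
  qed (use pr(1)[OF V0_V[OF v(2)]] vs.subspace_scale[OF subspace_vecs V0_V[OF v(1)]] in auto)
  then have p: "pr v' = smul a (pr v)" using pr_smul[OF V0_V[OF v(1)]] by simp
  then have p0: "pr v' \<noteq> 0" using False pr_nonzero[OF v(1,3)] by simp
  then have "v' \<noteq> 0" using pr_eq[of 0 0] vs.subspace_0 sub_W(1) sub_\<Gamma>(1) subspace_vecs by force
  moreover have "vs.span {pr v'} = vs.span {pr v}"
    using p p0 by (intro span_singleton_eqI) (auto simp: vs.span_singleton)
  ultimately have "v' \<in> (\<lambda>k. smul k v) ` (Fq - {0})" using fibre_V0(1)[OF v(1,3)] v(2) by blast
  then obtain k where k: "k \<in> Fq" "v' = smul k v" by auto
  then have "smul a (pr v) = smul k (pr v)" using p pr_smul[OF V0_V[OF v(1)], of k] by metis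
  then have "a = k" using pr_nonzero[OF v(1,3)] by (simp add: vs.scale_cancel_right)
  then show ?thesis using k by simp
qed (simp add: FqD)

text \<open>Both sides are determined by the number of points of \<open>L\<close> inside
  \<open>X\<close>: over each lie \<open>q - 1\<close> nonzero vectors of \<open>U\<close> and
  equally many of \<open>V0\<close>. This transfers weights to fixed vectors.\<close>

lemma card_\<Gamma>_plus_V0:
  assumes X: "vs.subspace X" "X \<subseteq> W"
  shows "card ((\<Gamma> + X) \<inter> V0) = card (X \<inter> U)"
proof -
  let ?M = "{P \<in> L. P \<subseteq> X}"
  have sp: "vs.span {x} \<subseteq> X \<longleftrightarrow> x \<in> X" for x
    using vs.span_minimal[of "{x}" X] X(1) vs.span_base[of x "{x}"] by auto
  have "{u \<in> U - {0}. vs.span {u} \<in> ?M} = (X \<inter> U) - {0}"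
    using sp by (auto simp: L_U)
  then have 1: "card ((X \<inter> U) - {0}) = (q - 1) * card ?M" using card_preimage_U[of ?M] by auto
  have "{v \<in> V0 - {0}. vs.span {pr v} \<in> ?M} = ((\<Gamma> + X) \<inter> V0) - {0}"
    using sp in_\<Gamma>_plus_iff[OF X V0_V] by (auto simp: L_V0)
  then have 2: "card (((\<Gamma> + X) \<inter> V0) - {0}) = (q - 1) * card ?M" using card_preimage_V0[of ?M] by auto
  have z: "0 \<in> X \<inter> U" "0 \<in> (\<Gamma> + X) \<inter> V0"
    using U(1) vs.subspace_0[OF X(1)] V0_closed(1) vs.subspace_0[OF subspace_set_plus[OF sub_\<Gamma>(1) X(1)]]
    by auto
  have f: "finite (X \<inter> U)" "finite ((\<Gamma> + X) \<inter> V0)"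
    using fin_V0 fin[of "X \<inter> U"] X(2) sub_W(2) by auto
  show ?thesis using card_Suc_Diff1[OF f(1) z(1)] card_Suc_Diff1[OF f(2) z(2)] 1 2 by simp
qed

lemma \<Gamma>_plus_inter:
  assumes "vs.subspace X" "X \<subseteq> W" "vs.subspace Y" "Y \<subseteq> W"
  shows "(\<Gamma> + X) \<inter> (\<Gamma> + Y) = \<Gamma> + (X \<inter> Y)"
proof -
  have "x \<in> (\<Gamma> + X) \<inter> (\<Gamma> + Y) \<longleftrightarrow> x \<in> \<Gamma> + (X \<inter> Y)" if "x \<in> V" for x
    using in_\<Gamma>_plus_iff[OF assms(1,2) that] in_\<Gamma>_plus_iff[OF assms(3,4) that]
      in_\<Gamma>_plus_iff[OF vs.subspace_inter[OF assms(1,3)] _ that] assms(2) by auto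
  moreover have "\<Gamma> + X \<subseteq> V" "\<Gamma> + (X \<inter> Y) \<subseteq> V"
    using assms sub_\<Gamma>(2) sub_W(2) by (intro plus_subset; blast)+
  ultimately show ?thesis by blast
qed

lemma \<Gamma>_plus_subset: "vs.subspace X \<Longrightarrow> \<Gamma> \<subseteq> \<Gamma> + X"
  using vs.subspace_0[of X] set_zero_plus2[of X \<Gamma>] by (simp add: add.commute)

lemma \<Gamma>_plus_0: "\<Gamma> + {0} = \<Gamma>"
  by (auto simp: set_plus_def)

section \<open>The lifted pseudoregulus and its transversals\<close>

definition lifted_PR :: "(nat \<Rightarrow> 'a) set set" where "lifted_PR = (\<lambda>s. \<Gamma> + s) ` PR"

lemma PR_D:
  assumes "s \<in> PR"
  shows "vs.subspace s" "s \<subseteq> W" "card s = CARD('a) ^ 2" "card (s \<inter> U) = q ^ t"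
  using PR[OF assms] by (auto simp: ksub_iff)

lemma T_D:
  assumes "T \<in> {T1, T2}"
  shows "vs.subspace T" "T \<subseteq> W" "card T = CARD('a) ^ n" "P \<in> L \<Longrightarrow> \<not> P \<subseteq> T" "s \<in> PR \<Longrightarrow> s \<inter> T \<noteq> {0}"
  using T[OF assms] by (auto simp: ksub_iff)

text \<open>Away from zero the pieces are pairwise disjoint with \<open>q ^ t - 1\<close> vectors
  each, and the number of lines is exactly what fills \<open>V0\<close>.\<close>

lemma V0_cover: "V0 \<subseteq> \<Union>lifted_PR"
proof -
  let ?A = "\<lambda>s. ((\<Gamma> + s) \<inter> V0) - {0}"
  have finPR: "finite PR"
  proof (rule finite_subset)
    show "PR \<subseteq> Pow W" using PR_D(2) by auto
  qed (simp add: fin sub_W(2))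
  have z: "0 \<in> (\<Gamma> + s) \<inter> V0" if "s \<in> PR" for s
    using V0_closed(1) vs.subspace_0[OF subspace_set_plus[OF sub_\<Gamma>(1) PR_D(1)[OF that]]] by simp
  have cA: "card (?A s) = q ^ t - 1" if s: "s \<in> PR" for s
    using card_\<Gamma>_plus_V0[OF PR_D(1,2)[OF s]] PR_D(4)[OF s] z[OF s] fin_V0
    by (simp add: card_Diff_singleton)
  have disj: "?A s \<inter> ?A s' = {}" if "s \<in> PR" "s' \<in> PR" "s \<noteq> s'" for s s'
  proof -
    have "(\<Gamma> + s) \<inter> (\<Gamma> + s') = \<Gamma>"
      using \<Gamma>_plus_inter[OF PR_D(1,2)[OF that(1)] PR_D(1,2)[OF that(2)]] PR_inter[OF that] \<Gamma>_plus_0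
      by simp
    then show ?thesis using V0_\<Gamma> by blast
  qed
  have "card (\<Union>s\<in>PR. ?A s) = (\<Sum>s\<in>PR. card (?A s))"
    using finPR fin_V0 disj by (intro card_UN_disjoint) auto
  also have "\<dots> = card PR * (q ^ t - 1)" using cA by simp
  also have "\<dots> = q ^ (t * n) - 1"
  proof -
    have one: "1 \<le> q ^ i" for i using q_ge_2 by simp
    \<comment> \<open>The natural-number division in the number of lines has to be exact.\<close>
    have "int (q ^ t) - 1 dvd int (q ^ t) ^ n - 1"
      using power_diff_1_eq[of "int (q ^ t)" n] by (metis dvd_triv_left)
    then have "int (q ^ t - 1) dvd int (q ^ (t * n) - 1)"
      using one[of t] one[of "t * n"] by (simp add: power_mult of_nat_diff)
    then have "q ^ t - 1 dvd q ^ (t * n) - 1" by (simp only: int_dvd_int_iff)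
    then show ?thesis unfolding card_PR by (simp add: mult.commute[of n])
  qed
  finally have "card (\<Union>s\<in>PR. ?A s) = card (V0 - {0})"
    using card_V0 V0_closed(1) by simp
  then have eq: "(\<Union>s\<in>PR. ?A s) = V0 - {0}" using fin_V0 by (intro card_subset_eq) auto
  have "PR \<noteq> {}"
  proof
    assume "PR = {}"
    then have "V0 - {0} = {}" using eq by simp
    then show False using ex_V0_outside[OF vs.subspace_0[OF subspace_vecs]] vs.span_zero by auto
  qed
  then obtain s0 where s0: "s0 \<in> PR" by auto
  show ?thesis
  proof
    fix v assume v: "v \<in> V0"
    show "v \<in> \<Union>lifted_PR"
    proof (cases "v = 0")
      case True
      then show ?thesis using z[OF s0] s0 by (auto simp: lifted_PR_def)
    next
      case False
      then have "v \<in> (\<Union>s\<in>PR. ?A s)" unfolding eq using v by simp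
      then show ?thesis by (auto simp: lifted_PR_def)
    qed
  qed
qed

lemma lifted: "lifted_pseudoregulus q t \<sigma> n (t * n) \<Psi> V0 \<Gamma> (\<Gamma> + T1) (\<Gamma> + T2) lifted_PR"
proof -
  interpret sl: semilin q t K \<sigma> n "t * n" \<Psi> V0 by (rule semilin) simp
  show ?thesis
  proof unfold_locales
    show "n \<ge> 2" "t \<ge> 2" using n2 t3 by auto
    show "card \<Gamma> = CARD('a) ^ (n * (t - 2))" by (rule \<Gamma>(2))
    show "vs.subspace \<Gamma>" by (rule sub_\<Gamma>)
    show "a \<in> Fq" if "v \<in> V0" "v' \<in> V0" "v \<noteq> 0" "smul a v - v' \<in> \<Gamma>" for v v' a
      using V0_scattered that by blast
    show "V0 \<subseteq> \<Union>lifted_PR" by (rule V0_cover)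
    show "vs.subspace S \<and> S \<subseteq> vecs (t * n) \<and> \<Gamma> \<subseteq> S
      \<and> card S = CARD('a) ^ 2 * card \<Gamma> \<and> card (S \<inter> V0) = CARD('a)" if S: "S \<in> lifted_PR" for S
    proof -
      obtain s where s: "s \<in> PR" "S = \<Gamma> + s" using S by (auto simp: lifted_PR_def)
      note d = PR_D[OF s(1)]
      show ?thesis
        using subspace_set_plus[OF sub_\<Gamma>(1) d(1)] plus_subset[OF sub_\<Gamma>(2), of s] d sub_W(2)
          \<Gamma>_plus_subset[OF d(1)] card_\<Gamma>_plus[OF d(1,2)] card_\<Gamma>_plus_V0[OF d(1,2)] card_field
        by (simp add: s(2) mult.commute subset_trans)
    qed
    show "S \<inter> S' = \<Gamma>" if S: "S \<in> lifted_PR" "S' \<in> lifted_PR" "S \<noteq> S'" for S S'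
    proof -
      obtain s s' where s: "s \<in> PR" "S = \<Gamma> + s" and s': "s' \<in> PR" "S' = \<Gamma> + s'"
        using S(1,2) by (auto simp: lifted_PR_def)
      have "s \<noteq> s'" using S(3) s s' by auto
      then show ?thesis
        using \<Gamma>_plus_inter[OF PR_D(1,2)[OF s(1)] PR_D(1,2)[OF s'(1)]] PR_inter[OF s(1) s'(1)]
        by (simp add: s(2) s'(2) \<Gamma>_plus_0)
    qed
    show "vs.subspace H \<and> H \<subseteq> vecs (t * n) \<and> \<Gamma> \<subseteq> H \<and> card H = CARD('a) ^ n * card \<Gamma>
        \<and> H \<inter> V0 = {0} \<and> (\<forall>S\<in>lifted_PR. S \<inter> H \<noteq> \<Gamma>)" if H: "H \<in> {\<Gamma> + T1, \<Gamma> + T2}" for H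
    proof -
      obtain T where T: "T \<in> {T1, T2}" "H = \<Gamma> + T" using H by auto
      note d = T_D[OF T(1)]
      have "T \<inter> U = {0}"
      proof -
        have "u = 0" if u: "u \<in> T" "u \<in> U" for u
        proof (rule ccontr)
          assume "u \<noteq> 0"
          then have "vs.span {u} \<in> L" using u by (auto simp: L_U)
          moreover have "vs.span {u} \<subseteq> T" using u d(1) by (intro vs.span_minimal) auto
          ultimately show False using d(4) by blast
        qed
        then show ?thesis using U(1) vs.subspace_0[OF d(1)] by auto
      qed
      \<comment> \<open>Weight zero of the transversal in \<open>L\<close> becomes absence of
        nonzero fixed vectors.\<close>
      then have "card ((\<Gamma> + T) \<inter> V0) = 1" using card_\<Gamma>_plus_V0[OF d(1,2)] by simp
      moreover have "0 \<in> (\<Gamma> + T) \<inter> V0"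
        using V0_closed(1) vs.subspace_0[OF subspace_set_plus[OF sub_\<Gamma>(1) d(1)]] by simp
      ultimately have HV0: "(\<Gamma> + T) \<inter> V0 = {0}" by (metis card_1_singletonE singletonD)
      have neq: "(\<Gamma> + s) \<inter> (\<Gamma> + T) \<noteq> \<Gamma>" if s: "s \<in> PR" for s
      proof
        assume eq: "(\<Gamma> + s) \<inter> (\<Gamma> + T) = \<Gamma>"
        have "s \<inter> T \<subseteq> \<Gamma>"
          using eq set_zero_plus2[OF vs.subspace_0[OF sub_\<Gamma>(1)], of s]
            set_zero_plus2[OF vs.subspace_0[OF sub_\<Gamma>(1)], of T] by blast
        then have "s \<inter> T \<subseteq> {0}" using \<Gamma>_W d(2) by blast
        then show False using d(5)[OF s] vs.subspace_0[OF d(1)] vs.subspace_0[OF PR_D(1)[OF s]] by blast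
      qed
      have "\<forall>S\<in>lifted_PR. S \<inter> H \<noteq> \<Gamma>" using neq by (auto simp: lifted_PR_def T(2))
      then show ?thesis
        using subspace_set_plus[OF sub_\<Gamma>(1) d(1)] plus_subset[OF sub_\<Gamma>(2), of T] d(2,3) sub_W(2)
          \<Gamma>_plus_subset[OF d(1)] card_\<Gamma>_plus[OF d(1,2)] HV0
        by (simp add: T(2) mult.commute subset_trans)
    qed
    show "\<Gamma> + T1 \<noteq> \<Gamma> + T2"
    proof -
      have T_eq: "T = {w \<in> W. w \<in> \<Gamma> + T}" if "T \<in> {T1, T2}" for T
      proof -
        note d = T_D[OF that]
        have "w \<in> \<Gamma> + T \<longleftrightarrow> w \<in> T" if "w \<in> W" for w
          using in_\<Gamma>_plus_iff[OF d(1,2), of w] pr_eq[of w w] that sub_W(2) vs.subspace_0[OF sub_\<Gamma>(1)]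
          by auto
        then show ?thesis using d(2) by auto
      qed
      show ?thesis using T_eq[of T1] T_eq[of T2] T_neq by auto
    qed
  qed
qed

sublocale lifted: lifted_pseudoregulus q t K \<sigma> n "t * n" \<Psi> V0 \<Gamma> "\<Gamma> + T1" "\<Gamma> + T2" lifted_PR
  by (rule lifted)

section \<open>Return from \<open>\<Psi>\<close> to the given collineation\<close>

lemma image_f_pow:
  assumes "vs.subspace A" "A \<subseteq> vecs (t * n)"
  shows "(f ^^ i) ` A = (\<Psi> ^^ i) ` A"
proof (induction i)
  case (Suc i)
  have "(f ^^ Suc i) ` A = f ` (f ^^ i) ` A" by (simp add: image_comp)
  also have "\<dots> = f ` (\<Psi> ^^ i) ` A" by (simp only: Suc)
  also have "\<dots> = \<Psi> ` (\<Psi> ^^ i) ` A"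
    by (rule image_f_eq[OF lifted.subspace_pow[OF assms] lifted.pow_subset[OF assms(2)]])
  also have "\<dots> = (\<Psi> ^^ Suc i) ` A" by (simp add: image_comp)
  finally show ?case .
qed simp

lemma kspan_conj:
  assumes "vs.subspace A" "A \<subseteq> vecs (t * n)"
  shows "kspan (t * n) (\<Union>i\<in>I. (f ^^ e i) ` A) = vs.span (\<Union>i\<in>I. (\<Psi> ^^ e i) ` A)"
  unfolding image_f_pow[OF assms] using lifted.pow_subset[OF assms(2)] by (intro kspan_eq) blast

lemma director_ok_\<Theta>: "director_ok (t * n) f t n lifted.\<Theta>"
  using lifted.subspace_\<Theta> lifted.\<Theta>_subset lifted.card_\<Theta> lifted.span_conj_\<Theta> kspan_conj[OF lifted.subspace_\<Theta> lifted.\<Theta>_subset, where I = "{..<t}" and e = "\<lambda>i. i"]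
  by (simp add: director_ok_def ksub_iff)

text \<open>A fixed point lies in a subspace as soon as a vector of \<open>V0\<close> spanning it
  does, so comparing fixed vectors is enough.\<close>

lemma sigma_part_eq:
  assumes "vs.subspace Y" "vs.subspace Y'" "\<And>v. v \<in> V0 \<Longrightarrow> v \<in> Y \<longleftrightarrow> v \<in> Y'"
  shows "sigma_part (t * n) f Y = sigma_part (t * n) f Y'"
proof -
  have sp: "vs.span {x} \<subseteq> X \<longleftrightarrow> x \<in> X" if "vs.subspace X" for x X
    using vs.span_minimal[of "{x}" X] that vs.span_base[of x "{x}"] by auto
  have "P \<subseteq> Y \<longleftrightarrow> P \<subseteq> Y'" if "P \<in> fixpts (t * n) f" for P
    using that assms sp by (auto simp: fixpts_iff)
  then show ?thesis unfolding sigma_part_def by blast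
qed

lemma sigma_part_S:
  assumes s: "s \<in> PR" and p: "p \<in> lifted.\<Theta>" "p \<noteq> 0" "lifted.tr p \<in> \<Gamma> + s"
  shows "sigma_part (t * n) f (kspan (t * n) (\<Gamma> \<union> s))
    = sigma_part (t * n) f (kspan (t * n) (\<Union>i<t. (f ^^ i) ` vs.span {p}))"
proof (rule sigma_part_eq)
  have sp: "vs.span {p} \<subseteq> vecs (t * n)"
    using p(1) lifted.\<Theta>_subset by (intro vs.span_minimal subspace_vecs) auto
  have S: "kspan (t * n) (\<Gamma> \<union> s) = \<Gamma> + s"
    using PR_D(1,2)[OF s] sub_\<Gamma> sub_W(2) by (simp add: kspan_eq span_Un_subspaces)
  have R: "kspan (t * n) (\<Union>i<t. (f ^^ i) ` vs.span {p}) = vs.span (\<Union>i<t. (\<Psi> ^^ i) ` vs.span {p})"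
    using kspan_conj[OF _ sp, where I = "{..<t}" and e = "\<lambda>i. i"] by simp
  show "vs.subspace (kspan (t * n) (\<Gamma> \<union> s))"
    unfolding S by (rule subspace_set_plus[OF sub_\<Gamma>(1) PR_D(1)[OF s]])
  show "vs.subspace (kspan (t * n) (\<Union>i<t. (f ^^ i) ` vs.span {p}))" unfolding R by simp
  show "v \<in> kspan (t * n) (\<Gamma> \<union> s) \<longleftrightarrow> v \<in> kspan (t * n) (\<Union>i<t. (f ^^ i) ` vs.span {p})"
    if "v \<in> V0" for v
    unfolding S R by (rule lifted.S_V0_iff[OF p(1,2) _ p(3) that]) (auto simp: lifted_PR_def s)
qed

text \<open>Traces match the two sides: every member of \<open>lifted_PR\<close> contains the trace
  of a nonzero vector of \<open>\<Theta>\<close>, and every such trace lies in a member.\<close>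

lemma DL_eq: "DL (t * n) f \<Gamma> PR = desarg_spread (t * n) f t lifted.\<Theta>"
proof
  show "DL (t * n) f \<Gamma> PR \<subseteq> desarg_spread (t * n) f t lifted.\<Theta>"
  proof
    fix X assume "X \<in> DL (t * n) f \<Gamma> PR"
    then obtain s where s: "s \<in> PR" "X = sigma_part (t * n) f (kspan (t * n) (\<Gamma> \<union> s))"
      by (auto simp: DL_def)
    obtain p where p: "p \<in> lifted.\<Theta>" "p \<noteq> 0" "lifted.tr p \<in> \<Gamma> + s"
      using lifted.ex_S_\<Theta>[of "\<Gamma> + s"] s(1) by (auto simp: lifted_PR_def)
    have "is_point (t * n) (vs.span {p})" using p lifted.\<Theta>_subset by (intro is_point_span) auto
    moreover have "vs.span {p} \<subseteq> lifted.\<Theta>" using p(1) lifted.subspace_\<Theta> by (intro vs.span_minimal) auto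
    ultimately show "X \<in> desarg_spread (t * n) f t lifted.\<Theta>"
      unfolding desarg_spread_def s(2) sigma_part_S[OF s(1) p] by blast
  qed
  show "desarg_spread (t * n) f t lifted.\<Theta> \<subseteq> DL (t * n) f \<Gamma> PR"
  proof
    fix X assume "X \<in> desarg_spread (t * n) f t lifted.\<Theta>"
    then obtain P where P: "is_point (t * n) P" "P \<subseteq> lifted.\<Theta>"
      "X = sigma_part (t * n) f (kspan (t * n) (\<Union>i<t. (f ^^ i) ` P))"
      by (auto simp: desarg_spread_def)
    obtain p where p: "p \<noteq> 0" "P = vs.span {p}" using P(1) by (rule is_pointE)
    have p\<Theta>: "p \<in> lifted.\<Theta>" using P(2) p(2) vs.span_base[of p "{p}"] by auto
    obtain s where s: "s \<in> PR" "lifted.tr p \<in> \<Gamma> + s" using lifted.ex_\<Theta>_S[OF p\<Theta>] by (auto simp: lifted_PR_def)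
    show "X \<in> DL (t * n) f \<Gamma> PR"
      unfolding P(3) p(2) sigma_part_S[OF s(1) p\<Theta> p(1) s(2), symmetric] DL_def using s(1) by blast
  qed
qed

lemma projection_theorem:
  "is_desarguesian (t * n) f t n (DL (t * n) f \<Gamma> PR)
    \<and> (\<exists>\<Theta>b m. is_director_space (t * n) f t n (DL (t * n) f \<Gamma> PR) \<Theta>b
          \<and> coprime m t
          \<and> \<Gamma> = kspan (t * n) (\<Union>i\<le>t - 3. (f ^^ (m * i)) ` \<Theta>b))"
proof -
  obtain j where j: "coprime j t" "\<Gamma> = vs.span (\<Union>i\<le>t - 3. (\<Psi> ^^ (j * i)) ` (\<Psi> ^^ (2 * j mod t)) ` lifted.\<Theta>)"
    using lifted.\<Gamma>_eq_span[OF t3] by blast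
  \<comment> \<open>The exponent is reduced modulo \<open>t\<close> because director spaces are
    conjugates with index below \<open>t\<close>.\<close>
  let ?\<Theta>b = "(f ^^ (2 * j mod t)) ` lifted.\<Theta>"
  have \<Theta>b: "?\<Theta>b = (\<Psi> ^^ (2 * j mod t)) ` lifted.\<Theta>" by (rule image_f_pow[OF lifted.subspace_\<Theta> lifted.\<Theta>_subset])
  have "is_director_space (t * n) f t n (DL (t * n) f \<Gamma> PR) ?\<Theta>b"
    unfolding is_director_space_def using director_ok_\<Theta> DL_eq t_pos mod_less_divisor by blast
  moreover have "\<Gamma> = kspan (t * n) (\<Union>i\<le>t - 3. (f ^^ (j * i)) ` ?\<Theta>b)"
    unfolding \<Theta>b using kspan_conj[OF lifted.conj_\<Theta>, where I = "{..t - 3}" and e = "\<lambda>i. j * i"] j(2) by simp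
  moreover have "is_desarguesian (t * n) f t n (DL (t * n) f \<Gamma> PR)"
    unfolding is_desarguesian_def using director_ok_\<Theta> DL_eq by blast
  ultimately show ?thesis using j(1) by blast
qed

end

theorem theorem3p11:
  fixes q n t :: nat
    and \<sigma> :: "'a::{field,finite} \<Rightarrow> 'a"
    and f :: "(nat \<Rightarrow> 'a) \<Rightarrow> (nat \<Rightarrow> 'a)"
    and W \<Gamma> U :: "(nat \<Rightarrow> 'a) set"
    and L PR :: "(nat \<Rightarrow> 'a) set set"
  assumes n2: "n \<ge> 2" and t3: "t \<ge> 3"
    and q_pp: "\<exists>p k. prime p \<and> k > 0 \<and> q = p ^ k"
    and card_field: "CARD('a) = q ^ t"
    and Psi_semilin: "semilinear (t * n) \<sigma> f"
    and Psi_order: "coll_order (t * n) f t"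
    and Sigma_sub: "canonical_subgeometry q (t * n) (fixpts (t * n) f)"
    and Lambda_sub: "ksub (t * n) W" "card W = CARD('a) ^ (2 * n)"
    and U_sub: "subsp_over (subfield_q q) (t * n) U" "U \<subseteq> W"
    and U_rank: "card U = q ^ (t * n)"
    and U_scat: "scattered q (t * n) U"
    and L_def: "L = lin_set (t * n) U"
    and PR_pseudo: "pseudoregulus q (t * n) t n W U PR"
    and Gamma_sub: "ksub (t * n) \<Gamma>" "card \<Gamma> = CARD('a) ^ (n * (t - 2))"
    and Gamma_Sigma: "\<forall>P \<in> fixpts (t * n) f. \<not> P \<subseteq> \<Gamma>"
    and Gamma_Lambda: "\<Gamma> \<inter> W = {zvec}"
    and L_proj: "L = proj (t * n) f \<Gamma> W"
  shows "is_desarguesian (t * n) f t n (DL (t * n) f \<Gamma> PR)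
       \<and> (\<exists>\<Theta>b m. is_director_space (t * n) f t n (DL (t * n) f \<Gamma> PR) \<Theta>b
             \<and> coprime m t
             \<and> \<Gamma> = kspan (t * n) (\<Union>i\<le>t - 3. (f ^^ (m * i)) ` \<Theta>b))"
proof -
  let ?N = "t * n"
  obtain V0 where V0: "subsp_over (subfield_q q) ?N V0" "card V0 = q ^ ?N" "kspan ?N V0 = vecs ?N"
    "fixpts ?N f = lin_set ?N V0"
    using Sigma_sub by (auto simp: canonical_subgeometry_def)
  let ?trans = "{T. ksub ?N T \<and> T \<subseteq> W \<and> card T = CARD('a) ^ n
    \<and> (\<forall>P\<in>lin_set ?N U. \<not> P \<subseteq> T) \<and> (\<forall>s\<in>PR. s \<inter> T \<noteq> {zvec})}"
  have "card ?trans = 2" using PR_pseudo by (simp add: pseudoregulus_def)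
  \<comment> \<open>That there are exactly two transversals is used as a pair of distinct subspaces,
    one for each structure on \<open>V0\<close>.\<close>
  then obtain T1 T2 where T12: "?trans = {T1, T2}" "T1 \<noteq> T2" by (auto simp: card_2_iff)
  interpret pseudoregulus_projection q t n "TYPE('a)" \<sigma> f V0 W \<Gamma> U T1 T2 PR
  proof unfold_locales
    show "t > 0" "n \<ge> 2" "t \<ge> 3" using t3 n2 by auto
    have "3 * 2 \<le> t * n" using t3 n2 by (rule mult_le_mono)
    then show "t * n \<ge> 2" by simp
    show "\<exists>p k. prime p \<and> k > 0 \<and> q = p ^ k" by (rule q_pp)
    show "0 \<in> U" using U_sub(1) by (simp add: subsp_over_def zvec_eq)
    show "ksub ?N s \<and> s \<subseteq> W \<and> card s = CARD('a) ^ 2 \<and> card (s \<inter> U) = q ^ t" if "s \<in> PR" for s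
      using PR_pseudo that by (simp add: pseudoregulus_def)
    show "s \<inter> s' = {0}" if "s \<in> PR" "s' \<in> PR" "s \<noteq> s'" for s s'
      using PR_pseudo that by (simp add: pseudoregulus_def zvec_eq)
    show "card PR = (q ^ (n * t) - 1) div (q ^ t - 1)"
      using PR_pseudo by (simp add: pseudoregulus_def)
    show "ksub ?N T \<and> T \<subseteq> W \<and> card T = CARD('a) ^ n
        \<and> (\<forall>P\<in>lin_set ?N U. \<not> P \<subseteq> T) \<and> (\<forall>s\<in>PR. s \<inter> T \<noteq> {0})" if T: "T \<in> {T1, T2}" for T
    proof -
      have "T \<in> ?trans" unfolding T12(1) by (rule T)
      then show ?thesis unfolding zvec_eq by simp
    qed
    show "T1 \<noteq> T2" by (rule T12(2))
    show "\<not> P \<subseteq> \<Gamma>" if "P \<in> fixpts ?N f" for P using Gamma_Sigma that by blast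
    show "\<Gamma> \<inter> W = {0}" using Gamma_Lambda by (simp add: zvec_eq)
    show "lin_set ?N U = proj ?N f \<Gamma> W" using L_def L_proj by simp
  qed (fact card_field Psi_semilin V0 Lambda_sub U_sub(2) U_rank U_scat Gamma_sub)+
  show ?thesis by (rule projection_theorem)
qed

end
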